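(* (1) If $\mathcal{R}' \subset \Pi_2$ is any set of six Leech roots forming a Coxeter–Dynkin diagram of type $A_2^{\oplus 2}\oplus A_1^{\oplus 2}$, then there is $\varphi \in \mathrm{Aut}(\mathcal{D})$ such that $\varphi(\mathcal{R}') = \mathcal{R}$, where $\mathcal{R}=\{c,z,x_0,r_0,x_1,x_2\}$; that is, up to $\mathrm{Aut}(\mathcal{D})$, $\mathcal{R}$ is the unique Coxeter–Dynkin diagram of type $A_2^{\oplus 2}\oplus A_1^{\oplus 2}$ formed by Leech roots. (2) The group $\mathrm{Aut}(\mathcal{D},\mathcal{R})$, the pointwise stabilizer of the set $\mathcal{R}$ in $\mathrm{Aut}(\mathcal{D})$, is isomorphic to the alternating group $A_6$ of degree $6$.
   Context: Leech lattice. Let $\Omega=\mathbf{P}^1(\mathbf{F}_{23})=\{\infty,0,1,\dots,22\}$ and regard the power set $2^\Omega$ as an $\mathbf{F}_2$-vector space under symmetric difference. Put $N=\Omega\setminus\{a^2 : a\in\mathbf{F}_{23}\}$, $N_\infty=\Omega$, $N_i=\{n-i : n\in N\}$ for $i\in\mathbf{F}_{23}$ (with $\infty-i=\infty$). The binary Golay code $\mathcal{C}$ is the span of the $N_i$ ($i\in\Omega$); its elements of cardinality $8$ are called octads. Let $\nu_i$ ($i\in\Omega$) be an orthonormal basis of Euclidean space $\mathbf{R}^{24}$ and $\nu_A=\sum_{i\in A}\nu_i$ for $A\subset\Omega$. The Leech lattice $\Lambda$ is the $\mathbf{Z}$-span of $2\nu_K$ ($K$ an octad) and $\nu_\Omega-4\nu_\infty$,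 with the form $(U,V)=-U\cdot V/8$; it is an even unimodular negative definite lattice of rank $24$ without vectors of norm $-2$. The lattice $\Pi$ and Leech roots. Let $U$ be the hyperbolic plane $\mathbf{Z}^2$ with $((l_1,m_1),(l_2,m_2))=l_1m_2+l_2m_1$, and $\Pi=\Lambda\oplus U$, the even unimodular lattice of signature $(1,25)$, with elements written $(\lambda,l,m)$. Let $w=(0,0,1)$ (Weyl vector). The set of Leech roots is $\Pi_2=\{r\in\Pi : (r^2)=-2,\ (r,w)=1\}$; each Leech root is uniquely of the form $(X,1,-\tfrac{X^2}{2}-1)$ with $X\in\Lambda$. Let $\mathcal{P}$ be the connected component of $\{v\in\Pi\otimes\mathbf{R} : (v^2)>0\}$ whose closure contains $w$, let $\mathcal{D}=\{v\in\mathcal{P} : (v,r)\ge 0\ \ \forall r\in\Pi_2\}$, and let $\mathrm{Aut}(\mathcal{D})$ be the group of isometries of $\Pi$ preserving $\mathcal{D}$. The set $\mathcal{R}$. Let $C=4\nu_\infty+\nu_\Omega$, $X_0=4\nu_\infty+4\nu_0$, $R_0=2\nu_{K_0}$, $X_1=2\nu_{K_1}$, $X_2=2\nu_{K_2}$ with octads $K_0=\{\infty,1,2,3,4,6,15,18\}$, $K_1=\{\infty,0,1,2,3,5,14,17\}$, $K_2=\{\infty,0,1,2,4,13,16,22\}$. Define Leech roots $c=(C,1,2)$, $z=(0,1,-1)$, $x_0=(X_0,1,1)$, $r_0=(R_0,1,1)$, $x_1=(X_1,1,1)$, $x_2=(X_2,1,1)$ and $\mathcal{R}=\{c,z,x_0,r_0,x_1,x_2\}$.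 They form a Coxeter–Dynkin diagram of type $A_2^{\oplus 2}\oplus A_1^{\oplus 2}$ with edges $c - z$ and $r_0 - x_0$, and $x_1,x_2$ isolated. Here two Leech roots are joined by a simple edge if their product is $1$ and are not joined if their product is $0$. *)

theory Defs
  imports "HOL-Analysis.Analysis" "HOL-Library.Numeral_Type"
    "HOL-Computational_Algebra.Group_Closure" "HOL-Algebra.Sym_Groups"
begin

text \<open>The type \<open>23\<close> is the ring of integers modulo 23; \<open>None\<close> is the point at infinity.\<close>

type_synonym P1 = "23 option"

abbreviation (input) infty :: P1  (\<open>\<infinity>\<^sub>P\<close>) where
  "\<infinity>\<^sub>P \<equiv> None"

definition golay_N :: "P1 set" where
  "golay_N = UNIV - {Some (a\<^sup>2) | a :: 23. True}"

fun golay_gen :: "P1 \<Rightarrow> P1 set" where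
  "golay_gen None = UNIV"
| "golay_gen (Some i) = map_option (\<lambda>n. n - i) ` golay_N"

text \<open>The span over the two-element field: the smallest set of subsets that contains the
  generators and is a subgroup under symmetric difference.\<close>

inductive_set golay_code :: "P1 set set" where
  empty: "{} \<in> golay_code"
| gen: "golay_gen i \<in> golay_code"
| add: "A \<in> golay_code \<Longrightarrow> B \<in> golay_code \<Longrightarrow> sym_diff A B \<in> golay_code"

definition octads :: "P1 set set" where
  "octads = {K \<in> golay_code. card K = 8}"

definition nu :: "P1 \<Rightarrow> real ^ P1" where
  "nu i = axis i 1"

definition nu_set :: "P1 set \<Rightarrow> real ^ P1" where
  "nu_set A = (\<Sum>i\<in>A. nu i)"

definition leech_lattice :: "(real ^ P1) set" where
  "leech_lattice =
     group_closure ({2 *\<^sub>R nu_set K | K. K \<in> octads} \<union> {nu_set UNIV - 4 *\<^sub>R nu \<infinity>\<^sub>P})"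

definition leech_form :: "real ^ P1 \<Rightarrow> real ^ P1 \<Rightarrow> real" where
  "leech_form x y = - (x \<bullet> y) / 8"

text \<open>The lattice is realised inside its real span: triples \<open>(\<lambda>, l, m)\<close> with
  \<open>\<lambda>\<close> in 24-dimensional Euclidean space and real \<open>l\<close>, \<open>m\<close>.\<close>

type_synonym amb = "(real ^ P1) \<times> real \<times> real"

fun Pi_form :: "amb \<Rightarrow> amb \<Rightarrow> real" where
  "Pi_form (x, l, m) (x', l', m') = leech_form x x' + (l * m' + l' * m)"

definition Pi_lattice :: "amb set" where
  "Pi_lattice = leech_lattice \<times> \<int> \<times> \<int>"

definition weyl :: amb where
  "weyl = (0, 0, 1)"

definition leech_roots :: "amb set" where
  "leech_roots = {r \<in> Pi_lattice. Pi_form r r = -2 \<and> Pi_form r weyl = 1}"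

definition pos_cone :: "amb set" where
  "pos_cone = (THE P. P \<in> components {v. Pi_form v v > 0} \<and> weyl \<in> closure P)"

definition domain_D :: "amb set" where
  "domain_D = {v \<in> pos_cone. \<forall>r\<in>leech_roots. Pi_form v r \<ge> 0}"

text \<open>Isometries of the lattice are represented by their unique linear extensions to the
  real span, on which \<^const>\<open>domain_D\<close> lives.\<close>

definition Aut_D_carrier :: "(amb \<Rightarrow> amb) set" where
  "Aut_D_carrier = {\<phi>. linear \<phi> \<and> (\<forall>u v. Pi_form (\<phi> u) (\<phi> v) = Pi_form u v)
     \<and> \<phi> ` Pi_lattice = Pi_lattice \<and> \<phi> ` domain_D = domain_D}"

definition Aut_D :: "(amb \<Rightarrow> amb) monoid" where
  "Aut_D = \<lparr> carrier = Aut_D_carrier, mult = (\<circ>), one = id \<rparr>"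

definition Aut_D_stab :: "amb set \<Rightarrow> (amb \<Rightarrow> amb) monoid" where
  "Aut_D_stab R = Aut_D \<lparr> carrier := {\<phi> \<in> carrier Aut_D. \<forall>r\<in>R. \<phi> r = r} \<rparr>"

text \<open>A set of Leech roots forms the diagram with nodes \<open>V\<close> and simple edges \<open>E\<close> (two-element
  subsets of \<open>V\<close>) if it can be labelled by \<open>V\<close> such that distinct roots have product 1 when
  their nodes are joined, and product 0 otherwise.\<close>

definition forms_diagram :: "nat set \<Rightarrow> nat set set \<Rightarrow> amb set \<Rightarrow> bool" where
  "forms_diagram V E S \<longleftrightarrow> S \<subseteq> leech_roots \<and>
     (\<exists>f. bij_betw f V S \<and>
       (\<forall>i\<in>V. \<forall>j\<in>V. i \<noteq> j \<longrightarrow> Pi_form (f i) (f j) = (if {i, j} \<in> E then 1 else 0)))"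

definition forms_A2A2A1A1 :: "amb set \<Rightarrow> bool" where
  "forms_A2A2A1A1 = forms_diagram {0..<6} {{0, 1}, {2, 3}}"

definition K0 :: "P1 set" where
  "K0 = insert \<infinity>\<^sub>P (Some ` {1, 2, 3, 4, 6, 15, 18})"

definition K1 :: "P1 set" where
  "K1 = insert \<infinity>\<^sub>P (Some ` {0, 1, 2, 3, 5, 14, 17})"

definition K2 :: "P1 set" where
  "K2 = insert \<infinity>\<^sub>P (Some ` {0, 1, 2, 4, 13, 16, 22})"

definition root_c :: amb where
  "root_c = (4 *\<^sub>R nu \<infinity>\<^sub>P + nu_set UNIV, 1, 2)"

definition root_z :: amb where
  "root_z = (0, 1, -1)"

definition root_x0 :: amb where
  "root_x0 = (4 *\<^sub>R nu \<infinity>\<^sub>P + 4 *\<^sub>R nu (Some 0), 1, 1)"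

definition root_r0 :: amb where
  "root_r0 = (2 *\<^sub>R nu_set K0, 1, 1)"

definition root_x1 :: amb where
  "root_x1 = (2 *\<^sub>R nu_set K1, 1, 1)"

definition root_x2 :: amb where
  "root_x2 = (2 *\<^sub>R nu_set K2, 1, 1)"

definition roots_R :: "amb set" where
  "roots_R = {root_c, root_z, root_x0, root_r0, root_x1, root_x2}"

end

theory Submission imports Defs begin

text \<open>A Leech root is determined by a point of the Leech lattice \<open>\<Lambda>\<close>, and the product of two Leech roots
  depends only on the squared distance of their points: it is 0 for squared distance 32 and 1 for
  squared distance 48 (\<open>Pi_form_roots\<close>; distances are taken in the standard scalar product of
  Euclidean space). A diagram of six roots is therefore a configuration of six lattice points with prescribed
  distances.

  The group of the fundamental domain acts on these points by the affine isometries of \<open>\<Lambda>\<close>.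
  Translations and linear automorphisms of \<open>\<Lambda>\<close> lift to isometries that fix the Weyl vector
  (\<open>translation_Aut_D\<close>, \<open>linear_lift_Aut_D\<close>). Conversely an isometry that preserves the domain permutes its
  walls, which are exactly the hyperplanes of the Leech roots (\<open>Aut_D_root\<close>); as the Weyl vector is the only
  vector that has product 1 with all of them, it is fixed (\<open>Aut_D_weyl\<close>). If moreover the root of the lattice
  point 0 is fixed, then the isometry comes from a linear automorphism of \<open>\<Lambda>\<close>
  (\<open>star_stabilizer_lift\<close>).

  Uniqueness is thus a statement about the Conway group \<open>co0\<close> of linear automorphisms, once one of the six points
  has been translated to 0. Four of the points, 0 and \<open>x, x', x''\<close>, have mutual squared distance 32.
  The group is transitive on vectors of squared length 32 (\<open>short_vec_transitive\<close>), so \<open>x\<close> may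
  be taken to have coordinates \<open>(4, 4, 0, ...)\<close>. The vector \<open>x + x' - x''\<close> has squared length 64, and
  product 32 with \<open>x\<close>; this restricts its coordinates so much that it can be moved to \<open>(8, 0, ...)\<close>
  by hand (\<open>to_frame\<close>). The three vectors \<open>x, x', x''\<close> are then \<open>(4, 4, 0)\<close>, \<open>(4, 0, 4)\<close> and
  \<open>(0, 4, 4)\<close> on three points of the projective line, and zero elsewhere. The products with them determine three
  coordinates of each of the two points that remain. One becomes \<open>(3, 3, 3, -1, ...)\<close> after a sign change on a
  codeword, and the other is then described by an octad that contains two of the three points. The
  automorphism group of the Golay code acts transitively on such data (\<open>golay_aut_transitive_octad\<close>),
  which gives the normal form \<open>stars\<close> (\<open>config_normal_form\<close>).

  An automorphism of \<open>\<Lambda>\<close> that fixes the points of the normal form fixes three of the 24 coordinate axes; this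
  forces it to permute the coordinates (\<open>star_stabilizer_monomial\<close>). What is left is the group of the
  permutations in \<open>M\<^sub>2\<^sub>4\<close> that preserve an octad, fix two of its points and one point outside. Such a
  permutation is determined by its action on the six other points of the octad (\<open>hexad_stab_rigid\<close>), all
  3-cycles of these points occur (\<open>hexad_stab_three_cycle\<close>) and no transposition does
  (\<open>hexad_stab_no_transposition\<close>), so the group is the alternating group (\<open>hexad_group_iso\<close>).

  The facts on the Golay code rest on a description by linear equations (\<open>golay_code_iff\<close>), by which
  membership of a codeword, or invariance under a permutation, is a finite computation on 24 bits. Transitivity
  is obtained from a few explicit permutations by computing orbits.\<close>

section \<open>Coordinates for the projective line\<close>

text \<open>The 24 points are numbered in the order \<open>0, ..., 22, \<infinity>\<close>, so that index 23 is the point at infinity. Sets of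
  points become lists of 24 bits, on which all finite checks are computed.\<close>

definition pt :: "nat \<Rightarrow> P1" where
  "pt k = (if k < 23 then Some (of_nat k) else None)"

lemma of_nat_23_eq: "(of_nat a :: 23) = of_nat b \<longleftrightarrow> a mod 23 = b mod 23"
proof -
  have *: "(of_nat a :: 23) = of_nat b \<longleftrightarrow> a mod 23 = b mod 23" if "a \<le> b" for a b
  proof -
    have "(of_nat a :: 23) = of_nat b \<longleftrightarrow> (of_nat (b - a) :: 23) = 0"
      using that by (auto simp: of_nat_diff)
    also have "\<dots> \<longleftrightarrow> 23 dvd b - a"
      by (simp add: of_nat_eq_0_iff_char_dvd)
    also have "\<dots> \<longleftrightarrow> a mod 23 = b mod 23"
      using mod_eq_dvd_iff_nat[OF that, of 23] by auto
    finally show ?thesis .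
  qed
  show ?thesis
    using *[of a b] *[of b a] by (cases "a \<le> b") auto
qed

lemma inj_on_pt: "inj_on pt {..<24}"
  by (auto simp: inj_on_def pt_def of_nat_23_eq split: if_splits)

lemma range_pt: "pt ` {..<24} = UNIV"
proof -
  have "card (pt ` {..<24}) = CARD(P1)"
    using inj_on_pt by (simp add: card_image)
  then show ?thesis
    by (metis card_subset_eq finite subset_UNIV)
qed

lemma pt_cases: obtains k where "k < 24" "x = pt k"
  using range_pt by (metis UNIV_I imageE lessThan_iff)

lemma pt_eq_iff: "k < 24 \<Longrightarrow> j < 24 \<Longrightarrow> pt k = pt j \<longleftrightarrow> k = j"
  using inj_on_pt by (auto simp: inj_on_def)

definition idx :: "P1 \<Rightarrow> nat" where
  "idx = inv_into {..<24} pt"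

lemma idx_pt: "k < 24 \<Longrightarrow> idx (pt k) = k"
  by (simp add: idx_def inv_into_f_f inj_on_pt)

lemma idx_less: "idx x < 24"
  by (metis idx_pt pt_cases)

lemma pt_idx: "pt (idx x) = x"
  by (metis idx_pt pt_cases)

definition bits :: "P1 set \<Rightarrow> bool list" where
  "bits A = map (\<lambda>k. pt k \<in> A) [0..<24]"

definition of_bits :: "bool list \<Rightarrow> P1 set" where
  "of_bits l = pt ` {k. k < 24 \<and> l ! k}"

lemma length_bits [simp]: "length (bits A) = 24"
  by (simp add: bits_def)

lemma nth_bits: "k < 24 \<Longrightarrow> bits A ! k \<longleftrightarrow> pt k \<in> A"
  by (simp add: bits_def)

lemma of_bits_bits [simp]: "of_bits (bits A) = A"
proof -
  have "of_bits (bits A) = pt ` {k. k < 24 \<and> pt k \<in> A}"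
    unfolding of_bits_def by (rule arg_cong[where f = "image pt"]) (auto simp: nth_bits)
  also have "\<dots> = A"
    by (auto simp: image_iff) (metis pt_cases)
  finally show ?thesis .
qed

lemma pt_in_of_bits: "k < 24 \<Longrightarrow> pt k \<in> of_bits l \<longleftrightarrow> l ! k"
  by (auto simp: of_bits_def pt_eq_iff)

lemma bits_of_bits: "length l = 24 \<Longrightarrow> bits (of_bits l) = l"
  by (rule nth_equalityI) (auto simp: nth_bits pt_in_of_bits)

lemma bits_inject: "bits A = bits B \<longleftrightarrow> A = B"
  by (metis of_bits_bits)

definition xor_word :: "bool list \<Rightarrow> bool list \<Rightarrow> bool list" where
  "xor_word l h = map2 (\<noteq>) l h"

lemma length_xor_word [simp]: "length (xor_word l h) = min (length l) (length h)"
  by (simp add: xor_word_def)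

lemma nth_xor_word: "k < length l \<Longrightarrow> k < length h \<Longrightarrow> xor_word l h ! k \<longleftrightarrow> l ! k \<noteq> h ! k"
  by (simp add: xor_word_def)

lemma bits_sym_diff: "bits (sym_diff A B) = xor_word (bits A) (bits B)"
  by (rule nth_equalityI) (auto simp: nth_bits nth_xor_word)

fun weight :: "bool list \<Rightarrow> nat" where
  "weight [] = 0"
| "weight (b # l) = (if b then Suc (weight l) else weight l)"

lemma weight_eq_card: "weight l = card {k. k < length l \<and> l ! k}"
proof (induction l)
  case (Cons b l)
  have "{k. k < length (b # l) \<and> (b # l) ! k} =
      (if b then {0} else {}) \<union> Suc ` {k. k < length l \<and> l ! k}"
    by (auto simp: less_Suc_eq_0_disj)
  then have "card {k. k < length (b # l) \<and> (b # l) ! k} = (if b then 1 else 0) + card {k. k < length l \<and> l ! k}"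
    by (simp add: card_insert_if card_image image_iff)
  then show ?case
    using Cons by auto
qed auto

lemma card_eq_weight: "card A = weight (bits A)"
proof -
  have "card A = card (pt ` {k. k < 24 \<and> bits A ! k})"
    by (metis of_bits_bits of_bits_def)
  also have "\<dots> = card {k. k < 24 \<and> bits A ! k}"
    by (rule card_image) (rule inj_on_subset[OF inj_on_pt], auto)
  finally show ?thesis
    by (simp add: weight_eq_card)
qed

definition points :: "nat list \<Rightarrow> bool list" where
  "points ks = map (\<lambda>k. k \<in> set ks) [0..<24]"

lemma length_points [simp]: "length (points ks) = 24"
  by (simp add: points_def)

lemma of_bits_points: "set ks \<subseteq> {..<24} \<Longrightarrow> of_bits (points ks) = pt ` set ks"
  unfolding of_bits_def points_def by (rule arg_cong[where f = "image pt"]) auto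

section \<open>The Golay code as its own dual\<close>

text \<open>The parity of the number of common points of two sets, see \<open>dot_bits\<close>.\<close>

fun dot :: "bool list \<Rightarrow> bool list \<Rightarrow> bool" where
  "dot (a # l) (b # h) = ((a \<and> b) \<noteq> dot l h)"
| "dot _ _ = False"

lemma dot_xor:
  "length l = length h \<Longrightarrow> length l' = length h \<Longrightarrow>
   dot h (xor_word l l') = (dot h l \<noteq> dot h l')"
  by (induction l h arbitrary: l' rule: list_induct2) (auto simp: length_Suc_conv xor_word_def)

lemma dot_eq_odd_weight: "length l = length h \<Longrightarrow> dot l h = odd (weight (map2 (\<and>) l h))"
  by (induction l h rule: list_induct2) auto

lemma dot_bits: "dot (bits A) (bits B) = odd (card (A \<inter> B))"
proof -
  have "map2 (\<and>) (bits A) (bits B) = bits (A \<inter> B)"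
    by (rule nth_equalityI) (auto simp: nth_bits)
  then show ?thesis
    by (simp add: dot_eq_odd_weight card_eq_weight)
qed

text \<open>These twelve octads are a basis of the code. Each is a translate of the first one, none wraps
  around modulo 23, and its least point is \<open>i\<close>; hence the basis is in echelon form. In terms of the
  generators, octad \<open>i\<close> is the sum of \<open>N\<^sub>-\<^sub>i\<close>, \<open>N\<^sub>3\<^sub>-\<^sub>i\<close> and \<open>N\<^sub>2\<^sub>2\<^sub>-\<^sub>i\<close>, see
  \<open>cyclic_octad_eq_gens\<close>.\<close>

definition cyclic_octad :: "nat \<Rightarrow> bool list" where
  "cyclic_octad i = points (23 # map ((+) i) [0, 2, 4, 5, 6, 10, 11])"

text \<open>The code is its own dual, so that membership is a system of twelve parity checks.\<close>

definition dual_word :: "bool list \<Rightarrow> bool" where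
  "dual_word l \<longleftrightarrow> list_all (\<lambda>i. \<not> dot (cyclic_octad i) l) [0..<12]"

text \<open>The bits of the generators; the listed residues are the squares modulo 23.\<close>

definition gen_word :: "nat \<Rightarrow> bool list" where
  "gen_word i = map (\<lambda>k. k = 23 \<or> (k + i) mod 23 \<notin> set [0, 1, 2, 3, 4, 6, 8, 9, 12, 13, 16, 18]) [0..<24]"

lemma squares_23: "(\<exists>a::23. of_nat n = a\<^sup>2) \<longleftrightarrow> n mod 23 \<in> {0, 1, 2, 3, 4, 6, 8, 9, 12, 13, 16, 18}"
proof -
  have surj: "\<exists>k<23. a = of_nat k" for a :: 23
  proof -
    obtain k where "k < 24" "Some a = pt k"
      using pt_cases by blast
    then show ?thesis
      by (auto simp: pt_def split: if_splits)
  qed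
  have "(\<exists>a::23. of_nat n = a\<^sup>2) \<longleftrightarrow> (\<exists>k<23. (of_nat n :: 23) = of_nat (k\<^sup>2))"
    using surj by (metis of_nat_power)
  also have "\<dots> \<longleftrightarrow> (\<exists>k\<in>{..<23}. n mod 23 = k\<^sup>2 mod 23)"
    unfolding of_nat_23_eq by blast
  \<comment> \<open>A finite check over all residues.\<close>
  also have "\<dots> \<longleftrightarrow> n mod 23 \<in> {0, 1, 2, 3, 4, 6, 8, 9, 12, 13, 16, 18}"
    by (simp add: lessThan_nat_numeral lessThan_Suc) argo
  finally show ?thesis .
qed

lemma Some_in_golay_N: "Some (of_nat n) \<in> golay_N \<longleftrightarrow> n mod 23 \<notin> {0, 1, 2, 3, 4, 6, 8, 9, 12, 13, 16, 18}"
  unfolding golay_N_def using squares_23[of n] by auto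

lemma bits_golay_gen: "bits (golay_gen (Some (of_nat i))) = gen_word i"
proof (rule nth_equalityI)
  fix k assume "k < length (bits (golay_gen (Some (of_nat i))))"
  then have k: "k < 24"
    by simp
  have Some: "Some x \<in> golay_gen (Some (of_nat i)) \<longleftrightarrow> Some (x + of_nat i) \<in> golay_N" for x :: 23
    by (force simp: image_iff map_option_case split: option.splits)
  have None: "None \<in> golay_gen (Some (of_nat i))"
    by (auto simp: image_iff golay_N_def intro!: bexI[of _ None])
  show "bits (golay_gen (Some (of_nat i))) ! k = gen_word i ! k"
  proof (cases "k < 23")
    case True
    then have "bits (golay_gen (Some (of_nat i))) ! k \<longleftrightarrow> Some (of_nat (k + i)) \<in> golay_N"
      using Some[of "of_nat k"] by (simp add: nth_bits pt_def)
    then show ?thesis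
      unfolding Some_in_golay_N using True k by (simp add: gen_word_def)
  next
    case False
    then show ?thesis
      using None k by (simp add: nth_bits pt_def gen_word_def)
  qed
qed (simp add: gen_word_def)

lemma dual_word_gens: "list_all (\<lambda>i. dual_word (gen_word i)) [0..<23] \<and> dual_word (points [0..<24])"
  by code_simp

definition zero_word :: "bool list" where
  "zero_word = replicate 24 False"

lemma bits_empty: "bits {} = zero_word"
  by (rule nth_equalityI) (auto simp: nth_bits zero_word_def)

lemma dual_word_zero: "dual_word zero_word"
  by code_simp

lemma length_cyclic_octad [simp]: "length (cyclic_octad i) = 24"
  by (simp add: cyclic_octad_def)

lemma dual_word_xor:
  "dual_word l \<Longrightarrow> dual_word l' \<Longrightarrow> length l = 24 \<Longrightarrow> length l' = 24 \<Longrightarrow> dual_word (xor_word l l')"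
  by (simp add: dual_word_def list_all_iff dot_xor)

lemma dual_word_cyclic_octad: "list_all (\<lambda>i. dual_word (cyclic_octad i)) [0..<12]"
  by code_simp

lemma cyclic_octad_triangular:
  "list_all (\<lambda>i. cyclic_octad i ! i \<and> list_all (\<lambda>k. \<not> cyclic_octad i ! k) [0..<i]) [0..<12]"
  by code_simp

lemma upt_0_24: "[0..<24] = [0, 1, 2, 3, 4, 5, 6, 7, 8, 9, 10, 11, 12, 13, 14, 15, 16, 17, 18, 19, 20, 21, 22, 23::nat]"
  by (simp add: upt_rec)

text \<open>The last twelve bits are eliminated one after the other, beginning with the point at infinity: the
  check of octad \<open>i\<close> involves, among the positions from 12 on, only infinity and positions up to
  \<open>i + 11\<close>.\<close>

lemma dual_word_eq_zero:
  assumes "dual_word l" "length l = 24" "\<forall>k<12. \<not> l ! k"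
  shows "l = zero_word"
proof -
  have "take 12 l = replicate 12 False"
    using assms by (intro nth_equalityI) auto
  moreover obtain r where r: "r = drop 12 l" "length r = 12"
    using assms by simp
  obtain a b c d e f g h i j k m where "r = [a, b, c, d, e, f, g, h, i, j, k, m]"
    using r(2) by (auto simp: length_Suc_conv numeral_eq_Suc)
  with r have "drop 12 l = [a, b, c, d, e, f, g, h, i, j, k, m]"
    by simp
  ultimately have l: "l = replicate 12 False @ [a, b, c, d, e, f, g, h, i, j, k, m]"
    by (metis append_take_drop_id)
  have dual: "\<not> dot (cyclic_octad n) l" if "n < 12" for n
    using assms(1) that by (simp add: dual_word_def list_all_iff)
  have "replicate 12 False = [False, False, False, False, False, False, False, False, False, False, False, False]"
    by (simp add: numeral_eq_Suc)
  note ev = l this cyclic_octad_def points_def upt_0_24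
  have m: "\<not> m" using dual[of 0] by (simp add: ev)
  have a: "\<not> a" using dual[of 1] m by (simp add: ev)
  have b: "\<not> b" using dual[of 2] m a by (simp add: ev)
  have c: "\<not> c" using dual[of 3] m a b by (simp add: ev)
  have d: "\<not> d" using dual[of 4] m a b c by (simp add: ev)
  have e: "\<not> e" using dual[of 5] m a b c d by (simp add: ev)
  have f: "\<not> f" using dual[of 6] m a b c d e by (simp add: ev)
  have g: "\<not> g" using dual[of 7] m a b c d e f by (simp add: ev)
  have h: "\<not> h" using dual[of 8] m a b c d e f g by (simp add: ev)
  have i: "\<not> i" using dual[of 9] m a b c d e f g h by (simp add: ev)
  have j: "\<not> j" using dual[of 10] m a b c d e f g h i by (simp add: ev)
  have k: "\<not> k" using dual[of 11] m a b c d e f g h i j by (simp add: ev)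
  note facts = m a b c d e f g h i j k
  then show ?thesis
    using facts unfolding l zero_word_def by (simp add: numeral_eq_Suc)
qed

text \<open>An induction principle for words in the dual: the echelon form allows the first twelve bits to be
  cleared with the basis, and then nothing remains by \<open>dual_word_eq_zero\<close>. With membership in the code
  for \<open>P\<close> it shows that the dual lies in the code.\<close>

lemma code_of_dual:
  assumes zero: "P zero_word"
    and gen: "\<And>i. i < 12 \<Longrightarrow> P (cyclic_octad i)"
    and xor: "\<And>l h. length l = 24 \<Longrightarrow> length h = 24 \<Longrightarrow> P l \<Longrightarrow> P h \<Longrightarrow> P (xor_word l h)"
    and l: "dual_word l" "length l = 24"
  shows "P l"
proof -
  have tri: "cyclic_octad i ! i" "k < i \<Longrightarrow> \<not> cyclic_octad i ! k" if "i < 12" for i k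
    using cyclic_octad_triangular that by (auto simp: list_all_iff)
  have "\<exists>h. length h = 24 \<and> dual_word h \<and> P h \<and> (\<forall>k<n. \<not> xor_word l h ! k)" if "n \<le> 12" for n
    using that
  proof (induction n)
    case 0
    then show ?case
      using zero dual_word_zero by (intro exI[of _ zero_word]) (auto simp: zero_word_def)
  next
    case (Suc n)
    then obtain h where h: "length h = 24" "dual_word h" "P h" "\<forall>k<n. \<not> xor_word l h ! k"
      by auto
    let ?h' = "xor_word h (cyclic_octad n)"
    show ?case
    proof (cases "xor_word l h ! n")
      case True
      have "dual_word ?h'"
        using h Suc.prems dual_word_cyclic_octad by (auto intro!: dual_word_xor simp: list_all_iff)
      moreover have "P ?h'"
        using h Suc.prems by (intro xor gen) auto
      moreover have "\<not> xor_word l ?h' ! k" if "k < Suc n" for k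
        using that h True l(2) tri[of n] Suc.prems by (cases "k = n") (auto simp: nth_xor_word)
      ultimately show ?thesis
        using h by (intro exI[of _ ?h']) auto
    next
      case False
      then show ?thesis
        using h by (intro exI[of _ h]) (auto simp: less_Suc_eq)
    qed
  qed
  from this[of 12] obtain h where h: "length h = 24" "dual_word h" "P h" "\<forall>k<12. \<not> xor_word l h ! k"
    by auto
  then have "xor_word l h = zero_word"
    using l by (intro dual_word_eq_zero dual_word_xor) auto
  moreover have "l = xor_word (xor_word l h) h" if "length l = 24" "length h = 24" for l h
    using that by (intro nth_equalityI) (auto simp: nth_xor_word)
  moreover have "h = xor_word zero_word h"
    using h(1) by (intro nth_equalityI) (auto simp: nth_xor_word zero_word_def)
  ultimately have "l = h"
    using l(2) h(1) by metis
  then show ?thesis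
    using h by simp
qed

lemma cyclic_octad_eq_gens:
  "list_all (\<lambda>i. cyclic_octad i =
     xor_word (gen_word ((23 - i) mod 23)) (xor_word (gen_word ((26 - i) mod 23)) (gen_word (22 - i)))) [0..<12]"
  by code_simp

theorem golay_code_iff: "A \<in> golay_code \<longleftrightarrow> dual_word (bits A)"
proof
  assume "A \<in> golay_code"
  then show "dual_word (bits A)"
  proof induction
    case empty
    then show ?case by (simp add: bits_empty dual_word_zero)
  next
    case (gen i)
    show ?case
    proof (cases i)
      case None
      have "bits UNIV = points [0..<24]"
        by (rule nth_equalityI) (auto simp: nth_bits points_def)
      then show ?thesis
        using dual_word_gens None by simp
    next
      case (Some j)
      then obtain k where "k < 24" "Some j = pt k"
        using pt_cases by blast
      then have "k < 23" "j = of_nat k"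
        by (auto simp: pt_def split: if_splits)
      then show ?thesis
        using dual_word_gens Some bits_golay_gen[of k] by (auto simp: list_all_iff)
    qed
  next
    case (add A B)
    then show ?case
      by (simp add: bits_sym_diff dual_word_xor)
  qed
next
  have gen: "of_bits (gen_word j) \<in> golay_code" for j
    using golay_code.gen[of "Some (of_nat j)"] bits_golay_gen[of j] by (metis of_bits_bits)
  have len: "length (gen_word j) = 24" for j
    by (simp add: gen_word_def)
  have xor: "of_bits (xor_word l h) \<in> golay_code"
    if "of_bits l \<in> golay_code" "of_bits h \<in> golay_code" "length l = 24" "length h = 24" for l h
  proof -
    have "of_bits (xor_word l h) = sym_diff (of_bits l) (of_bits h)"
      using that by (subst bits_inject[symmetric]) (simp add: bits_of_bits bits_sym_diff)
    then show ?thesis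
      using that golay_code.add by simp
  qed
  assume "dual_word (bits A)"
  then have "of_bits (bits A) \<in> golay_code"
  proof (rule code_of_dual[where P = "\<lambda>l. of_bits l \<in> golay_code", rotated 3])
    show "of_bits zero_word \<in> golay_code"
      using golay_code.empty by (metis bits_empty of_bits_bits)
    show "of_bits (cyclic_octad i) \<in> golay_code" if "i < 12" for i
      using cyclic_octad_eq_gens that by (auto simp: list_all_iff len intro!: xor gen)
  qed (auto intro: xor)
  then show "A \<in> golay_code"
    by simp
qed

lemma golay_code_induct [consumes 1, case_names empty cyclic sym_diff]:
  assumes "A \<in> golay_code" and "P {}" and "\<And>i. i < 12 \<Longrightarrow> P (of_bits (cyclic_octad i))"
    and "\<And>A B. P A \<Longrightarrow> P B \<Longrightarrow> P (sym_diff A B)"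
  shows "P A"
proof -
  have "P (of_bits (bits A))"
  proof (rule code_of_dual[where P = "\<lambda>l. P (of_bits l)"])
    show "P (of_bits zero_word)"
      using assms(2) by (metis bits_empty of_bits_bits)
    show "P (of_bits (xor_word l h))" if "length l = 24" "length h = 24" "P (of_bits l)" "P (of_bits h)" for l h
    proof -
      have "of_bits (xor_word l h) = sym_diff (of_bits l) (of_bits h)"
        using that by (subst bits_inject[symmetric]) (simp add: bits_of_bits bits_sym_diff)
      then show ?thesis
        using that assms(4) by simp
    qed
  qed (use assms golay_code_iff in auto)
  then show ?thesis
    by simp
qed

lemma of_bits_in_golay: "length l = 24 \<Longrightarrow> of_bits l \<in> golay_code \<longleftrightarrow> dual_word l"
  by (simp add: golay_code_iff bits_of_bits)

lemma cyclic_octad_in_golay: "i < 12 \<Longrightarrow> of_bits (cyclic_octad i) \<in> golay_code"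
  using dual_word_cyclic_octad by (auto simp: of_bits_in_golay list_all_iff)

lemma card_sym_diff:
  fixes A B :: "'a::finite set"
  shows "card (sym_diff A B) + 2 * card (A \<inter> B) = card A + card B"
proof -
  have "card (sym_diff A B) = card (A - B) + card (B - A)"
    by (rule card_Un_disjoint) auto
  moreover have "card A = card (A - B) + card (A \<inter> B)" "card B = card (B - A) + card (A \<inter> B)"
    by (subst card_Un_disjoint[symmetric]; force intro: arg_cong[where f = card])+
  ultimately show ?thesis
    by simp
qed

lemma golay_self_orthogonal:
  assumes "A \<in> golay_code" "B \<in> golay_code"
  shows "even (card (A \<inter> B))"
  using assms(1)
proof (induction rule: golay_code_induct)
  case (cyclic i)
  then show ?case
    using assms(2) dot_bits[of "of_bits (cyclic_octad i)" B]
    by (auto simp: golay_code_iff dual_word_def list_all_iff bits_of_bits)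
next
  case (sym_diff A A')
  have "sym_diff A A' \<inter> B = sym_diff (A \<inter> B) (A' \<inter> B)"
    by auto
  moreover have "card (sym_diff (A \<inter> B) (A' \<inter> B)) + 2 * card (A \<inter> B \<inter> (A' \<inter> B)) = card (A \<inter> B) + card (A' \<inter> B)"
    by (rule card_sym_diff)
  ultimately show ?case
    using sym_diff by presburger
qed auto

text \<open>The basis words have weight 8, and a sum of two words of weight divisible by 4 that meet in an even
  number of points again has weight divisible by 4.\<close>

lemma golay_doubly_even: "A \<in> golay_code \<Longrightarrow> 4 dvd card A"
proof -
  assume A: "A \<in> golay_code"
  then have "A \<in> golay_code \<and> 4 dvd card A"
  proof (induction rule: golay_code_induct)
    case (cyclic i)
    have "list_all (\<lambda>i. weight (cyclic_octad i) = 8) [0..<12]"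
      by code_simp
    with cyclic show ?case
      by (auto simp: cyclic_octad_in_golay card_eq_weight bits_of_bits list_all_iff)
  next
    case (sym_diff A B)
    then have "even (card (A \<inter> B))"
      using golay_self_orthogonal by blast
    then obtain a b c where "card (A \<inter> B) = 2 * a" "card A = 4 * b" "card B = 4 * c"
      using sym_diff by (metis dvdE)
    then have "card (sym_diff A B) = 4 * (b + c - a)"
      using card_sym_diff[of A B] by simp
    then show ?case
      using sym_diff golay_code.add by (metis dvd_triv_left)
  qed (auto intro: golay_code.empty)
  then show ?thesis
    by simp
qed

section \<open>Automorphisms of the Golay code\<close>

text \<open>The Mathieu group \<open>M\<^sub>2\<^sub>4\<close>. Preimages are used because they commute with symmetric differences for
  every map, and because the bits of a preimage are obtained from those of the set by reindexing.\<close>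

definition golay_aut :: "(P1 \<Rightarrow> P1) set" where
  "golay_aut = {\<sigma>. bij \<sigma> \<and> (\<forall>A. \<sigma> -` A \<in> golay_code \<longleftrightarrow> A \<in> golay_code)}"

lemma golay_autI:
  assumes "bij \<sigma>" "\<And>A. A \<in> golay_code \<Longrightarrow> \<sigma> -` A \<in> golay_code"
  shows "\<sigma> \<in> golay_aut"
proof -
  have inj: "inj_on ((-`) \<sigma>) golay_code"
    using assms(1) by (intro inj_onI) (metis bij_is_surj surj_image_vimage_eq)
  have "(-`) \<sigma> ` golay_code = golay_code"
    using assms(2) inj by (intro endo_inj_surj) auto
  then have "A \<in> golay_code" if "\<sigma> -` A \<in> golay_code" for A
    using that assms(1) by (metis bij_is_surj imageE surj_image_vimage_eq)
  with assms show ?thesis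
    unfolding golay_aut_def by blast
qed

lemma golay_aut_bij: "\<sigma> \<in> golay_aut \<Longrightarrow> bij \<sigma>"
  by (simp add: golay_aut_def)

lemma golay_aut_inj: "\<sigma> \<in> golay_aut \<Longrightarrow> \<sigma> x = \<sigma> y \<longleftrightarrow> x = y"
  using golay_aut_bij by (metis bij_pointE)

lemma golay_aut_vimage: "\<sigma> \<in> golay_aut \<Longrightarrow> \<sigma> -` A \<in> golay_code \<longleftrightarrow> A \<in> golay_code"
  by (simp add: golay_aut_def)

lemma golay_aut_image: "\<sigma> \<in> golay_aut \<Longrightarrow> \<sigma> ` A \<in> golay_code \<longleftrightarrow> A \<in> golay_code"
  using golay_aut_vimage[of \<sigma> "\<sigma> ` A"] golay_aut_bij[of \<sigma>] by (simp add: bij_is_inj inj_vimage_image_eq)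

lemma golay_aut_id: "id \<in> golay_aut"
  by (simp add: golay_aut_def)

lemma golay_aut_comp: "\<sigma> \<in> golay_aut \<Longrightarrow> \<tau> \<in> golay_aut \<Longrightarrow> \<sigma> \<circ> \<tau> \<in> golay_aut"
  by (simp add: golay_aut_def bij_comp vimage_comp[symmetric])

lemma golay_aut_inv: "\<sigma> \<in> golay_aut \<Longrightarrow> inv' \<sigma> \<in> golay_aut"
proof -
  assume \<sigma>: "\<sigma> \<in> golay_aut"
  have "inv' \<sigma> -` A = \<sigma> ` A" for A
    using golay_aut_bij[OF \<sigma>] by (metis bij_imp_bij_inv bij_vimage_eq_inv_image inv_inv_eq)
  then show ?thesis
    using \<sigma> by (intro golay_autI) (auto simp: golay_aut_bij bij_imp_bij_inv golay_aut_image)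
qed

text \<open>The permutation with a given list of images; a list is checked to give an element of \<open>M\<^sub>2\<^sub>4\<close> by
  computing the preimages of the basis (\<open>valid_perm\<close>).\<close>

definition perm :: "nat list \<Rightarrow> P1 \<Rightarrow> P1" where
  "perm L x = pt (L ! idx x)"

lemma perm_pt: "k < 24 \<Longrightarrow> perm L (pt k) = pt (L ! k)"
  by (simp add: perm_def idx_pt)

definition valid_perm :: "nat list \<Rightarrow> bool" where
  "valid_perm L \<longleftrightarrow> length L = 24 \<and> distinct L \<and> list_all (\<lambda>k. k < 24) L \<and>
     list_all (\<lambda>i. dual_word (map ((!) (cyclic_octad i)) L)) [0..<12]"

lemma bits_perm_vimage:
  assumes "length L = 24" "list_all (\<lambda>k. k < 24) L" "length l = 24"
  shows "bits (perm L -` of_bits l) = map ((!) l) L"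
  using assms by (intro nth_equalityI) (auto simp: nth_bits perm_pt pt_in_of_bits list_all_length)

lemma perm_in_golay_aut:
  assumes "valid_perm L"
  shows "perm L \<in> golay_aut"
proof (rule golay_autI)
  have L: "length L = 24" "distinct L" "list_all (\<lambda>k. k < 24) L"
    using assms by (auto simp: valid_perm_def)
  have "inj (perm L)"
  proof (rule injI)
    fix x y assume eq: "perm L x = perm L y"
    obtain j k where "j < 24" "x = pt j" "k < 24" "y = pt k"
      by (metis pt_cases)
    then show "x = y"
      using L eq by (auto simp: perm_pt list_all_length pt_eq_iff nth_eq_iff_index_eq)
  qed
  then show "bij (perm L)"
    by (simp add: bij_def finite_UNIV_inj_surj)
  fix A assume "A \<in> golay_code"
  then show "perm L -` A \<in> golay_code"
  proof (induction rule: golay_code_induct)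
    case (cyclic i)
    then show ?case
      using assms by (simp add: golay_code_iff bits_perm_vimage L valid_perm_def list_all_iff)
  next
    case (sym_diff A B)
    then show ?case
      using golay_code.add[of "perm L -` A" "perm L -` B"] by (simp add: vimage_Un vimage_Diff)
  qed (auto intro: golay_code.empty)
qed

text \<open>The next four permutations are the classical generators \<open>x + 1\<close>, \<open>2x\<close>, \<open>-1/x\<close> and the map that is \<open>x\<^sup>3\<close>
  on squares and \<open>12x\<^sup>3\<close> on non-squares.\<close>

definition p_shift :: "nat list" where
  "p_shift = [1, 2, 3, 4, 5, 6, 7, 8, 9, 10, 11, 12, 13, 14, 15, 16, 17, 18, 19, 20, 21, 22, 0, 23]"

definition p_double :: "nat list" where
  "p_double = [0, 2, 4, 6, 8, 10, 12, 14, 16, 18, 20, 22, 1, 3, 5, 7, 9, 11, 13, 15, 17, 19, 21, 23]"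

definition p_neginv :: "nat list" where
  "p_neginv = [23, 22, 11, 15, 17, 9, 19, 13, 20, 5, 16, 2, 21, 7, 18, 3, 10, 4, 14, 6, 8, 12, 1, 0]"

definition p_cube :: "nat list" where
  "p_cube = [0, 1, 8, 4, 18, 5, 9, 22, 6, 16, 17, 10, 3, 12, 15, 20, 2, 7, 13, 14, 21, 19, 11, 23]"

text \<open>Two permutations that fix the points \<open>\<infinity>, 0, 1, 2\<close>, and generate a group that is transitive on the octads which
  contain \<open>\<infinity>, 0\<close> but not \<open>1, 2\<close> (\<open>orbit_octads\<close>).\<close>

definition p_sext1 :: "nat list" where
  "p_sext1 = [0, 1, 2, 19, 8, 21, 4, 16, 20, 5, 3, 9, 15, 11, 6, 17, 12, 7, 10, 22, 14, 13, 18, 23]"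

definition p_sext2 :: "nat list" where
  "p_sext2 = [0, 1, 2, 12, 6, 11, 10, 15, 16, 3, 5, 4, 13, 19, 18, 14, 21, 8, 22, 9, 17, 20, 7, 23]"

text \<open>Two permutations that fix \<open>\<infinity>, 0, 1\<close> and preserve the octad \<open>{\<infinity>, 0, 3, 4, 5, 12, 13, 18}\<close>; on its other six
  points they are the cycles \<open>(3 4 5)\<close> and \<open>(4 5 12 13 18)\<close>, which generate the alternating group.\<close>

definition p_hex1 :: "nat list" where
  "p_hex1 = [0, 1, 11, 4, 5, 3, 16, 14, 2, 10, 22, 8, 12, 13, 20, 17, 21, 19, 18, 15, 7, 6, 9, 23]"

definition p_hex2 :: "nat list" where
  "p_hex2 = [0, 1, 22, 3, 5, 12, 9, 19, 16, 11, 7, 2, 13, 18, 15, 10, 20, 21, 4, 14, 17, 8, 6, 23]"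

lemma valid_perms:
  "list_all valid_perm [p_shift, p_double, p_neginv, p_cube, p_sext1, p_sext2, p_hex1, p_hex2]"
  by code_simp

section \<open>Orbits by breadth-first search\<close>

text \<open>The functions of this section are written for evaluation by rewriting. An argument that occurs
  twice in a result is passed to a function of its own, so that it is evaluated only once, and conjunctions
  are written as conditionals to stop early.\<close>

definition grow :: "'a list \<Rightarrow> 'a list \<Rightarrow> 'a list \<times> 'a list" where
  "grow N S = (N, N @ S)"

fun elem :: "'a \<Rightarrow> 'a list \<Rightarrow> bool" where
  "elem x [] = False"
| "elem x (y # ys) = (if x = y then True else elem x ys)"

lemma elem_iff: "elem x ys \<longleftrightarrow> x \<in> set ys"
  by (induction ys) auto

fun fresh :: "'a list \<Rightarrow> 'a list \<Rightarrow> 'a list" where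
  "fresh [] S = []"
| "fresh (x # xs) S = (if elem x S then fresh xs S else if elem x xs then fresh xs S else x # fresh xs S)"

lemma set_fresh: "set (fresh xs S) = set xs - set S"
  by (induction xs) (auto simp: elem_iff)

text \<open>One round of the search applies all maps to the frontier \<open>F\<close> of points found last, and adds what is
  new to the list \<open>S\<close> of all points found.\<close>

fun expand :: "('a \<Rightarrow> 'a) list \<Rightarrow> 'a list \<times> 'a list \<Rightarrow> 'a list \<times> 'a list" where
  "expand fs (F, S) = grow (fresh (concat (map (\<lambda>f. map f F) fs)) S) S"

fun expansions :: "('a \<Rightarrow> 'a) list \<Rightarrow> nat \<Rightarrow> 'a list \<times> 'a list \<Rightarrow> 'a list" where
  "expansions fs 0 FS = snd FS"
| "expansions fs (Suc n) FS = expansions fs n (expand fs FS)"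

definition reach :: "('a \<Rightarrow> 'a) list \<Rightarrow> nat \<Rightarrow> 'a list \<Rightarrow> 'a list" where
  "reach fs n S = expansions fs n (S, S)"

text \<open>Soundness of the search. That the search finds the whole orbit is seen in each case from the
  computed list, so a bound on the number of rounds is enough for termination.\<close>

lemma reach_invariant:
  assumes "x \<in> set (reach fs n S)" "\<And>s. s \<in> set S \<Longrightarrow> P s"
    and "\<And>f s. f \<in> set fs \<Longrightarrow> P s \<Longrightarrow> P (f s)"
  shows "P x"
proof -
  have "\<forall>x\<in>set (expansions fs n (F, S)). P x" if "\<forall>x\<in>set F \<union> set S. P x" for F S
    using that
  proof (induction n arbitrary: F S)
    case (Suc n)
    show ?case
      unfolding expansions.simps expand.simps grow_def
      by (rule Suc.IH) (use Suc.prems assms(3) in \<open>auto simp: set_fresh\<close>)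
  qed auto
  then show ?thesis
    using assms(1,2) unfolding reach_def by blast
qed

definition fixing :: "nat list \<Rightarrow> (P1 \<Rightarrow> P1) set" where
  "fixing F = {\<sigma> \<in> golay_aut. \<forall>j\<in>set F. \<sigma> (pt j) = pt j}"

definition perms_fixing :: "nat list list \<Rightarrow> nat list \<Rightarrow> bool" where
  "perms_fixing Ls F \<longleftrightarrow> list_all (\<lambda>j. j < 24 \<and> list_all (\<lambda>L. L ! j = j) Ls) F"

lemma perm_in_fixing: "valid_perm L \<Longrightarrow> L \<in> set Ls \<Longrightarrow> perms_fixing Ls F \<Longrightarrow> perm L \<in> fixing F"
  by (auto simp: fixing_def perms_fixing_def list_all_iff perm_in_golay_aut perm_pt)

lemma fixing_comp: "\<sigma> \<in> fixing F \<Longrightarrow> \<tau> \<in> fixing F \<Longrightarrow> \<sigma> \<circ> \<tau> \<in> fixing F"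
  by (auto simp: fixing_def golay_aut_comp)

lemma fixing_inv: "\<sigma> \<in> fixing F \<Longrightarrow> inv' \<sigma> \<in> fixing F"
  by (auto simp: fixing_def golay_aut_inv) (metis golay_aut_bij bij_inv_eq_iff)

lemma fixing_id: "id \<in> fixing F"
  by (simp add: fixing_def golay_aut_id)

lemma transitive_on_points:
  assumes "list_all valid_perm Ls" "perms_fixing Ls F" "t < 24"
    and "k \<in> set (reach (map (!) Ls) n [t])"
  shows "\<exists>\<sigma>\<in>fixing F. \<sigma> (pt k) = pt t"
proof -
  define P where "P k \<longleftrightarrow> k < 24 \<and> (\<exists>\<sigma>\<in>fixing F. \<sigma> (pt k) = pt t)" for k
  have "P k"
    using assms(4)
  proof (rule reach_invariant)
    show "P s" if "s \<in> set [t]" for s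
      using that assms(3) fixing_id by (auto simp: P_def intro: bexI[of _ id])
    fix f s assume "f \<in> set (map (!) Ls)" "P s"
    then obtain L \<sigma> where L: "L \<in> set Ls" "f = (!) L" and s: "s < 24" and \<sigma>: "\<sigma> \<in> fixing F" "\<sigma> (pt s) = pt t"
      by (auto simp: P_def)
    have valid: "valid_perm L"
      using assms(1) L by (auto simp: list_all_iff)
    then have *: "perm L \<in> fixing F"
      using assms(2) L by (intro perm_in_fixing)
    have "L ! s < 24"
      using s valid by (auto simp: valid_perm_def list_all_length)
    moreover have "inv' (perm L) (pt (L ! s)) = pt s"
      using * s by (metis (no_types, lifting) fixing_def golay_aut_bij bij_inv_eq_iff mem_Collect_eq perm_pt)
    ultimately show "P (f s)"
      unfolding P_def using L \<sigma> * by (auto intro!: bexI[of _ "\<sigma> \<circ> inv' (perm L)"] fixing_comp fixing_inv)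
  qed
  then show ?thesis
    by (auto simp: P_def)
qed

fun all_in :: "'a list \<Rightarrow> 'a list \<Rightarrow> bool" where
  "all_in [] ys = True"
| "all_in (x # xs) ys = (if elem x ys then all_in xs ys else False)"

lemma all_in_iff: "all_in xs ys \<longleftrightarrow> set xs \<subseteq> set ys"
  by (induction xs) (auto simp: elem_iff)

lemma orbit_23: "all_in [0..<24] (reach (map (!) [p_shift, p_neginv]) 23 [23])"
  by code_simp

lemma orbit_0: "all_in [0..<23] (reach (map (!) [p_shift]) 22 [0])" "perms_fixing [p_shift] [23]"
  by code_simp+

lemma orbit_1: "all_in [1..<23] (reach (map (!) [p_double, p_sext1, p_sext2, p_cube]) 8 [1])"
  "perms_fixing [p_double, p_sext1, p_sext2, p_cube] [23, 0]"
  by code_simp+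

lemma orbit_2: "all_in [2..<23] (reach (map (!) [p_sext1, p_sext2, p_cube]) 8 [2])"
  "perms_fixing [p_sext1, p_sext2, p_cube] [23, 0, 1]"
  by code_simp+

text \<open>An octad that contains \<open>\<infinity>, 0\<close> but not \<open>1, 2\<close>; it serves as the representative of its orbit.\<close>

definition std_octad :: "bool list" where
  "std_octad = points [0, 3, 4, 5, 12, 13, 18, 23]"

definition coset_union :: "bool list \<Rightarrow> bool list list \<Rightarrow> bool list list" where
  "coset_union w r = r @ map (xor_word w) r"

fun span_words :: "bool list list \<Rightarrow> bool list list" where
  "span_words [] = [zero_word]"
| "span_words (w # ws) = coset_union w (span_words ws)"

definition high_words :: "bool list list" where
  "high_words = span_words (map cyclic_octad [3..<12])"

text \<open>In \<open>orbit_octads\<close> this selects from a coset of \<open>high_words\<close>. Since the basis is in echelon form, the bits at 0, 1, 2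
  fix the coefficients of the first three basis words, and the words with bits 1, 0, 0 there form the coset through the
  sum of the basis words 0 and 2. What is selected are the octads that contain \<open>\<infinity>, 0\<close> but not \<open>1, 2\<close>.\<close>

definition base_pattern :: "bool list \<Rightarrow> bool" where
  "base_pattern l = (if l ! 23 then weight l = 8 else False)"

lemma orbit_octads:
  "all_in (filter base_pattern
       (map (xor_word (xor_word (cyclic_octad 0) (cyclic_octad 2))) high_words))
     (reach [\<lambda>l. map ((!) l) p_sext1, \<lambda>l. map ((!) l) p_sext2] 8 [std_octad])"
  by code_simp

section \<open>Transitivity on points and octads, and the minimum weight\<close>

lemma fixing_iff: "\<sigma> \<in> fixing F \<longleftrightarrow> \<sigma> \<in> golay_aut \<and> (\<forall>j\<in>set F. \<sigma> (pt j) = pt j)"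
  by (simp add: fixing_def)

lemma fixing_avoids:
  assumes "\<sigma> \<in> fixing F" "j \<in> set F" "x \<noteq> pt j"
  shows "\<sigma> x \<noteq> pt j"
  using assms golay_aut_inj unfolding fixing_iff by metis

lemma valid_perm_list: "L \<in> {p_shift, p_double, p_neginv, p_cube, p_sext1, p_sext2, p_hex1, p_hex2} \<Longrightarrow> valid_perm L"
  using valid_perms by auto

text \<open>Points are moved to their places one at a time, each by an element that fixes those moved before.\<close>

theorem golay_aut_transitive_4:
  assumes "distinct [a, b, c, d]"
  obtains \<sigma> where "\<sigma> \<in> golay_aut" "\<sigma> a = pt 23" "\<sigma> b = pt 0" "\<sigma> c = pt 1" "\<sigma> d = pt 2"
proof -
  have reach: "k \<in> set (reach fs n S)" if "all_in xs (reach fs n S)" "k \<in> set xs"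
    for k and xs S :: "nat list" and fs n
    using that by (auto simp: all_in_iff)
  obtain k where "k < 24" "a = pt k"
    using pt_cases by blast
  moreover have "k \<in> set (reach (map (!) [p_shift, p_neginv]) 23 [23])" if "k < 24" for k
    by (rule reach[OF orbit_23]) (use that in auto)
  ultimately obtain \<sigma>1 where \<sigma>1: "\<sigma>1 \<in> fixing []" "\<sigma>1 a = pt 23"
    using transitive_on_points[of "[p_shift, p_neginv]" "[]" 23 k 23] valid_perm_list
    by (auto simp: perms_fixing_def)
  have inj1: "\<sigma>1 x = \<sigma>1 y \<longleftrightarrow> x = y" for x y
    using \<sigma>1 golay_aut_inj by (auto simp: fixing_iff)
  obtain k where k: "k < 24" "\<sigma>1 b = pt k"
    using pt_cases by blast
  have ne: "\<sigma>1 b \<noteq> pt 23"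
    using inj1[of b a] \<sigma>1(2) assms by auto
  then have "k \<noteq> 23"
    using k by auto
  with k have "k \<in> set [0..<23]"
    by auto
  then obtain \<sigma>2 where \<sigma>2: "\<sigma>2 \<in> fixing [23]" "\<sigma>2 (\<sigma>1 b) = pt 0"
    using transitive_on_points[OF _ orbit_0(2) _ reach[OF orbit_0(1)], of k] valid_perm_list k
    by auto
  obtain k where k: "k < 24" "\<sigma>2 (\<sigma>1 c) = pt k"
    using pt_cases by blast
  have "\<sigma>1 c \<noteq> pt 23" "\<sigma>1 c \<noteq> \<sigma>1 b"
    using inj1[of c a] inj1[of c b] \<sigma>1(2) assms by auto
  then have "\<sigma>2 (\<sigma>1 c) \<noteq> pt 23" "\<sigma>2 (\<sigma>1 c) \<noteq> pt 0"
    using \<sigma>2 fixing_avoids[OF \<sigma>2(1), of 23 "\<sigma>1 c"] golay_aut_inj[of \<sigma>2 "\<sigma>1 c" "\<sigma>1 b"]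
    by (auto simp: fixing_iff)
  then have "k \<noteq> 23" "k \<noteq> 0"
    using k by metis+
  with k have "k \<in> set [1..<23]"
    by auto
  then obtain \<sigma>3 where \<sigma>3: "\<sigma>3 \<in> fixing [23, 0]" "\<sigma>3 (\<sigma>2 (\<sigma>1 c)) = pt 1"
    using transitive_on_points[OF _ orbit_1(2) _ reach[OF orbit_1(1)], of k] valid_perm_list k
    by auto
  let ?\<tau> = "\<sigma>3 \<circ> \<sigma>2 \<circ> \<sigma>1"
  have \<tau>: "?\<tau> \<in> golay_aut"
    using \<sigma>1 \<sigma>2 \<sigma>3 by (auto simp: fixing_iff golay_aut_comp)
  have \<tau>abc: "?\<tau> a = pt 23" "?\<tau> b = pt 0" "?\<tau> c = pt 1"
    using \<sigma>1 \<sigma>2 \<sigma>3 by (auto simp: fixing_iff)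
  obtain k where k: "k < 24" "?\<tau> d = pt k"
    using pt_cases by blast
  have "?\<tau> d \<notin> {?\<tau> a, ?\<tau> b, ?\<tau> c}"
    using golay_aut_inj[OF \<tau>] assms by auto
  then have "k \<noteq> 23" "k \<noteq> 0" "k \<noteq> 1"
    unfolding \<tau>abc using k(2) by (metis insertCI)+
  with k have "k \<in> set [2..<23]"
    unfolding set_upt by auto
  then obtain \<sigma>4 where \<sigma>4: "\<sigma>4 \<in> fixing [23, 0, 1]" "\<sigma>4 (?\<tau> d) = pt 2"
    using transitive_on_points[OF _ orbit_2(2) _ reach[OF orbit_2(1)], of k] valid_perm_list k
    by auto
  show ?thesis
    by (rule that[of "\<sigma>4 \<circ> ?\<tau>"])
       (use \<sigma>4 \<tau> \<tau>abc in \<open>auto simp: fixing_iff golay_aut_comp\<close>)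
qed

lemma span_words_closed:
  assumes "\<forall>w\<in>set ws. length w = 24"
  shows "\<forall>u\<in>set (span_words ws). length u = 24 \<and> (\<forall>v\<in>set (span_words ws). xor_word u v \<in> set (span_words ws))"
  using assms
proof (induction ws)
  case Nil
  then show ?case
    by (auto simp: xor_word_def zero_word_def)
next
  case (Cons w ws)
  let ?S = "set (span_words ws)"
  have S: "length u = 24" "xor_word u v \<in> ?S" if "u \<in> ?S" "v \<in> ?S" for u v
    using Cons that by auto
  have w: "length w = 24"
    using Cons.prems by simp
  have "xor_word u (xor_word w v) = xor_word w (xor_word u v)" "xor_word (xor_word w u) v = xor_word w (xor_word u v)"
    "xor_word (xor_word w u) (xor_word w v) = xor_word u v" if "u \<in> ?S" "v \<in> ?S" for u v
    using w S(1)[OF that(1,1)] S(1)[OF that(2,2)]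
    by (auto intro!: nth_equalityI simp: nth_xor_word)
  then show ?case
    using S w by (auto simp: coset_union_def)
qed

lemma golay_bits_in_span:
  assumes "A \<in> golay_code"
  shows "bits A \<in> set (span_words (map cyclic_octad [0..<12]))"
proof -
  define ws where "ws = map cyclic_octad [0..<12]"
  have ws: "length w = 24" if "w \<in> set ws" for w
    using that by (auto simp: ws_def)
  let ?S = "set (span_words ws)"
  have closed: "xor_word u v \<in> ?S" if "u \<in> ?S" "v \<in> ?S" for u v
    using span_words_closed[of ws] ws that by blast
  have zero: "zero_word \<in> set (span_words vs)" for vs
    by (induction vs) (auto simp: coset_union_def)
  have gen: "w \<in> set (span_words vs)" if "w \<in> set vs" "\<forall>w\<in>set vs. length w = 24" for w vs
    using that
  proof (induction vs)
    case (Cons x vs)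
    have "xor_word x zero_word = x"
      using Cons.prems by (intro nth_equalityI) (auto simp: nth_xor_word zero_word_def)
    then have "x \<in> set (span_words (x # vs))"
      using zero[of vs] by (auto simp: coset_union_def image_iff intro!: bexI[of _ zero_word])
    then show ?case
      using Cons by (auto simp: coset_union_def)
  qed simp
  have "bits A \<in> ?S"
    using assms
  proof (induction rule: golay_code_induct)
    case empty
    show ?case using zero by (simp add: bits_empty)
  next
    case (cyclic i)
    then have "cyclic_octad i \<in> set ws"
      unfolding ws_def by (simp del: upt_rec_numeral)
    then show ?case
      using gen[of "cyclic_octad i" ws] ws by (simp add: bits_of_bits)
  qed (auto simp: bits_sym_diff intro: closed)
  then show ?thesis
    by (simp only: ws_def)
qed

lemma span_words_low_zero:
  assumes "\<forall>w\<in>set ws. length w = 24 \<and> \<not> w ! k" "k < 24"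
  shows "\<forall>u\<in>set (span_words ws). \<not> u ! k"
proof -
  have "\<forall>u\<in>set (span_words ws). length u = 24 \<and> \<not> u ! k"
    using assms by (induction ws) (auto simp: coset_union_def zero_word_def nth_xor_word)
  then show ?thesis
    by blast
qed

lemma golay_bits_base_pattern:
  assumes A: "A \<in> golay_code" "pt 0 \<in> A" "pt 1 \<notin> A" "pt 2 \<notin> A"
  shows "bits A \<in> set (map (xor_word (xor_word (cyclic_octad 0) (cyclic_octad 2))) high_words)"
proof -
  let ?K = cyclic_octad and ?W = high_words
  define ws where "ws = map ?K [3..<12]"
  have ws: "length w = 24 \<and> \<not> w ! 0 \<and> \<not> w ! 1 \<and> \<not> w ! 2" if "w \<in> set ws" for w
    using that cyclic_octad_triangular by (auto simp: ws_def list_all_iff simp del: upt_rec_numeral)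
  have W_eq: "?W = span_words ws"
    by (simp only: high_words_def ws_def)
  have W: "length u = 24" "\<not> u ! 0" "\<not> u ! 1" "\<not> u ! 2" if "u \<in> set ?W" for u
  proof -
    have u: "u \<in> set (span_words ws)"
      using that by (simp only: W_eq)
    show "length u = 24"
      using span_words_closed[of ws] ws u by blast
    show "\<not> u ! 0" "\<not> u ! 1" "\<not> u ! 2"
      using span_words_low_zero[of ws 0] span_words_low_zero[of ws 1] span_words_low_zero[of ws 2] ws u by auto
  qed
  have K: "?K 0 ! 0" "\<not> ?K 0 ! 1" "?K 0 ! 2" "\<not> ?K 1 ! 0" "?K 1 ! 1" "\<not> ?K 1 ! 2" "\<not> ?K 2 ! 0" "\<not> ?K 2 ! 1" "?K 2 ! 2"
    by code_simp+
  have "[0..<12] = 0 # 1 # 2 # [3..<12::nat]"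
    by code_simp
  then have upt: "map ?K [0..<12] = ?K 0 # ?K 1 # ?K 2 # ws"
    unfolding ws_def by (simp only: list.map)
  obtain e0 e1 e2 u where u: "u \<in> set ?W"
    and A_eq: "bits A = (if e0 then xor_word (?K 0) else id) ((if e1 then xor_word (?K 1) else id) ((if e2 then xor_word (?K 2) else id) u))"
  proof -
    have extend: "\<exists>e. \<exists>v\<in>set (span_words vs). u = (if e then xor_word w else id) v"
      if "u \<in> set (span_words (w # vs))" for u w vs
      using that by (auto simp: coset_union_def intro: exI[of _ True] exI[of _ False])
    obtain e0 u0 where 0: "u0 \<in> set (span_words (?K 1 # ?K 2 # ws))" "bits A = (if e0 then xor_word (?K 0) else id) u0"
      using extend[OF golay_bits_in_span[OF A(1), unfolded upt]] by blast
    obtain e1 u1 where 1: "u1 \<in> set (span_words (?K 2 # ws))" "u0 = (if e1 then xor_word (?K 1) else id) u1"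
      using extend[OF 0(1)] by blast
    obtain e2 u2 where 2: "u2 \<in> set (span_words ws)" "u1 = (if e2 then xor_word (?K 2) else id) u2"
      using extend[OF 1(1)] by blast
    show ?thesis
      using that[of u2 e0 e1 e2] 0(2) 1(2) 2 unfolding W_eq by simp
  qed
  \<comment> \<open>The bits at 0, 1, 2 determine the coefficients of the first three basis words.\<close>
  have at: "bits A ! k = ((e0 \<and> ?K 0 ! k) \<noteq> ((e1 \<and> ?K 1 ! k) \<noteq> ((e2 \<and> ?K 2 ! k) \<noteq> u ! k)))" if "k < 24" for k
    using that W(1)[OF u] unfolding A_eq by (cases e0; cases e1; cases e2; simp add: nth_xor_word)
  have "e0" "\<not> e1" "e2"
    using A W[OF u] K at[of 0] at[of 1] at[of 2] by (auto simp: nth_bits)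
  then have "bits A = xor_word (xor_word (?K 0) (?K 2)) u"
    unfolding A_eq using W(1)[OF u] by (intro nth_equalityI) (auto simp: nth_xor_word)
  then show ?thesis
    using u by auto
qed

lemma golay_aut_octads_fixing:
  assumes "K \<in> octads" "pt 23 \<in> K" "pt 0 \<in> K" "pt 1 \<notin> K" "pt 2 \<notin> K"
  obtains \<sigma> where "\<sigma> \<in> fixing [23, 0, 1, 2]" "\<sigma> ` K = of_bits std_octad"
proof -
  define P where "P l \<longleftrightarrow> length l = 24 \<and> (\<exists>\<sigma>\<in>fixing [23, 0, 1, 2]. \<sigma> ` of_bits l = of_bits std_octad)" for l
  have "bits K \<in> set (filter base_pattern
      (map (xor_word (xor_word (cyclic_octad 0) (cyclic_octad 2))) high_words))"
    using assms golay_bits_base_pattern[of K]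
    by (auto simp: octads_def nth_bits card_eq_weight base_pattern_def)
  then have "bits K \<in> set (reach [\<lambda>l. map ((!) l) p_sext1, \<lambda>l. map ((!) l) p_sext2] 8 [std_octad])"
    using orbit_octads unfolding all_in_iff by (rule rev_subsetD)
  then have "P (bits K)"
  proof (rule reach_invariant)
    show "P s" if "s \<in> set [std_octad]" for s
      using that fixing_id by (auto simp: P_def std_octad_def intro: bexI[of _ id])
    fix f :: "bool list \<Rightarrow> bool list" and s assume "f \<in> set [\<lambda>l. map ((!) l) p_sext1, \<lambda>l. map ((!) l) p_sext2]" "P s"
    then obtain L \<sigma> where L: "L \<in> {p_sext1, p_sext2}" "f = (\<lambda>l. map ((!) l) L)" and s: "length s = 24"
      and \<sigma>: "\<sigma> \<in> fixing [23, 0, 1, 2]" "\<sigma> ` of_bits s = of_bits std_octad"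
      by (auto simp: P_def)
    have valid: "valid_perm L"
      using L valid_perm_list by auto
    have "perms_fixing [p_sext1, p_sext2] [23, 0, 1, 2]"
      by code_simp
    then have fixL: "perm L \<in> fixing [23, 0, 1, 2]"
      using valid L by (intro perm_in_fixing) auto
    have "of_bits (f s) = perm L -` of_bits s"
      using valid s L by (metis bits_perm_vimage of_bits_bits valid_perm_def)
    then have "perm L ` of_bits (f s) = of_bits s"
      using valid by (metis golay_aut_bij bij_is_surj perm_in_golay_aut surj_image_vimage_eq)
    then have "(\<sigma> \<circ> perm L) ` of_bits (f s) = of_bits std_octad"
      using \<sigma> by (metis image_comp)
    moreover have "length (f s) = 24"
      using L valid by (auto simp: valid_perm_def)
    ultimately show "P (f s)"
      unfolding P_def using fixing_comp[OF \<sigma>(1) fixL] by blast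
  qed
  then show ?thesis
    using that by (auto simp: P_def)
qed

text \<open>After the four points have been moved to \<open>\<infinity>, 0, 1, 2\<close>, the octad is one of those in
  \<open>orbit_octads\<close>, and these form a single orbit under the permutations that fix the four points.\<close>

theorem golay_aut_transitive_octad:
  assumes "K \<in> octads" "a \<in> K" "b \<in> K" "a \<noteq> b" "p \<notin> K" "q \<notin> K" "p \<noteq> q"
  obtains \<sigma> where "\<sigma> \<in> golay_aut" "\<sigma> a = pt 23" "\<sigma> b = pt 0" "\<sigma> p = pt 1" "\<sigma> q = pt 2"
    "\<sigma> ` K = of_bits std_octad"
proof -
  have "distinct [a, b, p, q]"
    using assms by auto
  then obtain \<sigma> where \<sigma>: "\<sigma> \<in> golay_aut" "\<sigma> a = pt 23" "\<sigma> b = pt 0" "\<sigma> p = pt 1" "\<sigma> q = pt 2"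
    by (rule golay_aut_transitive_4)
  have K': "\<sigma> ` K \<in> octads"
    using assms(1) \<sigma>(1) golay_aut_bij[OF \<sigma>(1)]
    by (auto simp: octads_def golay_aut_image card_image inj_on_subset[OF bij_is_inj])
  have "\<sigma> x \<in> \<sigma> ` K \<longleftrightarrow> x \<in> K" for x
    using golay_aut_bij[OF \<sigma>(1)] by (simp add: bij_is_inj inj_image_mem_iff)
  from this[of a] this[of b] this[of p] this[of q] have
    "pt 23 \<in> \<sigma> ` K" "pt 0 \<in> \<sigma> ` K" "pt 1 \<notin> \<sigma> ` K" "pt 2 \<notin> \<sigma> ` K"
    using assms unfolding \<sigma>(2-5) by simp_all
  then obtain \<tau> where \<tau>: "\<tau> \<in> fixing [23, 0, 1, 2]" "\<tau> ` \<sigma> ` K = of_bits std_octad"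
    by (rule golay_aut_octads_fixing[OF K'])
  have "\<tau> (pt j) = pt j" if "j \<in> {23, 0, 1, 2}" for j
    using \<tau>(1) that by (auto simp: fixing_iff)
  moreover have "\<tau> \<circ> \<sigma> \<in> golay_aut"
    using \<sigma>(1) \<tau>(1) by (simp add: fixing_iff golay_aut_comp)
  moreover have "(\<tau> \<circ> \<sigma>) ` K = of_bits std_octad"
    using \<tau>(2) by (simp only: image_comp)
  ultimately show ?thesis
    using \<sigma>(2-5) by (intro that[of "\<tau> \<circ> \<sigma>"]) simp_all
qed

text \<open>Weights are divisible by 4, and by transitivity on four points a word of weight 4 would exist only if
  all sets of four points were codewords.\<close>

lemma golay_min_weight:
  assumes "A \<in> golay_code" "A \<noteq> {}"
  shows "card A \<ge> 8"
proof (rule ccontr)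
  assume "\<not> card A \<ge> 8"
  moreover have "card A > 0"
    using assms(2) by (simp add: card_gt_0_iff)
  moreover have "4 dvd card A"
    using assms(1) by (rule golay_doubly_even)
  ultimately have "card A = 4"
    by (auto elim!: dvdE)
  then obtain a b c d where A: "A = {a, b, c, d}" "distinct [a, b, c, d]"
    by (auto simp: card_Suc_eq numeral_eq_Suc)
  obtain \<sigma> where \<sigma>: "\<sigma> \<in> golay_aut" "\<sigma> a = pt 23" "\<sigma> b = pt 0" "\<sigma> c = pt 1" "\<sigma> d = pt 2"
    using A(2) by (rule golay_aut_transitive_4)
  have "of_bits (points [23, 0, 1, 2]) = \<sigma> ` A"
    using \<sigma> by (simp add: A of_bits_points)
  then have "dual_word (points [23, 0, 1, 2])"
    using \<sigma>(1) assms(1) by (metis golay_aut_image length_points of_bits_in_golay)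
  moreover have "\<not> dual_word (points [23, 0, 1, 2])"
    by code_simp
  ultimately show False
    by contradiction
qed

section \<open>Prescribing codewords on small sets\<close>

text \<open>If each single point of a set can be cut out by a codeword, then by addition so can every subset.\<close>

lemma golay_separate:
  assumes "\<And>x. x \<in> Z \<Longrightarrow> \<exists>A\<in>golay_code. A \<inter> Z = {x}" "E \<subseteq> Z"
  shows "\<exists>A\<in>golay_code. A \<inter> Z = E"
  using finite[of E] assms(2)
proof (induction E)
  case empty
  then show ?case using golay_code.empty by auto
next
  case (insert x E)
  then obtain A B where AB: "A \<in> golay_code" "A \<inter> Z = E" "B \<in> golay_code" "B \<inter> Z = {x}"
    using assms(1) by (metis insert_subset)
  have "sym_diff A B \<inter> Z = sym_diff (A \<inter> Z) (B \<inter> Z)"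
    by blast
  also have "\<dots> = insert x E"
    unfolding AB using insert.hyps by blast
  finally show ?case
    using golay_code.add[OF AB(1,3)] by blast
qed

lemma golay_word: "dual_word (points ks) \<Longrightarrow> set ks \<subseteq> {..<24} \<Longrightarrow> pt ` set ks \<in> golay_code"
  by (metis length_points of_bits_in_golay of_bits_points)

lemma pt_image_Int: 
  "set ks \<subseteq> {..<24} \<Longrightarrow> set js \<subseteq> {..<24} \<Longrightarrow> pt ` set ks \<inter> pt ` set js = pt ` (set ks \<inter> set js)"
  using inj_on_pt by (metis inj_on_image_Int)

definition separating_word :: "nat list \<Rightarrow> nat \<Rightarrow> nat list \<Rightarrow> bool" where
  "separating_word js x ks \<longleftrightarrow> dual_word (points ks) \<and> list_all (\<lambda>k. k < 24) ks \<and> list_all (\<lambda>k. k < 24) js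
     \<and> filter (\<lambda>k. elem k js) ks = [x]"

lemma separating_word:
  assumes "separating_word js x ks"
  shows "\<exists>A\<in>golay_code. A \<inter> pt ` set js = {pt x}"
proof -
  have "set (filter (\<lambda>k. elem k js) ks) = {x}"
    using assms by (simp only: separating_word_def) simp
  then have "set ks \<inter> set js = {x}"
    by (auto simp: elem_iff)
  then have "pt ` set ks \<inter> pt ` set js = {pt x}"
    using assms by (subst pt_image_Int) (auto simp: separating_word_def list_all_iff)
  moreover have "pt ` set ks \<in> golay_code"
    using assms by (intro golay_word) (auto simp: separating_word_def list_all_iff)
  ultimately show ?thesis
    by blast
qed

text \<open>Octads that meet a given set in a single prescribed point.\<close>

lemma separating_words_4:
  "separating_word [23, 0, 1, 2] 23 [3, 4, 5, 6, 8, 17, 20, 23] \<and>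
   separating_word [23, 0, 1, 2] 0 [0, 3, 4, 5, 7, 9, 11, 17] \<and>
   separating_word [23, 0, 1, 2] 1 [1, 3, 4, 5, 7, 14, 18, 20] \<and>
   separating_word [23, 0, 1, 2] 2 [2, 3, 4, 5, 6, 9, 12, 14]"
  by code_simp

lemma separating_words_octad:
  "separating_word [0, 3, 4, 5, 12, 13, 18, 1, 2] 0 [0, 6, 7, 8, 9, 11, 20, 23] \<and>
   separating_word [0, 3, 4, 5, 12, 13, 18, 1, 2] 1 [1, 6, 7, 9, 11, 16, 17, 21] \<and>
   separating_word [0, 3, 4, 5, 12, 13, 18, 1, 2] 2 [2, 6, 7, 8, 9, 14, 21, 22] \<and>
   separating_word [0, 3, 4, 5, 12, 13, 18, 1, 2] 3 [3, 6, 7, 8, 15, 16, 21, 23] \<and>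
   separating_word [0, 3, 4, 5, 12, 13, 18, 1, 2] 4 [4, 6, 7, 11, 15, 17, 19, 23] \<and>
   separating_word [0, 3, 4, 5, 12, 13, 18, 1, 2] 5 [5, 6, 7, 8, 10, 19, 22, 23] \<and>
   separating_word [0, 3, 4, 5, 12, 13, 18, 1, 2] 12 [6, 7, 9, 12, 14, 16, 19, 23] \<and>
   separating_word [0, 3, 4, 5, 12, 13, 18, 1, 2] 13 [6, 7, 10, 11, 13, 14, 21, 23] \<and>
   separating_word [0, 3, 4, 5, 12, 13, 18, 1, 2] 18 [6, 9, 15, 16, 17, 18, 20, 23]"
  by code_simp

lemma golay_pullback:
  assumes "\<sigma> \<in> golay_aut" "\<exists>A\<in>golay_code. A \<inter> \<sigma> ` Z = \<sigma> ` E"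
  shows "\<exists>A\<in>golay_code. A \<inter> Z = E"
proof -
  obtain A where A: "A \<in> golay_code" "A \<inter> \<sigma> ` Z = \<sigma> ` E"
    using assms(2) by blast
  have "\<sigma> -` A \<inter> \<sigma> -` \<sigma> ` Z = \<sigma> -` \<sigma> ` E"
    using A(2) by (metis vimage_Int)
  then have "\<sigma> -` A \<inter> Z = E"
    using golay_aut_bij[OF assms(1)] by (simp only: bij_is_inj inj_vimage_image_eq)
  then show ?thesis
    using A(1) assms(1) golay_aut_vimage by blast
qed

text \<open>Sign changes of lattice vectors are possible on codewords only. This theorem and the next show that
  the signs of few coordinates can nevertheless be chosen freely.\<close>

theorem golay_prescribe_4:
  assumes "distinct [a, b, c, d]" "E \<subseteq> {a, b, c, d}"
  shows "\<exists>A\<in>golay_code. A \<inter> {a, b, c, d} = E"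
proof -
  obtain \<sigma> where \<sigma>: "\<sigma> \<in> golay_aut" "\<sigma> a = pt 23" "\<sigma> b = pt 0" "\<sigma> c = pt 1" "\<sigma> d = pt 2"
    using assms(1) by (rule golay_aut_transitive_4)
  have Z: "\<sigma> ` {a, b, c, d} = pt ` set [23, 0, 1, 2]"
    using \<sigma> by simp
  have "\<exists>A\<in>golay_code. A \<inter> pt ` set [23, 0, 1, 2] = {x}" if x: "x \<in> pt ` set [23, 0, 1, 2]" for x
  proof -
    obtain k where k: "k \<in> set [23, 0, 1, 2]" "x = pt k"
      using x by blast
    then have "\<exists>ks. separating_word [23, 0, 1, 2] k ks"
      using separating_words_4 by auto
    then show ?thesis
      using separating_word k by blast
  qed
  moreover have "\<sigma> ` E \<subseteq> pt ` set [23, 0, 1, 2]"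
    unfolding Z[symmetric] using assms(2) by (rule image_mono)
  ultimately have "\<exists>A\<in>golay_code. A \<inter> pt ` set [23, 0, 1, 2] = \<sigma> ` E"
    by (rule golay_separate)
  then show ?thesis
    unfolding Z[symmetric] by (rule golay_pullback[OF \<sigma>(1)])
qed

text \<open>Every codeword meets an octad in an even number of points, and this is the only constraint on its
  trace on an octad and two further points. Nine of the ten points can be separated, and parity decides the tenth.\<close>

theorem golay_prescribe_octad:
  assumes K: "K \<in> octads" "p \<notin> K" "q \<notin> K" "p \<noteq> q"
    and E: "E \<subseteq> K \<union> {p, q}" "even (card (E \<inter> K))"
  shows "\<exists>A\<in>golay_code. A \<inter> (K \<union> {p, q}) = E"
proof -
  have "card K = 8"
    using K by (simp add: octads_def)
  then obtain a b where ab: "a \<in> K" "b \<in> K" "a \<noteq> b"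
    using card_le_Suc0_iff_eq[of K] by force
  then obtain \<sigma> where \<sigma>: "\<sigma> \<in> golay_aut" "\<sigma> a = pt 23" "\<sigma> p = pt 1" "\<sigma> q = pt 2" "\<sigma> ` K = of_bits std_octad"
    by (rule golay_aut_transitive_octad[OF K(1) _ _ _ K(2-4)])
  let ?Z = "K \<union> {p, q} - {a}"
  have "\<sigma> ` K = pt ` {0, 3, 4, 5, 12, 13, 18, 23}"
    using \<sigma>(5) by (simp add: std_octad_def of_bits_points)
  then have all: "\<sigma> ` (K \<union> {p, q}) = pt ` {0, 3, 4, 5, 12, 13, 18, 23, 1, 2}"
    using \<sigma>(3,4) by (simp add: image_Un insert_commute)
  have "\<sigma> ` ?Z = \<sigma> ` (K \<union> {p, q}) - {pt 23}"
    using image_set_diff[OF bij_is_inj[OF golay_aut_bij[OF \<sigma>(1)]], of "K \<union> {p, q}" "{a}"] \<sigma>(2) by simp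
  then have Z: "\<sigma> ` ?Z = pt ` set [0, 3, 4, 5, 12, 13, 18, 1, 2]"
    by (simp only: all) (simp add: insert_Diff_if pt_eq_iff)
  have "\<exists>A\<in>golay_code. A \<inter> pt ` set [0, 3, 4, 5, 12, 13, 18, 1, 2] = {x}"
    if x: "x \<in> pt ` set [0, 3, 4, 5, 12, 13, 18, 1, 2]" for x
  proof -
    obtain k where k: "k \<in> set [0, 3, 4, 5, 12, 13, 18, 1, 2]" "x = pt k"
      using x by blast
    then have "\<exists>ks. separating_word [0, 3, 4, 5, 12, 13, 18, 1, 2] k ks"
      using separating_words_octad by auto
    then show ?thesis
      using separating_word k by blast
  qed
  moreover have "\<sigma> ` (E - {a}) \<subseteq> pt ` set [0, 3, 4, 5, 12, 13, 18, 1, 2]"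
    unfolding Z[symmetric] using E(1) by (intro image_mono) blast
  ultimately have "\<exists>A\<in>golay_code. A \<inter> pt ` set [0, 3, 4, 5, 12, 13, 18, 1, 2] = \<sigma> ` (E - {a})"
    by (rule golay_separate)
  then have "\<exists>A\<in>golay_code. A \<inter> ?Z = E - {a}"
    unfolding Z[symmetric] by (rule golay_pullback[OF \<sigma>(1)])
  then obtain A where A: "A \<in> golay_code" "A \<inter> ?Z = E - {a}"
    by blast
  \<comment> \<open>Membership of the last point of the octad is forced by parity.\<close>
  have "even (card (A \<inter> K))"
    using A(1) K(1) golay_self_orthogonal by (simp add: octads_def)
  moreover have "A \<inter> K - {a} = E \<inter> K - {a}"
    using A(2) by blast
  moreover have "card (B \<inter> K) = card (B \<inter> K - {a}) + (if a \<in> B then 1 else 0)" for B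
    using ab(1) card.remove[of "B \<inter> K" a] by simp
  ultimately have "even (card (E \<inter> K - {a}) + (if a \<in> A then 1 else 0 :: nat))"
    "even (card (E \<inter> K - {a}) + (if a \<in> E then 1 else 0 :: nat))"
    using E(2) by metis+
  then have "a \<in> A \<longleftrightarrow> a \<in> E"
    by (auto split: if_splits)
  then have "A \<inter> (K \<union> {p, q}) = E"
    using A(2) E(1) ab(1) by blast
  then show ?thesis
    using A(1) by blast
qed

section \<open>Coordinates of the Leech lattice\<close>

definition ivec :: "(P1 \<Rightarrow> int) \<Rightarrow> real ^ P1" where
  "ivec f = (\<chi> i. of_int (f i))"

lemma ivec_nth [simp]: "ivec f $ i = of_int (f i)"
  by (simp add: ivec_def)

lemma ivec_inject [simp]: "ivec f = ivec g \<longleftrightarrow> f = g"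
  by (auto simp: vec_eq_iff fun_eq_iff)

lemma ivec_diff: "ivec f - ivec g = ivec (\<lambda>i. f i - g i)"
  and ivec_add: "ivec f + ivec g = ivec (\<lambda>i. f i + g i)"
  and ivec_zero: "0 = ivec (\<lambda>i. 0)"
  by (auto simp: vec_eq_iff)

lemma ivec_inner: "ivec f \<bullet> ivec g = of_int (\<Sum>i\<in>UNIV. f i * g i)"
  by (simp add: inner_vec_def)

definition ind :: "P1 set \<Rightarrow> P1 \<Rightarrow> int" where
  "ind A i = (if i \<in> A then 1 else 0)"

lemma nu_set_nth: "nu_set A $ i = of_int (ind A i)"
proof -
  have "nu_set A $ i = (\<Sum>j\<in>A. if j = i then 1 else 0)"
    by (auto simp: nu_set_def nu_def sum_component axis_def intro!: sum.cong)
  then show ?thesis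
    by (simp add: ind_def)
qed

lemma nu_nth: "nu j $ i = (if i = j then 1 else 0)"
  by (auto simp: nu_def axis_def)

lemma sum_ind: "(\<Sum>i\<in>UNIV. ind A i) = int (card A)"
  by (simp add: ind_def sum.If_cases)

text \<open>Conway's description of the lattice: all coordinates have the same parity \<open>m\<close>, the places at which the second
  binary digit is set form a codeword, and the sum of the coordinates is \<open>4m\<close> modulo 8.\<close>

definition leech_coords :: "(P1 \<Rightarrow> int) \<Rightarrow> bool" where
  "leech_coords f \<longleftrightarrow> (\<exists>m\<in>{0, 1}. (\<forall>i. f i mod 2 = m) \<and> {i. f i mod 4 = m + 2} \<in> golay_code \<and>
     (\<Sum>i\<in>UNIV. f i) mod 8 = 4 * m)"

lemma leech_coordsE:
  assumes "leech_coords f"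
  obtains m where "m = 0 \<or> m = 1" "\<forall>i. f i mod 2 = m" "{i. f i mod 4 = m + 2} \<in> golay_code"
    "(\<Sum>i\<in>UNIV. f i) mod 8 = 4 * m"
proof -
  from assms[unfolded leech_coords_def] obtain m where m: "m \<in> {0, 1}" and
    "(\<forall>i. f i mod 2 = m) \<and> {i. f i mod 4 = m + 2} \<in> golay_code \<and> (\<Sum>i\<in>UNIV. f i) mod 8 = 4 * m"
    by (rule bexE)
  then show ?thesis
    by (elim conjE) (rule that; simp)
qed

lemma golay_UNIV: "UNIV \<in> golay_code"
  using golay_code.gen[of None] by simp

lemma golay_compl: "A \<in> golay_code \<Longrightarrow> - A \<in> golay_code"
proof -
  assume "A \<in> golay_code"
  then have "sym_diff UNIV A \<in> golay_code"
    using golay_UNIV golay_code.add by blast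
  moreover have "sym_diff UNIV A = - A"
    by auto
  ultimately show ?thesis by simp
qed

text \<open>The second binary digits of a difference are the sum of the second digits, except for a carry at each place when an
  odd vector is subtracted from an even one; this complements the codeword.\<close>

lemma leech_coords_diff:
  assumes "leech_coords f" "leech_coords g"
  shows "leech_coords (\<lambda>i. f i - g i)"
proof -
  obtain m where m: "m \<in> {0, 1}" "\<And>i. f i mod 2 = m" "{i. f i mod 4 = m + 2} \<in> golay_code" "(\<Sum>i\<in>UNIV. f i) mod 8 = 4 * m"
    using assms(1) by (auto simp: leech_coords_def)
  obtain n where n: "n \<in> {0, 1}" "\<And>i. g i mod 2 = n" "{i. g i mod 4 = n + 2} \<in> golay_code" "(\<Sum>i\<in>UNIV. g i) mod 8 = 4 * n"
    using assms(2) by (auto simp: leech_coords_def)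
  define d where "d = (m - n) mod 2"
  define S where "S = sym_diff {i. f i mod 4 = m + 2} {i. g i mod 4 = n + 2}"
  have S: "S \<in> golay_code"
    unfolding S_def using m n by (intro golay_code.add)
  have key: "(x - y) mod 4 = (m - n) mod 2 + 2 \<longleftrightarrow>
      (if m = 0 \<and> n = 1 then (x mod 4 = m + 2) = (y mod 4 = n + 2) else (x mod 4 = m + 2) \<noteq> (y mod 4 = n + 2))"
    if "x mod 2 = m" "y mod 2 = n" for x y
  proof -
    consider "m = 0" "n = 0" | "m = 0" "n = 1" | "m = 1" "n = 0" | "m = 1" "n = 1"
      using m(1) n(1) by blast
    then show ?thesis
      using that by cases (simp_all, presburger+)
  qed
  have "(f i - g i) mod 4 = d + 2 \<longleftrightarrow> (if m = 0 \<and> n = 1 then i \<notin> S else i \<in> S)" for i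
    using key[OF m(2)[of i] n(2)[of i]] unfolding d_def S_def
    by (simp only: Un_iff Diff_iff mem_Collect_eq) argo
  then have "{i. (f i - g i) mod 4 = d + 2} = (if m = 0 \<and> n = 1 then - S else S)"
    by (cases "m = 0 \<and> n = 1") (simp_all add: set_eq_iff)
  then have "{i. (f i - g i) mod 4 = d + 2} \<in> golay_code"
    using S golay_compl by simp
  moreover have "(f i - g i) mod 2 = d" for i
    unfolding d_def using m(2)[of i] n(2)[of i] by (metis mod_diff_eq)
  moreover have "(\<Sum>i\<in>UNIV. f i - g i) mod 8 = 4 * d"
  proof -
    have "(x - y) mod 8 = 4 * d" if "x mod 8 = 4 * m" "y mod 8 = 4 * n" for x y
    proof -
      consider "m = 0" "n = 0" | "m = 0" "n = 1" | "m = 1" "n = 0" | "m = 1" "n = 1"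
        using m(1) n(1) by blast
      then show ?thesis
        using that unfolding d_def by cases (simp_all, presburger+)
    qed
    then show ?thesis
      unfolding sum_subtractf using m(4) n(4) by blast
  qed
  moreover have "d \<in> {0, 1}"
    by (auto simp: d_def)
  ultimately show ?thesis
    unfolding leech_coords_def by blast
qed

lemma leech_coords_octad: "K \<in> octads \<Longrightarrow> leech_coords (\<lambda>i. 2 * ind K i)"
proof -
  assume K: "K \<in> octads"
  have "{i. 2 * ind K i mod 4 = 0 + 2} = K"
    by (auto simp: ind_def)
  moreover have "(\<Sum>i\<in>UNIV. 2 * ind K i) = 16"
    using K by (simp add: sum_distrib_left[symmetric] sum_ind octads_def)
  ultimately show ?thesis
    unfolding leech_coords_def using K by (intro bexI[of _ 0]) (auto simp: octads_def)
qed

lemma sum_ind_mult: "(\<Sum>i\<in>UNIV. c * ind A i) = c * int (card A)"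
  by (simp add: sum_distrib_left[symmetric] sum_ind)

lemma card_projective_line: "CARD(P1) = 24"
  by simp

text \<open>The coordinates of the generator \<open>\<nu>\<^sub>\<Omega> - 4\<nu>\<^sub>\<infinity>\<close>.\<close>

definition odd_coords :: "P1 \<Rightarrow> int" where
  "odd_coords i = 1 - 4 * ind {None} i"

lemma leech_coords_odd: "leech_coords odd_coords"
proof -
  have "{i. odd_coords i mod 4 = 1 + 2} = {}"
    by (auto simp: odd_coords_def ind_def)
  moreover have "(\<Sum>i\<in>UNIV. odd_coords i) = 20"
    by (simp add: odd_coords_def sum_subtractf sum_ind_mult)
  moreover have "\<forall>i. odd_coords i mod 2 = 1"
    by (auto simp: odd_coords_def ind_def)
  ultimately show ?thesis
    unfolding leech_coords_def by (intro bexI[of _ 1]) (auto intro: golay_code.empty)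
qed

lemma octad_vec: "2 *\<^sub>R nu_set K = ivec (\<lambda>i. 2 * ind K i)"
  by (simp add: vec_eq_iff nu_set_nth)

lemma odd_vec: "nu_set UNIV - 4 *\<^sub>R nu None = ivec odd_coords"
  by (simp add: vec_eq_iff nu_set_nth nu_nth odd_coords_def ind_def)

lemma leech_imp_coords: "x \<in> leech_lattice \<Longrightarrow> \<exists>f. x = ivec f \<and> leech_coords f"
  unfolding leech_lattice_def
proof (induction rule: group_closure.induct)
  case (base s)
  have "leech_coords (\<lambda>i. 0)"
    using golay_code.empty by (auto simp: leech_coords_def intro!: bexI[of _ 0])
  then show ?case
    using base leech_coords_octad leech_coords_odd by (auto simp: octad_vec odd_vec) (metis ivec_zero)
next
  case (diff s t)
  then show ?case
    using leech_coords_diff by (metis ivec_diff)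
qed

definition additive_subgroup :: "'a::real_vector set \<Rightarrow> bool" where
  "additive_subgroup H \<longleftrightarrow> 0 \<in> H \<and> (\<forall>x\<in>H. \<forall>y\<in>H. x - y \<in> H)"

lemma subgroup_diff: "additive_subgroup H \<Longrightarrow> x \<in> H \<Longrightarrow> y \<in> H \<Longrightarrow> x - y \<in> H"
  by (simp add: additive_subgroup_def)

lemma subgroup_minus: "additive_subgroup H \<Longrightarrow> x \<in> H \<Longrightarrow> - x \<in> H"
  using subgroup_diff[of H 0 x] by (simp add: additive_subgroup_def)

lemma subgroup_add: "additive_subgroup H \<Longrightarrow> x \<in> H \<Longrightarrow> y \<in> H \<Longrightarrow> x + y \<in> H"
  using subgroup_diff[of H x "- y"] subgroup_minus[of H y] by simp

lemma subgroup_sum: "additive_subgroup H \<Longrightarrow> (\<And>i. i \<in> I \<Longrightarrow> h i \<in> H) \<Longrightarrow> sum h I \<in> H"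
  by (induction I rule: infinite_finite_induct) (auto simp: subgroup_add, auto simp: additive_subgroup_def)

lemma subgroup_scale_int:
  assumes H: "additive_subgroup H" and x: "x \<in> H"
  shows "of_int k *\<^sub>R x \<in> H"
proof -
  have nat: "of_nat n *\<^sub>R x \<in> H" for n
    using H x by (induction n) (auto simp: scaleR_left_distrib subgroup_add, auto simp: additive_subgroup_def)
  show ?thesis
  proof (cases "k \<ge> 0")
    case True
    then show ?thesis using nat[of "nat k"] by simp
  next
    case False
    then show ?thesis using subgroup_minus[OF H nat[of "nat (- k)"]] by simp
  qed
qed

lemma subgroup_leech: "additive_subgroup leech_lattice"
  unfolding leech_lattice_def additive_subgroup_def by (simp add: group_closure.diff)

lemmas leech_diff = subgroup_diff[OF subgroup_leech]
  and leech_add = subgroup_add[OF subgroup_leech]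
  and leech_minus = subgroup_minus[OF subgroup_leech]
  and leech_scale_int = subgroup_scale_int[OF subgroup_leech]

lemma leech_zero: "0 \<in> leech_lattice"
  using subgroup_leech by (simp add: additive_subgroup_def)

lemma leech_octad: "K \<in> octads \<Longrightarrow> 2 *\<^sub>R nu_set K \<in> leech_lattice"
  unfolding leech_lattice_def by (rule group_closure.base) auto

lemma leech_odd: "ivec odd_coords \<in> leech_lattice"
  unfolding leech_lattice_def odd_vec[symmetric] by (rule group_closure.base) auto

definition octad_word :: "nat list \<Rightarrow> bool" where
  "octad_word ks \<longleftrightarrow> dual_word (points ks) \<and> list_all (\<lambda>k. k < 24) ks \<and> distinct ks \<and> length ks = 8"

lemma octad_word: 
  assumes "octad_word ks"
  shows "pt ` set ks \<in> octads"
proof -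
  have "set ks \<subseteq> {..<24}"
    using assms by (auto simp: octad_word_def list_all_iff)
  moreover have "card (pt ` set ks) = 8"
    using assms calculation by (metis card_image distinct_card inj_on_pt inj_on_subset octad_word_def)
  ultimately show ?thesis
    using assms golay_word by (auto simp: octads_def octad_word_def)
qed

text \<open>A sextet is a partition of the points into six tetrads any two of which form an octad. The first three
  octads are made up by three tetrads of the sextet of \<open>{0, 1, 2, \<infinity>}\<close>; the first, the fourth and the
  fifth partition all points.\<close>

lemma sextet_words:
  "octad_word [0, 1, 2, 23, 4, 13, 16, 22] \<and> octad_word [0, 1, 2, 23, 3, 5, 14, 17] \<and>
   octad_word [4, 13, 16, 22, 3, 5, 14, 17] \<and> octad_word [6, 7, 19, 21, 9, 10, 15, 20] \<and>
   octad_word [3, 5, 14, 17, 8, 11, 12, 18]"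
  by code_simp

lemma leech_tetrad:
  assumes "K \<in> octads" "L \<in> octads" "sym_diff K L \<in> octads"
  shows "4 *\<^sub>R nu_set (K \<inter> L) \<in> leech_lattice"
proof -
  have "4 *\<^sub>R nu_set (K \<inter> L) = 2 *\<^sub>R nu_set K + 2 *\<^sub>R nu_set L - 2 *\<^sub>R nu_set (sym_diff K L)"
    by (auto simp: vec_eq_iff nu_set_nth ind_def)
  then show ?thesis
    using assms by (simp add: leech_diff leech_add leech_octad)
qed

lemma golay_aut_vimage_octad:
  assumes "\<sigma> \<in> golay_aut"
  shows "\<sigma> -` K \<in> octads \<longleftrightarrow> K \<in> octads"
proof -
  have "card (\<sigma> -` K) = card K"
    using golay_aut_bij[OF assms] by (simp add: card_vimage_inj bij_is_inj bij_is_surj)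
  then show ?thesis
    using assms by (simp add: octads_def golay_aut_vimage)
qed

text \<open>A set of four points is a tetrad of some sextet, hence the intersection of two octads with an octad as
  symmetric difference. By transitivity on four points one sextet is enough.\<close>

lemma leech_4set:
  assumes "distinct [a, b, c, d]"
  shows "4 *\<^sub>R nu_set {a, b, c, d} \<in> leech_lattice"
proof -
  obtain \<sigma> where \<sigma>: "\<sigma> \<in> golay_aut" "\<sigma> a = pt 23" "\<sigma> b = pt 0" "\<sigma> c = pt 1" "\<sigma> d = pt 2"
    using assms by (rule golay_aut_transitive_4)
  let ?K = "pt ` set [0, 1, 2, 23, 4, 13, 16, 22]" and ?L = "pt ` set [0, 1, 2, 23, 3, 5, 14, 17]"
  have KL: "?K \<inter> ?L = pt ` {0, 1, 2, 23}"
    by (subst pt_image_Int) auto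
  have "sym_diff ?K ?L = pt ` set [4, 13, 16, 22, 3, 5, 14, 17]"
    by (simp add: insert_Diff_if pt_eq_iff insert_commute)
  then have "sym_diff ?K ?L \<in> octads"
    using sextet_words octad_word by metis
  then have "sym_diff (\<sigma> -` ?K) (\<sigma> -` ?L) \<in> octads"
    using golay_aut_vimage_octad[OF \<sigma>(1), of "sym_diff ?K ?L"] by (simp only: vimage_Un vimage_Diff)
  moreover have "?K \<in> octads" "?L \<in> octads"
    using sextet_words by (intro octad_word; simp only:)+
  ultimately have "4 *\<^sub>R nu_set (\<sigma> -` ?K \<inter> \<sigma> -` ?L) \<in> leech_lattice"
    using \<sigma>(1) by (intro leech_tetrad) (simp_all only: golay_aut_vimage_octad)
  also have "\<sigma> -` ?K \<inter> \<sigma> -` ?L = \<sigma> -` \<sigma> ` {a, b, c, d}"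
    unfolding vimage_Int[symmetric] KL using \<sigma>(2-) by (simp add: insert_commute)
  also have "\<dots> = {a, b, c, d}"
    by (rule inj_vimage_image_eq[OF bij_is_inj[OF golay_aut_bij[OF \<sigma>(1)]]])
  finally show ?thesis .
qed

lemma ex_point_notin:
  assumes "length xs < 24"
  shows "\<exists>x :: P1. x \<notin> set xs"
proof (rule ccontr)
  assume "\<not> ?thesis"
  then have "set xs = UNIV"
    by blast
  then show False
    using assms card_length[of xs] card_projective_line by simp
qed

lemma leech_4_diff: "4 *\<^sub>R nu a - 4 *\<^sub>R nu b \<in> leech_lattice"
proof (cases "a = b")
  case False
  obtain c where c: "c \<noteq> a" "c \<noteq> b"
    using ex_point_notin[of "[a, b]"] by auto
  obtain d where d: "d \<noteq> a" "d \<noteq> b" "d \<noteq> c"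
    using ex_point_notin[of "[a, b, c]"] by auto
  obtain e where e: "e \<noteq> a" "e \<noteq> b" "e \<noteq> c" "e \<noteq> d"
    using ex_point_notin[of "[a, b, c, d]"] by auto
  have "4 *\<^sub>R nu_set {a, c, d, e} - 4 *\<^sub>R nu_set {b, c, d, e} \<in> leech_lattice"
    using False c d e by (intro leech_diff leech_4set) auto
  moreover have "4 *\<^sub>R nu_set {a, c, d, e} - 4 *\<^sub>R nu_set {b, c, d, e} = 4 *\<^sub>R nu a - 4 *\<^sub>R nu b"
    using False c d e by (auto simp: vec_eq_iff nu_set_nth nu_nth ind_def)
  ultimately show ?thesis
    by simp
qed (simp add: leech_zero)

text \<open>Twice the sum over three disjoint octads is \<open>2\<nu>\<^sub>\<Omega>\<close>, which differs from twice the odd generator by \<open>8\<nu>\<^sub>\<infinity>\<close>.\<close>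

lemma leech_8: "8 *\<^sub>R nu a \<in> leech_lattice"
proof -
  let ?K = "pt ` set [0, 1, 2, 23, 4, 13, 16, 22]" and ?L = "pt ` set [6, 7, 19, 21, 9, 10, 15, 20]"
    and ?M = "pt ` set [3, 5, 14, 17, 8, 11, 12, 18]"
  have mem: "pt k \<in> pt ` set ks \<longleftrightarrow> k \<in> set ks" if "k < 24" "list_all (\<lambda>k. k < 24) ks" for k ks
    using that by (auto simp: pt_eq_iff list_all_iff)
  have part: "ind ?K i + ind ?L i + ind ?M i = 1" for i
  proof -
    obtain k where k: "k < 24" "i = pt k"
      using pt_cases by blast
    then have "k \<in> set [0..<24]"
      by simp
    then show ?thesis
      unfolding k(2) ind_def by (subst (1 2 3) mem) (use k(1) in \<open>auto simp: upt_0_24\<close>)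
  qed
  have sum: "real_of_int (ind ?K i) + real_of_int (ind ?L i) + real_of_int (ind ?M i) = 1" for i
    using arg_cong[OF part[of i], of real_of_int] by (simp only: of_int_add of_int_1)
  have calc: "8 *\<^sub>R (if i = None then 1 else 0) = 2 *\<^sub>R a + (2 *\<^sub>R b + 2 *\<^sub>R c) - 2 *\<^sub>R of_int (odd_coords i)"
    if "a + b + c = 1" for a b c :: real and i
    using that by (auto simp: odd_coords_def ind_def)
  have "8 *\<^sub>R nu None = 2 *\<^sub>R nu_set ?K + (2 *\<^sub>R nu_set ?L + 2 *\<^sub>R nu_set ?M) - of_int 2 *\<^sub>R ivec odd_coords"
    unfolding vec_eq_iff
  proof
    fix i
    show "(8 *\<^sub>R nu None) $ i =
      (2 *\<^sub>R nu_set ?K + (2 *\<^sub>R nu_set ?L + 2 *\<^sub>R nu_set ?M) - of_int 2 *\<^sub>R ivec odd_coords) $ i"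
      unfolding vector_minus_component vector_add_component vector_scaleR_component nu_set_nth nu_nth ivec_nth
      using calc[OF sum[of i], of i] by (simp only: of_int_numeral)
  qed
  also have "\<dots> \<in> leech_lattice"
    using sextet_words by (intro leech_diff leech_add leech_octad leech_scale_int leech_odd octad_word; simp only:)
  finally have "8 *\<^sub>R nu None \<in> leech_lattice" .
  then have "of_int 2 *\<^sub>R (4 *\<^sub>R nu a - 4 *\<^sub>R nu None) + 8 *\<^sub>R nu None \<in> leech_lattice"
    by (intro leech_add leech_scale_int leech_4_diff)
  then show ?thesis
    by (simp add: scaleR_right_diff_distrib)
qed

text \<open>A second system of generators. It is finite and explicit, unlike the set of all octads, and
  will be used to check invariance under a non-monomial map by computation.\<close>

definition contains_generators :: "(real ^ P1) set \<Rightarrow> bool" where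
  "contains_generators H \<longleftrightarrow> (\<forall>j. 4 *\<^sub>R nu j - 4 *\<^sub>R nu None \<in> H) \<and> 8 *\<^sub>R nu None \<in> H \<and>
     ivec odd_coords \<in> H \<and> (\<forall>i<12. 2 *\<^sub>R nu_set (of_bits (cyclic_octad i)) \<in> H)"

lemma subgroup_4_even_sum:
  assumes H: "additive_subgroup H" "contains_generators H" and "even (\<Sum>i\<in>UNIV. g i)"
  shows "ivec (\<lambda>i. 4 * g i) \<in> H"
proof -
  obtain k where k: "(\<Sum>i\<in>UNIV. g i) = 2 * k"
    using assms(3) by (elim evenE)
  have "ivec (\<lambda>i. 4 * g i) = (\<Sum>j\<in>UNIV. of_int (g j) *\<^sub>R (4 *\<^sub>R nu j - 4 *\<^sub>R nu None)) + of_int k *\<^sub>R (8 *\<^sub>R nu None)"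
  proof (rule vec_eq_iff[THEN iffD2], rule allI)
    fix i
    have "(\<Sum>j\<in>UNIV. of_int (g j) *\<^sub>R (4 *\<^sub>R nu j - 4 *\<^sub>R nu None)) $ i
        = (\<Sum>j\<in>UNIV. (if j = i then 4 * of_int (g j) else 0) - 4 * of_int (g j) * (if i = None then 1 else 0))"
      unfolding sum_component by (rule sum.cong) (auto simp: nu_nth algebra_simps)
    also have "\<dots> = 4 * of_int (g i) - (\<Sum>j\<in>UNIV. 4 * of_int (g j)) * (if i = None then 1 else 0)"
      by (simp add: sum_subtractf sum_distrib_right)
    also have "(\<Sum>j\<in>UNIV. 4 * of_int (g j)) = (4 * of_int (\<Sum>j\<in>UNIV. g j) :: real)"
      by (simp add: sum_distrib_left)
    finally show "ivec (\<lambda>i. 4 * g i) $ i = ((\<Sum>j\<in>UNIV. of_int (g j) *\<^sub>R (4 *\<^sub>R nu j - 4 *\<^sub>R nu None)) + of_int k *\<^sub>R (8 *\<^sub>R nu None)) $ i"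
      unfolding k by (simp add: nu_nth)
  qed
  then show ?thesis
    by (simp only:) (use H in \<open>intro subgroup_add subgroup_sum subgroup_scale_int; simp add: contains_generators_def\<close>)
qed

lemma subgroup_codeword:
  assumes H: "additive_subgroup H" "contains_generators H" and A: "A \<in> golay_code"
  shows "2 *\<^sub>R nu_set A \<in> H"
proof -
  from A have "A \<in> golay_code \<and> 2 *\<^sub>R nu_set A \<in> H"
  proof (induction rule: golay_code_induct)
    case empty
    then show ?case
      using H by (simp add: nu_set_def additive_subgroup_def golay_code.empty)
  next
    case (cyclic i)
    then show ?case
      using H by (simp add: contains_generators_def cyclic_octad_in_golay)
  next
    case (sym_diff A B)
    have "even (\<Sum>i\<in>UNIV. ind (A \<inter> B) i)"
      using sym_diff golay_self_orthogonal by (simp add: sum_ind)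
    then have "2 *\<^sub>R nu_set A + 2 *\<^sub>R nu_set B - ivec (\<lambda>i. 4 * ind (A \<inter> B) i) \<in> H"
      using sym_diff H by (intro subgroup_diff subgroup_add subgroup_4_even_sum) auto
    moreover have "2 *\<^sub>R nu_set (sym_diff A B) = 2 *\<^sub>R nu_set A + 2 *\<^sub>R nu_set B - ivec (\<lambda>i. 4 * ind (A \<inter> B) i)"
      by (auto simp: vec_eq_iff nu_set_nth ind_def)
    ultimately show ?case
      using sym_diff golay_code.add by auto
  qed
  then show ?thesis
    by simp
qed

text \<open>The parity, the second binary digits and the remaining multiples of 4 of the coordinates are realized in turn
  by generators. The theorem is stated for an arbitrary additive subgroup because it is also
  applied to the preimage of the lattice under a linear map.\<close>

theorem coords_in_subgroup:
  assumes H: "additive_subgroup H" "contains_generators H" and f: "leech_coords f"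
  shows "ivec f \<in> H"
proof -
  have even: "ivec f \<in> H" if "leech_coords f" "f None mod 2 = 0" for f
  proof -
    let ?A = "{i. f i mod 4 = 2}"
    have f: "\<And>i. f i mod 2 = 0" "?A \<in> golay_code" "(\<Sum>i\<in>UNIV. f i) mod 8 = 0"
    proof -
      note f = that
      obtain m where m: "\<forall>i. f i mod 2 = m" "{i. f i mod 4 = m + 2} \<in> golay_code" "(\<Sum>i\<in>UNIV. f i) mod 8 = 4 * m"
        by (rule leech_coordsE[OF f(1)])
      have m0: "m = 0"
        using spec[OF m(1), of None] f(2) by (rule subst)
      show "\<And>i. f i mod 2 = 0" "?A \<in> golay_code" "(\<Sum>i\<in>UNIV. f i) mod 8 = 0"
        using m[unfolded m0] by simp_all
    qed
    \<comment> \<open>Subtracting twice the codeword of second binary digits leaves a vector divisible by 4.\<close>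
    define g where "g i = (f i - 2 * ind ?A i) div 4" for i
    have "f i - 2 * ind ?A i = 4 * g i" for i
    proof -
      have "f i mod 4 = 0 \<or> f i mod 4 = 2"
        using f(1)[of i] by presburger
      then have "4 dvd f i - 2 * ind ?A i"
        by (auto simp: ind_def) presburger
      then show ?thesis
        by (simp add: g_def)
    qed
    then have g: "f i = 2 * ind ?A i + 4 * g i" for i
      by (metis add_diff_cancel_left' diff_add_cancel)
    have "(\<Sum>i\<in>UNIV. f i) = 2 * int (card ?A) + 4 * (\<Sum>i\<in>UNIV. g i)"
      by (subst g) (simp add: sum.distrib sum_ind_mult sum_ind sum_distrib_left[symmetric])
    moreover have "4 dvd int (card ?A)"
      using golay_doubly_even[OF f(2)] by presburger
    ultimately have "even (\<Sum>i\<in>UNIV. g i)"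
      using f(3) by (auto elim!: dvdE) presburger
    then have "2 *\<^sub>R nu_set ?A + ivec (\<lambda>i. 4 * g i) \<in> H"
      using H f(2) by (intro subgroup_add subgroup_codeword subgroup_4_even_sum)
    also have "2 *\<^sub>R nu_set ?A + ivec (\<lambda>i. 4 * g i) = ivec f"
      unfolding octad_vec ivec_add by (rule arg_cong[where f = ivec], rule ext, rule g[symmetric])
    finally show ?thesis .
  qed
  show ?thesis
  proof (cases "f None mod 2 = 0")
    case False
    \<comment> \<open>The odd generator reduces odd vectors to even ones.\<close>
    then have "(f None - odd_coords None) mod 2 = 0"
      by (simp add: odd_coords_def ind_def) presburger
    then have mem: "ivec (\<lambda>i. f i - odd_coords i) \<in> H"
      using f leech_coords_odd by (intro even leech_coords_diff)
    show ?thesis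
      using subgroup_add[OF H(1) mem, of "ivec odd_coords"] H(2) by (simp add: ivec_add contains_generators_def)
  qed (use f even in auto)
qed

lemma leech_contains_generators: "contains_generators leech_lattice"
proof -
  have "list_all (\<lambda>i. weight (cyclic_octad i) = 8) [0..<12]"
    by code_simp
  then have "of_bits (cyclic_octad i) \<in> octads" if "i < 12" for i
    using that by (simp add: octads_def card_eq_weight bits_of_bits list_all_iff cyclic_octad_in_golay)
  then show ?thesis
    by (simp add: contains_generators_def leech_4_diff leech_8 leech_odd leech_octad)
qed

theorem ivec_in_leech_iff: "ivec f \<in> leech_lattice \<longleftrightarrow> leech_coords f"
proof
  assume "ivec f \<in> leech_lattice"
  then obtain g where "ivec f = ivec g" "leech_coords g"
    using leech_imp_coords by blast
  then show "leech_coords f"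
    by simp
next
  assume "leech_coords f"
  then show "ivec f \<in> leech_lattice"
    by (rule coords_in_subgroup[OF subgroup_leech leech_contains_generators])
qed

lemmas leech_4_even_sum = subgroup_4_even_sum[OF subgroup_leech leech_contains_generators]
  and leech_codeword = subgroup_codeword[OF subgroup_leech leech_contains_generators]

lemma leech_cases:
  assumes "x \<in> leech_lattice"
  obtains f where "x = ivec f" "leech_coords f"
  using assms leech_imp_coords by blast

section \<open>Automorphisms of the Leech lattice\<close>

text \<open>The Conway group \<open>Co\<^sub>0\<close>, with automorphisms represented by their linear extensions.\<close>

definition co0 :: "(real ^ P1 \<Rightarrow> real ^ P1) set" where
  "co0 = {g. linear g \<and> (\<forall>x y. g x \<bullet> g y = x \<bullet> y) \<and> g ` leech_lattice = leech_lattice}"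

lemma co0_linear: "g \<in> co0 \<Longrightarrow> linear g"
  and co0_inner: "g \<in> co0 \<Longrightarrow> g x \<bullet> g y = x \<bullet> y"
  and co0_image: "g \<in> co0 \<Longrightarrow> g ` leech_lattice = leech_lattice"
  by (simp_all add: co0_def)

lemma co0_leech: "g \<in> co0 \<Longrightarrow> x \<in> leech_lattice \<Longrightarrow> g x \<in> leech_lattice"
  using co0_image by blast

lemma co0_comp: "g \<in> co0 \<Longrightarrow> h \<in> co0 \<Longrightarrow> g \<circ> h \<in> co0"
proof -
  assume g: "g \<in> co0" and h: "h \<in> co0"
  have "(g \<circ> h) ` leech_lattice = leech_lattice"
    by (metis g h co0_image image_comp)
  then show ?thesis
    using g h by (simp add: co0_def linear_compose)
qed

lemma co0I:
  assumes "linear g" "\<And>x y. g x \<bullet> g y = x \<bullet> y" "\<And>x. x \<in> leech_lattice \<Longrightarrow> g x \<in> leech_lattice"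
    and "\<And>x. x \<in> leech_lattice \<Longrightarrow> h x \<in> leech_lattice" "\<And>x. g (h x) = x"
  shows "g \<in> co0"
proof -
  have "x \<in> g ` leech_lattice" if "x \<in> leech_lattice" for x
    using assms(4,5)[of x] that by (metis image_eqI)
  then show ?thesis
    using assms by (auto simp: co0_def)
qed

text \<open>Invariance has to be checked on the generators only.\<close>

lemma leech_linear_image:
  assumes "linear g"
    and "\<And>K. K \<in> octads \<Longrightarrow> g (2 *\<^sub>R nu_set K) \<in> leech_lattice" "g (ivec odd_coords) \<in> leech_lattice"
    and "x \<in> leech_lattice"
  shows "g x \<in> leech_lattice"
proof -
  from assms(4)[unfolded leech_lattice_def] show ?thesis
  proof (induction rule: group_closure.induct)
    case (base s)
    then show ?case
      using assms(1-3) leech_zero by (auto simp: odd_vec linear_0)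
  next
    case (diff s t)
    then show ?case
      using assms(1) leech_diff by (simp add: linear_diff)
  qed
qed

subsection \<open>Monomial automorphisms\<close>

definition sign_map :: "P1 set \<Rightarrow> real ^ P1 \<Rightarrow> real ^ P1" where
  "sign_map A x = (\<chi> i. if i \<in> A then - x $ i else x $ i)"

lemma sign_map_nth [simp]: "sign_map A x $ i = (if i \<in> A then - x $ i else x $ i)"
  by (simp add: sign_map_def)

lemma sign_map_ivec: "sign_map A (ivec f) = ivec (\<lambda>i. if i \<in> A then - f i else f i)"
  by (simp add: vec_eq_iff)

text \<open>Changing signs on \<open>A\<close> alters \<open>2\<nu>\<^sub>K\<close> by the vector \<open>4\<nu>\<close> of \<open>K \<inter> A\<close>, which has an even number of points, and
  alters the odd generator by \<open>2\<nu>\<^sub>A\<close> up to a multiple of \<open>8\<nu>\<^sub>\<infinity>\<close>.\<close>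

lemma sign_map_co0:
  assumes "A \<in> golay_code"
  shows "sign_map A \<in> co0"
proof -
  have lin: "linear (sign_map A)"
    by (rule linearI) (auto simp: vec_eq_iff)
  have closed: "sign_map A x \<in> leech_lattice" if "x \<in> leech_lattice" for x
  proof (rule leech_linear_image[OF lin _ _ that])
    fix K assume K: "K \<in> octads"
    have "even (\<Sum>i\<in>UNIV. ind (K \<inter> A) i)"
      using K assms golay_self_orthogonal by (simp add: sum_ind octads_def)
    then have "2 *\<^sub>R nu_set K - ivec (\<lambda>i. 4 * ind (K \<inter> A) i) \<in> leech_lattice"
      using K by (intro leech_diff leech_octad leech_4_even_sum)
    moreover have "sign_map A (2 *\<^sub>R nu_set K) = 2 *\<^sub>R nu_set K - ivec (\<lambda>i. 4 * ind (K \<inter> A) i)"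
      by (auto simp: vec_eq_iff nu_set_nth ind_def)
    ultimately show "sign_map A (2 *\<^sub>R nu_set K) \<in> leech_lattice"
      by simp
  next
    have "ivec odd_coords - 2 *\<^sub>R nu_set A + of_int (ind A None) *\<^sub>R (8 *\<^sub>R nu None) \<in> leech_lattice"
      using assms by (intro leech_add leech_diff leech_odd leech_codeword leech_scale_int leech_8)
    moreover have "sign_map A (ivec odd_coords) = ivec odd_coords - 2 *\<^sub>R nu_set A + of_int (ind A None) *\<^sub>R (8 *\<^sub>R nu None)"
      by (auto simp: vec_eq_iff nu_set_nth nu_nth ind_def odd_coords_def)
    ultimately show "sign_map A (ivec odd_coords) \<in> leech_lattice"
      by simp
  qed
  show ?thesis
    using lin
  proof (rule co0I)
    show "sign_map A x \<bullet> sign_map A y = x \<bullet> y" for x y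
      by (auto simp: inner_vec_def intro!: sum.cong)
    show "sign_map A (sign_map A x) = x" for x
      by (simp add: vec_eq_iff)
  qed (use closed in auto)
qed

definition perm_map :: "(P1 \<Rightarrow> P1) \<Rightarrow> real ^ P1 \<Rightarrow> real ^ P1" where
  "perm_map \<sigma> x = (\<chi> i. x $ (inv' \<sigma> i))"

lemma perm_map_nth: "bij \<sigma> \<Longrightarrow> perm_map \<sigma> x $ \<sigma> i = x $ i"
  by (simp add: perm_map_def bij_is_inj)

lemma perm_map_eqI:
  assumes "bij \<sigma>" "\<And>i. y $ \<sigma> i = x $ i"
  shows "perm_map \<sigma> x = y"
  unfolding vec_eq_iff
proof
  fix i
  obtain j where "i = \<sigma> j"
    using assms(1) by (metis bij_pointE)
  then show "perm_map \<sigma> x $ i = y $ i"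
    using assms by (simp add: perm_map_nth)
qed

lemma perm_map_co0:
  assumes "\<sigma> \<in> golay_aut"
  shows "perm_map \<sigma> \<in> co0"
proof -
  have lin: "linear (perm_map \<sigma>)" for \<sigma>
    by (rule linearI) (auto simp: vec_eq_iff perm_map_def)
  have closed: "perm_map \<sigma> x \<in> leech_lattice" if \<sigma>: "\<sigma> \<in> golay_aut" and x: "x \<in> leech_lattice" for x \<sigma>
  proof (rule leech_linear_image[OF lin _ _ x])
    fix K assume K: "K \<in> octads"
    have "perm_map \<sigma> (2 *\<^sub>R nu_set K) = 2 *\<^sub>R nu_set (\<sigma> ` K)"
      using golay_aut_bij[OF \<sigma>] by (intro perm_map_eqI) (auto simp: nu_set_nth ind_def bij_is_inj inj_image_mem_iff)
    moreover have "\<sigma> ` K \<in> golay_code"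
      using K golay_aut_image[OF \<sigma>] by (simp add: octads_def)
    ultimately show "perm_map \<sigma> (2 *\<^sub>R nu_set K) \<in> leech_lattice"
      using leech_codeword by simp
  next
    have "perm_map \<sigma> (ivec odd_coords) = ivec odd_coords + (4 *\<^sub>R nu None - 4 *\<^sub>R nu (\<sigma> None))"
      using golay_aut_bij[OF \<sigma>] golay_aut_inj[OF \<sigma>, of _ None]
      by (intro perm_map_eqI) (auto simp: nu_nth odd_coords_def ind_def)
    then show "perm_map \<sigma> (ivec odd_coords) \<in> leech_lattice"
      using leech_add[OF leech_odd leech_4_diff] by simp
  qed
  have b: "bij \<sigma>"
    using assms by (rule golay_aut_bij)
  show ?thesis
    using lin
  proof (rule co0I)
    show "perm_map \<sigma> x \<bullet> perm_map \<sigma> y = x \<bullet> y" for x y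
      unfolding inner_vec_def perm_map_def
      using sum.reindex_bij_betw[OF bij_imp_bij_inv[OF b], of "\<lambda>i. x $ i * y $ i"] by simp
    show "perm_map \<sigma> (perm_map (inv' \<sigma>) x) = x" for x
      using b by (simp add: vec_eq_iff perm_map_def inv_inv_eq bij_is_surj surj_f_inv_f)
  qed (use closed assms golay_aut_inv in auto)
qed

text \<open>Lattice vectors given by the list of their coordinates, for computation.\<close>

definition lvec :: "int list \<Rightarrow> real ^ P1" where
  "lvec L = ivec (\<lambda>x. L ! idx x)"

lemma lvec_nth: "k < 24 \<Longrightarrow> lvec L $ pt k = of_int (L ! k)"
  by (simp add: lvec_def idx_pt)

lemma lvec_eqI: "(\<And>k. k < 24 \<Longrightarrow> x $ pt k = of_int (L ! k)) \<Longrightarrow> x = lvec L"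
  by (simp add: vec_eq_iff lvec_def) (metis idx_less pt_idx)

lemma sum_P1: "(\<Sum>x\<in>UNIV. h x) = (\<Sum>k\<leftarrow>[0..<24]. h (pt k))" for h :: "P1 \<Rightarrow> 'a::comm_monoid_add"
proof -
  have "(\<Sum>x\<in>UNIV. h x) = (\<Sum>k<24. h (pt k))"
    using sum.reindex[OF inj_on_pt, of h] by (simp add: range_pt)
  then show ?thesis
    by (simp add: interv_sum_list_conv_sum_set_nat atLeast0LessThan)
qed

text \<open>Membership in the lattice by computation: \<open>leech_coords\<close> on lists.\<close>

definition leech_list :: "int list \<Rightarrow> bool" where
  "leech_list L \<longleftrightarrow> length L = 24 \<and>
     (if hd L mod 2 = 0
      then list_all (\<lambda>a. a mod 2 = 0) L \<and> dual_word (map (\<lambda>a. a mod 4 = 2) L) \<and> sum_list L mod 8 = 0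
      else list_all (\<lambda>a. a mod 2 = 1) L \<and> dual_word (map (\<lambda>a. a mod 4 = 3) L) \<and> sum_list L mod 8 = 4)"

lemma leech_list:
  assumes "leech_list L"
  shows "lvec L \<in> leech_lattice"
proof -
  define m :: int where "m = (if hd L mod 2 = 0 then 0 else 1)"
  have L: "length L = 24" "list_all (\<lambda>a. a mod 2 = m) L" "dual_word (map (\<lambda>a. a mod 4 = m + 2) L)"
    "sum_list L mod 8 = 4 * m"
    using assms by (auto simp: leech_list_def m_def split: if_splits)
  have "bits {x. L ! idx x mod 4 = m + 2} = map (\<lambda>a. a mod 4 = m + 2) L"
    using L(1) by (intro nth_equalityI) (auto simp: nth_bits idx_pt)
  then have "{x. L ! idx x mod 4 = m + 2} \<in> golay_code"
    using L(3) by (simp add: golay_code_iff)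
  moreover have "L ! idx x mod 2 = m" for x
    using L(1,2) idx_less by (auto simp: list_all_length)
  moreover have "(\<Sum>x\<in>UNIV. L ! idx x) mod 8 = 4 * m"
  proof -
    have "(\<Sum>x\<in>UNIV. L ! idx x) = (\<Sum>k\<leftarrow>[0..<24]. L ! k)"
      unfolding sum_P1 by (rule arg_cong[where f = sum_list], rule map_cong) (auto simp: idx_pt)
    also have "map ((!) L) [0..<24] = L"
      using L(1) by (metis map_nth)
    finally show ?thesis
      using L(4) by simp
  qed
  ultimately have "leech_coords (\<lambda>x. L ! idx x)"
    unfolding leech_coords_def by (intro bexI[of _ m]) (auto simp: m_def)
  then show ?thesis
    by (simp add: lvec_def ivec_in_leech_iff)
qed

subsection \<open>An automorphism that is not monomial\<close>

text \<open>For each point the number of its tetrad, in the sextet whose tetrad 0 is \<open>{\<infinity>, 0, 1, 2}\<close>.\<close>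

definition tetrads :: "nat list" where
  "tetrads = [0, 0, 0, 1, 2, 1, 3, 3, 4, 5, 5, 4, 4, 2, 1, 5, 2, 1, 4, 3, 5, 3, 2, 0]"

definition tetrad :: "P1 \<Rightarrow> nat" where
  "tetrad x = tetrads ! idx x"

definition tetrad_sign :: "P1 \<Rightarrow> real" where
  "tetrad_sign x = (if tetrad x = 0 then -1 else 1)"

text \<open>Conway's non-monomial automorphism: subtract from each coordinate half the sum over its
  tetrad, then change the signs on one tetrad. Without the sign change the image of the odd generator would not be in the
  lattice.\<close>

definition sextet_map :: "real ^ P1 \<Rightarrow> real ^ P1" where
  "sextet_map x = (\<chi> i. tetrad_sign i * (x $ i - (\<Sum>j | tetrad j = tetrad i. x $ j) / 2))"

lemma card_tetrad: "card {j. tetrad j = tetrad i} = 4"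
proof -
  have "card {j. tetrad j = tetrad i} = (\<Sum>j\<in>UNIV. if tetrad j = tetrad i then 1 else 0)"
    by (simp add: sum.If_cases)
  also have "\<dots> = (\<Sum>k\<leftarrow>[0..<24]. if tetrads ! k = tetrad i then 1 else 0)"
    unfolding sum_P1 by (rule arg_cong[where f = sum_list], rule map_cong) (auto simp: tetrad_def idx_pt)
  also have "\<dots> = 4"
  proof -
    have "list_all (\<lambda>t. t < 6) tetrads \<and> length tetrads = 24"
      by code_simp
    then have "tetrad i < 6"
      using idx_less[of i] by (simp add: tetrad_def list_all_length)
    moreover have "list_all (\<lambda>t. (\<Sum>k\<leftarrow>[0..<24]. if tetrads ! k = t then 1 else 0 :: nat) = 4) [0..<6]"
      by code_simp
    ultimately show ?thesis
      by (simp add: list_all_iff del: upt_rec_numeral)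
  qed
  finally show ?thesis .
qed

lemma sextet_map_linear: "linear sextet_map"
  by (rule linearI) (auto simp: vec_eq_iff sextet_map_def sum.distrib sum_distrib_left[symmetric] algebra_simps add_divide_distrib)

lemma sextet_map_involution: "sextet_map (sextet_map x) = x"
  unfolding vec_eq_iff
proof
  fix i
  define s where "s = tetrad_sign i"
  have s: "s * s = 1"
    by (simp add: s_def tetrad_sign_def)
  have sj: "tetrad_sign j = s" if "tetrad j = tetrad i" for j
    using that by (simp add: s_def tetrad_sign_def)
  let ?T = "{j. tetrad j = tetrad i}" and ?S = "\<Sum>j | tetrad j = tetrad i. x $ j"
  have "(\<Sum>j\<in>?T. sextet_map x $ j) = (\<Sum>j\<in>?T. s * x $ j - s * (?S / 2))"
    by (rule sum.cong) (auto simp: sextet_map_def sj algebra_simps)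
  also have "\<dots> = - s * ?S"
    by (simp add: sum_subtractf sum_distrib_left[symmetric] card_tetrad)
  finally have "sextet_map (sextet_map x) $ i = s * (s * (x $ i - ?S / 2) + s * ?S / 2)"
    by (simp add: sextet_map_def[of "sextet_map x"]) (simp add: sextet_map_def s_def)
  also have "\<dots> = (s * s) * x $ i"
    by (simp add: algebra_simps)
  finally show "sextet_map (sextet_map x) $ i = x $ i"
    by (simp add: s)
qed

lemma sextet_map_symmetric: "sextet_map x \<bullet> y = x \<bullet> sextet_map y"
proof -
  have expand: "sextet_map x \<bullet> y = (\<Sum>i\<in>UNIV. tetrad_sign i * x $ i * y $ i) -
      (\<Sum>i\<in>UNIV. \<Sum>j\<in>UNIV. if tetrad j = tetrad i then tetrad_sign i * x $ j * y $ i / 2 else 0)" for x y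
  proof -
    have "sextet_map x \<bullet> y = (\<Sum>i\<in>UNIV. tetrad_sign i * x $ i * y $ i -
        (\<Sum>j\<in>UNIV. if tetrad j = tetrad i then tetrad_sign i * x $ j * y $ i / 2 else 0))"
      unfolding inner_vec_def
      by (rule sum.cong)
         (auto simp: sextet_map_def sum.If_cases sum_distrib_left sum_distrib_right sum_divide_distrib algebra_simps)
    then show ?thesis
      by (simp add: sum_subtractf)
  qed
  have "(\<Sum>i\<in>UNIV. \<Sum>j\<in>UNIV. if tetrad j = tetrad i then tetrad_sign i * x $ j * y $ i / 2 else 0) =
    (\<Sum>i\<in>UNIV. \<Sum>j\<in>UNIV. if tetrad j = tetrad i then tetrad_sign i * y $ j * x $ i / 2 else 0)"
    by (subst sum.swap) (auto intro!: sum.cong simp: tetrad_sign_def)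
  then show ?thesis
    using expand[of x y] expand[of y x] by (simp add: inner_commute mult.commute mult.left_commute)
qed

lemma sextet_map_inner: "sextet_map x \<bullet> sextet_map y = x \<bullet> y"
  by (simp add: sextet_map_symmetric sextet_map_involution)

lemma of_int_sum_list: "of_int (sum_list xs) = (\<Sum>x\<leftarrow>xs. of_int x)"
  by (induction xs) auto

definition tetrad_sum :: "nat \<Rightarrow> int list \<Rightarrow> int" where
  "tetrad_sum t L = (\<Sum>k\<leftarrow>[0..<24]. if tetrads ! k = t then L ! k else 0)"

definition subtract_halves :: "int list \<Rightarrow> int list \<Rightarrow> int list" where
  "subtract_halves L S = map (\<lambda>k. if tetrads ! k = 0 then S ! 0 - L ! k else L ! k - S ! (tetrads ! k)) [0..<24]"

text \<open>The sextet map on lists of integers, valid if the sums over tetrads are even.\<close>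

definition sextet_list :: "int list \<Rightarrow> int list" where
  "sextet_list L = subtract_halves L (map (\<lambda>t. tetrad_sum t L div 2) [0..<6])"

definition even_tetrads :: "int list \<Rightarrow> bool" where
  "even_tetrads L \<longleftrightarrow> list_all (\<lambda>t. tetrad_sum t L mod 2 = 0) [0..<6]"

lemma sextet_map_lvec:
  assumes "even_tetrads L"
  shows "sextet_map (lvec L) = lvec (sextet_list L)"
proof (rule lvec_eqI)
  fix k :: nat assume k: "k < 24"
  have "list_all (\<lambda>t. t < 6) tetrads \<and> length tetrads = 24"
    by code_simp
  then have t: "tetrads ! k < 6"
    using k by (simp add: list_all_length)
  have "(\<Sum>j | tetrad j = tetrads ! k. lvec L $ j) = (\<Sum>j\<in>UNIV. if tetrad j = tetrads ! k then lvec L $ j else 0)"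
    by (simp add: sum.If_cases)
  also have "\<dots> = (\<Sum>j\<leftarrow>[0..<24]. real_of_int (if tetrads ! j = tetrads ! k then L ! j else 0))"
    unfolding sum_P1 by (rule arg_cong[where f = sum_list], rule map_cong) (auto simp: tetrad_def idx_pt lvec_nth)
  also have "\<dots> = of_int (tetrad_sum (tetrads ! k) L)"
    unfolding tetrad_sum_def by (simp only: of_int_sum_list map_map comp_def)
  also have "tetrad_sum (tetrads ! k) L = 2 * (tetrad_sum (tetrads ! k) L div 2)"
  proof -
    have "tetrad_sum (tetrads ! k) L mod 2 = 0"
      using assms t by (simp add: even_tetrads_def list_all_iff del: upt_rec_numeral)
    then show ?thesis
      by presburger
  qed
  finally have "(\<Sum>j | tetrad j = tetrads ! k. lvec L $ j) / 2 = of_int (tetrad_sum (tetrads ! k) L div 2)"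
    by simp
  then show "sextet_map (lvec L) $ pt k = of_int (sextet_list L ! k)"
    using k t by (simp add: sextet_map_def tetrad_def[of "pt k"] idx_pt lvec_nth tetrad_sign_def
        sextet_list_def subtract_halves_def del: upt_rec_numeral)
qed

definition generator_lists :: "int list list" where
  "generator_lists = map (\<lambda>k. if k = 23 then 1 - 4 else 1) [0..<24] # map (\<lambda>k. if k = 23 then 8 else 0) [0..<24] #
     map (\<lambda>j. map (\<lambda>k. (if k = j then 4 else 0) - (if k = 23 then 4 else 0)) [0..<24]) [0..<24] @
     map (\<lambda>i. map (\<lambda>b. if b then 2 else 0) (cyclic_octad i)) [0..<12]"

lemma sextet_generators: "list_all (\<lambda>L. even_tetrads L \<and> leech_list (sextet_list L)) generator_lists"
  by code_simp

text \<open>The sextet map is an involution, so it suffices that it maps the lattice into itself; by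
  \<open>coords_in_subgroup\<close> this is a computation on finitely many generators.\<close>

lemma sextet_map_co0: "sextet_map \<in> co0"
proof -
  let ?H = "{x. sextet_map x \<in> leech_lattice}"
  have gen: "lvec L \<in> ?H" if "L \<in> set generator_lists" for L
    using sextet_generators that by (simp add: list_all_iff sextet_map_lvec leech_list)
  have sub: "additive_subgroup ?H"
    using linear_0[OF sextet_map_linear] linear_diff[OF sextet_map_linear]
    by (simp add: additive_subgroup_def leech_zero leech_diff)
  have None: "pt k = None \<longleftrightarrow> k = 23" if "k < 24" for k
    using that by (auto simp: pt_def)
  have "ivec odd_coords = lvec (map (\<lambda>k. if k = 23 then 1 - 4 else 1) [0..<24])"
    by (rule lvec_eqI) (simp add: odd_coords_def ind_def None)
  then have 1: "ivec odd_coords \<in> ?H"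
    by (simp only:) (rule gen, simp add: generator_lists_def del: upt_rec_numeral)
  have "8 *\<^sub>R nu None = lvec (map (\<lambda>k. if k = 23 then 8 else 0) [0..<24])"
    by (rule lvec_eqI) (simp add: nu_nth None)
  then have 2: "8 *\<^sub>R nu None \<in> ?H"
    by (simp only:) (rule gen, simp add: generator_lists_def del: upt_rec_numeral)
  have 3: "4 *\<^sub>R nu (pt j) - 4 *\<^sub>R nu None \<in> ?H" if j: "j < 24" for j
  proof -
    have "4 *\<^sub>R nu (pt j) - 4 *\<^sub>R nu None = lvec (map (\<lambda>k. (if k = j then 4 else 0) - (if k = 23 then 4 else 0)) [0..<24])"
      using j by (intro lvec_eqI) (simp add: nu_nth None pt_eq_iff)
    moreover have "map (\<lambda>k. (if k = j then 4 else 0) - (if k = 23 then 4 else 0)) [0..<24] \<in> set generator_lists"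
    proof -
      define F :: "nat \<Rightarrow> int list" where
        "F = (\<lambda>j. map (\<lambda>k. (if k = j then 4 else 0) - (if k = 23 then 4 else 0)) [0..<24])"
      have "F j \<in> set (map F [0..<24])"
        using j by (simp only: set_map set_upt) simp
      then have "F j \<in> set generator_lists"
        unfolding generator_lists_def F_def[symmetric] by (simp only: list.set set_append Un_iff insert_iff simp_thms)
      then show ?thesis
        by (simp only: F_def)
    qed
    ultimately show ?thesis
      using gen by (simp only:)
  qed
  have 4: "2 *\<^sub>R nu_set (of_bits (cyclic_octad i)) \<in> ?H" if i: "i < 12" for i
  proof -
    have "2 *\<^sub>R nu_set (of_bits (cyclic_octad i)) = lvec (map (\<lambda>b. if b then 2 else 0) (cyclic_octad i))"
      by (rule lvec_eqI) (simp add: nu_set_nth ind_def pt_in_of_bits)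
    moreover have "map (\<lambda>b. if b then 2 else 0) (cyclic_octad i) \<in> set generator_lists"
      using i by (simp add: generator_lists_def del: upt_rec_numeral)
    ultimately show ?thesis
      using gen by (simp only:)
  qed
  have "contains_generators ?H"
    unfolding contains_generators_def using 1 2 3 4 pt_idx idx_less by metis
  then have closed: "sextet_map x \<in> leech_lattice" if "x \<in> leech_lattice" for x
    using leech_imp_coords[OF that] coords_in_subgroup[OF sub] by auto
  show ?thesis
    by (rule co0I[OF sextet_map_linear sextet_map_inner closed closed sextet_map_involution])
qed

section \<open>Vectors of squared length 32\<close>

definition co0_to :: "real ^ P1 \<Rightarrow> real ^ P1 \<Rightarrow> bool" where
  "co0_to x y \<longleftrightarrow> (\<exists>g\<in>co0. g x = y)"

lemma co0_toI: "g \<in> co0 \<Longrightarrow> co0_to x (g x)"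
  by (auto simp: co0_to_def)

lemma co0_to_trans: "co0_to x y \<Longrightarrow> co0_to y z \<Longrightarrow> co0_to x z"
  unfolding co0_to_def by (metis co0_comp comp_apply)

lemma co0_to_leech: "co0_to x y \<Longrightarrow> x \<in> leech_lattice \<Longrightarrow> y \<in> leech_lattice"
  unfolding co0_to_def using co0_leech by blast

lemma co0_to_inner: "co0_to x y \<Longrightarrow> y \<bullet> y = x \<bullet> x"
  unfolding co0_to_def using co0_inner by blast

text \<open>All monomial steps have this form: change signs on a codeword, then permute coordinates.\<close>

lemma co0_to_monomial:
  assumes "A \<in> golay_code" "\<sigma> \<in> golay_aut" "\<And>i. y $ \<sigma> i = (if i \<in> A then - of_int (f i) else of_int (f i))"
  shows "co0_to (ivec f) y"
proof -
  have "perm_map \<sigma> (sign_map A (ivec f)) = y"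
    using assms(3) by (intro perm_map_eqI golay_aut_bij assms(2)) simp
  then show ?thesis
    using co0_to_trans[OF co0_toI[OF sign_map_co0[OF assms(1)]] co0_toI[OF perm_map_co0[OF assms(2)]]] by metis
qed

text \<open>The theorem \<open>golay_aut_transitive_octad\<close> with an arbitrary target in place of the standard one.\<close>

lemma octad_transport:
  assumes "K \<in> octads" "a \<in> K" "b \<in> K" "a \<noteq> b" "p \<notin> K" "q \<notin> K" "p \<noteq> q"
    and "L \<in> octads" "a' \<in> L" "b' \<in> L" "a' \<noteq> b'" "p' \<notin> L" "q' \<notin> L" "p' \<noteq> q'"
  obtains \<sigma> where "\<sigma> \<in> golay_aut" "\<sigma> a = a'" "\<sigma> b = b'" "\<sigma> p = p'" "\<sigma> q = q'" "\<sigma> ` K = L"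
proof -
  obtain \<sigma> where \<sigma>: "\<sigma> \<in> golay_aut" "\<sigma> a = pt 23" "\<sigma> b = pt 0" "\<sigma> p = pt 1" "\<sigma> q = pt 2" "\<sigma> ` K = of_bits std_octad"
    by (rule golay_aut_transitive_octad[OF assms(1-7)])
  obtain \<tau> where \<tau>: "\<tau> \<in> golay_aut" "\<tau> a' = pt 23" "\<tau> b' = pt 0" "\<tau> p' = pt 1" "\<tau> q' = pt 2" "\<tau> ` L = of_bits std_octad"
    by (rule golay_aut_transitive_octad[OF assms(8-14)])
  have inv: "inv' \<tau> (\<tau> x) = x" "inv' \<tau> ` \<tau> ` A = A" for x A
    using golay_aut_bij[OF \<tau>(1)] by (simp_all add: bij_is_inj image_comp)
  have "(inv' \<tau> \<circ> \<sigma>) ` K = L"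
    using inv(2)[of L] by (simp only: image_comp[symmetric] \<sigma>(6) \<tau>(6))
  moreover have "inv' \<tau> \<circ> \<sigma> \<in> golay_aut"
    using \<sigma>(1) \<tau>(1) by (intro golay_aut_comp golay_aut_inv)
  ultimately show ?thesis
    using inv(1)[of a'] inv(1)[of b'] inv(1)[of p'] inv(1)[of q'] \<sigma>(2-5) \<tau>(2-5)
    by (intro that[of "inv' \<tau> \<circ> \<sigma>"]) simp_all
qed

lemma octad_two_points:
  assumes "K \<in> octads"
  obtains a b where "a \<in> K" "b \<in> K" "a \<noteq> b"
proof -
  have "card K = 8"
    using assms by (simp add: octads_def)
  then show ?thesis
    using that card_le_Suc0_iff_eq[of K] by force
qed

lemma octad_two_points_outside:
  assumes "K \<in> octads"
  obtains p q where "p \<notin> K" "q \<notin> K" "p \<noteq> q"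
proof -
  have "card (- K) = 16"
    using assms card_projective_line by (simp add: octads_def Compl_eq_Diff_UNIV card_Diff_subset)
  then show ?thesis
    using that card_le_Suc0_iff_eq[of "- K"] by force
qed

lemma sq_less_4: "h * h < 4 \<Longrightarrow> h = -1 \<or> h = 0 \<or> h = 1" for h :: int
proof -
  assume *: "h * h < 4"
  have "\<bar>h\<bar> * \<bar>h\<bar> < 2 * 2"
    using * by simp
  then have "\<bar>h\<bar> < 2"
    using mult_mono[of 2 "\<bar>h\<bar>" 2 "\<bar>h\<bar>"] by force
  then show ?thesis
    by auto
qed

lemma sq_ge: "k \<ge> 0 \<Longrightarrow> k \<le> \<bar>h\<bar> \<Longrightarrow> k * k \<le> h * h" for h k :: int
  using mult_mono[of k "\<bar>h\<bar>" k "\<bar>h\<bar>"] by simp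

lemma member_le_sum_sq: "h i * h i \<le> (\<Sum>j\<in>UNIV. h j * h j)" for h :: "P1 \<Rightarrow> int"
  by (rule member_le_sum) auto

lemma sum_eq_member:
  fixes q :: "P1 \<Rightarrow> int"
  assumes "\<And>j. q j \<ge> 0" "(\<Sum>j\<in>UNIV. q j) \<le> q i" "j \<noteq> i"
  shows "q j = 0"
proof -
  have "(\<Sum>j\<in>UNIV. q j) = q i + (\<Sum>j\<in>UNIV - {i}. q j)"
    by (rule sum.remove) auto
  then have "(\<Sum>j\<in>UNIV - {i}. q j) \<le> 0"
    using assms(2) by simp
  moreover have "(\<Sum>j\<in>UNIV - {i}. q j) \<ge> 0"
    by (rule sum_nonneg) (use assms(1) in auto)
  ultimately have "(\<Sum>j\<in>UNIV - {i}. q j) = 0"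
    by linarith
  then have "\<forall>j\<in>UNIV - {i}. q j = 0"
    by (subst (asm) sum_nonneg_eq_0_iff) (use assms(1) in auto)
  then show ?thesis
    using assms(3) by blast
qed

lemma sum_sq_ivec: "ivec f \<bullet> ivec f = of_int N \<longleftrightarrow> (\<Sum>i\<in>UNIV. f i * f i) = N"
  by (simp only: ivec_inner of_int_eq_iff)

lemma divide_by_4:
  fixes f :: "P1 \<Rightarrow> int"
  assumes "\<And>i. f i mod 4 = 0" "(\<Sum>i\<in>UNIV. f i * f i) = 16 * N"
  obtains h where "\<And>i. f i = 4 * h i" "(\<Sum>i\<in>UNIV. h i * h i) = N"
proof -
  define h where "h i = f i div 4" for i
  have f: "f i = 4 * h i" for i
    unfolding h_def using assms(1)[of i] by presburger
  have "(\<Sum>i\<in>UNIV. f i * f i) = 16 * (\<Sum>i\<in>UNIV. h i * h i)"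
    unfolding f sum_distrib_left by (rule sum.cong) auto
  then show ?thesis
    using that[of h] f assms(2) by simp
qed

lemma support_of_units:
  fixes h :: "P1 \<Rightarrow> int"
  assumes "\<And>i. h i = -1 \<or> h i = 0 \<or> h i = 1"
  shows "(\<Sum>i\<in>UNIV. h i * h i) = int (card {i. h i \<noteq> 0})"
proof -
  have "(\<Sum>i\<in>UNIV. h i * h i) = (\<Sum>i\<in>UNIV. ind {i. h i \<noteq> 0} i)"
  proof (rule sum.cong)
    fix i
    show "h i * h i = ind {i. h i \<noteq> 0} i"
      using assms[of i] by (auto simp: ind_def)
  qed simp
  then show ?thesis
    by (simp only: sum_ind)
qed

text \<open>Vectors of squared length 32 have the shapes \<open>(4\<^sup>2, 0\<^sup>2\<^sup>2)\<close>, \<open>(2\<^sup>8, 0\<^sup>1\<^sup>6)\<close> and \<open>(-3, 1\<^sup>2\<^sup>3)\<close>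
  up to signs. Each shape is a single orbit of the monomial group; the sextet map leads from the third to the second
  and from the second to the first.\<close>

definition short_vec :: "real ^ P1" where
  "short_vec = 4 *\<^sub>R nu (pt 23) + 4 *\<^sub>R nu (pt 0)"

lemma short_vec_zero_mod_4:
  assumes norm: "(\<Sum>i\<in>UNIV. f i * f i) = 32" and 4: "\<And>i. f i mod 4 = 0"
  shows "co0_to (ivec f) short_vec"
proof -
  obtain h where h: "\<And>i. f i = 4 * h i" "(\<Sum>i\<in>UNIV. h i * h i) = 2"
    using divide_by_4[of f 2] norm 4 by auto
  have unit: "h i = -1 \<or> h i = 0 \<or> h i = 1" for i
    using member_le_sum_sq[of h i] h(2) by (intro sq_less_4) simp
  then have "card {i. h i \<noteq> 0} = 2"
    using support_of_units[of h] h(2) by simp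
  then obtain a b where ab: "{i. h i \<noteq> 0} = {a, b}" "a \<noteq> b"
    by (auto simp: card_2_iff)
  obtain c where c: "c \<noteq> a" "c \<noteq> b"
    using ex_point_notin[of "[a, b]"] by auto
  obtain d where d: "d \<noteq> a" "d \<noteq> b" "d \<noteq> c"
    using ex_point_notin[of "[a, b, c]"] by auto
  have dist: "distinct [a, b, c, d]"
    using ab(2) c d by auto
  obtain A where A: "A \<in> golay_code" "A \<inter> {a, b, c, d} = {i \<in> {a, b}. h i = -1}"
    using golay_prescribe_4[OF dist, of "{i \<in> {a, b}. h i = -1}"] by auto
  obtain \<sigma> where \<sigma>: "\<sigma> \<in> golay_aut" "\<sigma> a = pt 23" "\<sigma> b = pt 0"
    by (rule golay_aut_transitive_4[OF dist])
  have inj: "\<sigma> i = \<sigma> j \<longleftrightarrow> i = j" for i j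
    by (rule golay_aut_inj[OF \<sigma>(1)])
  show ?thesis
  proof (rule co0_to_monomial[OF A(1) \<sigma>(1)])
    fix i
    have val: "short_vec $ \<sigma> i = (if i = a then 4 else 0) + (if i = b then 4 else 0)"
      by (simp add: short_vec_def nu_nth \<sigma>(2)[symmetric] \<sigma>(3)[symmetric] inj)
    show "short_vec $ \<sigma> i = (if i \<in> A then - real_of_int (f i) else real_of_int (f i))"
    proof (cases "i \<in> {a, b}")
      case True
      have "i \<in> A \<longleftrightarrow> h i = -1"
        using A(2) True by blast
      moreover have "h i \<noteq> 0"
        using ab(1) True by blast
      ultimately show ?thesis
        using True unit[of i] ab(2) by (auto simp: val h(1))
    next
      case False
      then have "h i = 0"
        using ab(1) by blast
      then show ?thesis
        using False by (simp add: val h(1))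
    qed
  qed
qed

text \<open>Applied with \<open>q\<close> the squares of the coordinates, or what is left of them when some large coordinates are
  discounted: the codeword of coordinates that are 2 modulo 4 costs at least 4 at each place, and at least 8
  places, so squared length 32 leaves no room for anything else.\<close>

lemma octad_of_twos:
  fixes q :: "P1 \<Rightarrow> int"
  assumes K: "K \<in> golay_code" "K \<noteq> {}" and q: "\<And>i. q i \<ge> 4 * ind K i" "(\<Sum>i\<in>UNIV. q i) \<le> 32"
  shows "K \<in> octads" "q i = 4 * ind K i"
proof -
  have ge: "card K \<ge> 8"
    using K by (rule golay_min_weight)
  have "(\<Sum>i\<in>UNIV. q i - 4 * ind K i) = (\<Sum>i\<in>UNIV. q i) - 4 * int (card K)"
    by (simp add: sum_subtractf sum_ind_mult)
  moreover have "(\<Sum>i\<in>UNIV. q i - 4 * ind K i) \<ge> 0"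
    by (rule sum_nonneg) (use q(1) in simp)
  ultimately have "card K = 8" "(\<Sum>i\<in>UNIV. q i - 4 * ind K i) = 0"
    using ge q(2) by linarith+
  then show "K \<in> octads" "q i = 4 * ind K i"
    using K(1) q(1) by (simp_all add: octads_def sum_nonneg_eq_0_iff)
qed

text \<open>An octad that meets tetrad 0 in three points and every other tetrad in one point. The sextet map alone preserves
  some of the shapes; a preceding sign change on this octad makes it change them.\<close>

definition twist_word :: "bool list" where
  "twist_word = points [0, 1, 2, 3, 4, 7, 10, 12]"

definition sign_list :: "bool list \<Rightarrow> int list \<Rightarrow> int list" where
  "sign_list w L = map2 (\<lambda>b a. if b then - a else a) w L"

definition twist :: "int list \<Rightarrow> int list" where
  "twist L = sextet_list (sign_list twist_word L)"

lemma co0_to_twist: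
  assumes "length L = 24" "even_tetrads (sign_list twist_word L)"
  shows "co0_to (lvec L) (lvec (twist L))"
proof -
  have "dual_word twist_word \<and> length twist_word = 24"
    by code_simp
  then have twist_word: "of_bits twist_word \<in> golay_code" "length twist_word = 24"
    by (simp_all add: of_bits_in_golay)
  have "sign_map (of_bits twist_word) (lvec L) = lvec (sign_list twist_word L)"
    using assms(1) twist_word(2) by (intro lvec_eqI) (simp add: sign_list_def pt_in_of_bits lvec_nth)
  then show ?thesis
    using co0_to_trans[OF co0_toI[OF sign_map_co0[OF twist_word(1)], of "lvec L"] co0_toI[OF sextet_map_co0]]
      sextet_map_lvec[OF assms(2)] unfolding twist_def by simp
qed

lemma list_all_coord: "list_all P L \<Longrightarrow> length L = 24 \<Longrightarrow> P (L ! idx x)"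
  using idx_less by (simp add: list_all_length)

lemma length_twist [simp]: "length (twist L) = 24"
  by (simp add: twist_def sextet_list_def subtract_halves_def)

definition first_octad :: "nat list" where
  "first_octad = [0, 1, 2, 23, 4, 13, 16, 22]"

lemma first_octad: "pt ` set first_octad \<in> octads"
  using sextet_words octad_word by (simp only: first_octad_def)

definition twos :: "int list" where
  "twos = map (\<lambda>b. if b then 2 else 0) (points first_octad)"

lemma twist_twos: "even_tetrads (sign_list twist_word twos) \<and> list_all (\<lambda>a. a mod 4 = 0) (twist twos)"
  by code_simp

lemma nth_points: "k < 24 \<Longrightarrow> points ks ! k \<longleftrightarrow> k \<in> set ks"
  by (simp add: points_def)

lemma sum_from_co0_to:
  assumes "co0_to (ivec f) (ivec g)" "(\<Sum>i\<in>UNIV. f i * f i) = N"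
  shows "(\<Sum>i\<in>UNIV. g i * g i) = N"
  using co0_to_inner[OF assms(1)] assms(2) by (simp only: ivec_inner of_int_eq_iff)

lemma mod_4_eq_2: "a mod 4 = 2 \<Longrightarrow> a * a \<ge> 4" for a :: int
proof -
  assume "a mod 4 = 2"
  then have "2 \<le> \<bar>a\<bar>"
    by presburger
  then show ?thesis
    using sq_ge[of 2 a] by simp
qed

lemma sq_eq_4: "a * a = 4 \<Longrightarrow> a = 2 \<or> a = -2" for a :: int
  using square_eq_iff[of a 2] by simp

lemma even_coords:
  assumes "leech_coords f" "even (f i)"
  shows "f j mod 2 = 0" "{i. f i mod 4 = 2} \<in> golay_code" "(\<Sum>i\<in>UNIV. f i) mod 8 = 0"
proof -
  obtain m where m: "\<forall>i. f i mod 2 = m" "{i. f i mod 4 = m + 2} \<in> golay_code" "(\<Sum>i\<in>UNIV. f i) mod 8 = 4 * m"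
    by (rule leech_coordsE[OF assms(1)])
  have m0: "m = 0"
    using spec[OF m(1), of i] assms(2) by simp
  show "f j mod 2 = 0" "{i. f i mod 4 = 2} \<in> golay_code" "(\<Sum>i\<in>UNIV. f i) mod 8 = 0"
    using m[unfolded m0] by simp_all
qed

lemma odd_coords_sets:
  assumes "leech_coords f" "odd (f i)"
  shows "f j mod 2 = 1" "{i. f i mod 4 = 3} \<in> golay_code" "(\<Sum>i\<in>UNIV. f i) mod 8 = 4"
proof -
  obtain m where m: "m = 0 \<or> m = 1" "\<forall>i. f i mod 2 = m" "{i. f i mod 4 = m + 2} \<in> golay_code" "(\<Sum>i\<in>UNIV. f i) mod 8 = 4 * m"
    by (rule leech_coordsE[OF assms(1)])
  have m1: "m = 1"
    using spec[OF m(2), of i] assms(2) m(1) by presburger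
  show "f j mod 2 = 1" "{i. f i mod 4 = 3} \<in> golay_code" "(\<Sum>i\<in>UNIV. f i) mod 8 = 4"
    using m[unfolded m1] by simp_all
qed

lemma sum_signed:
  fixes f :: "P1 \<Rightarrow> int"
  assumes "\<And>i. f i = (if i \<in> N then - c i else c i)"
  shows "(\<Sum>i\<in>UNIV. f i) = (\<Sum>i\<in>UNIV. c i) - 2 * (\<Sum>i\<in>N. c i)"
proof -
  have "(\<Sum>i\<in>UNIV. f i) = (\<Sum>i\<in>UNIV. c i - (if i \<in> N then 2 * c i else 0))"
    by (rule sum.cong) (simp_all add: assms)
  also have "\<dots> = (\<Sum>i\<in>UNIV. c i) - (\<Sum>i\<in>N. 2 * c i)"
    by (simp add: sum_subtractf sum.If_cases)
  finally show ?thesis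
    by (simp add: sum_distrib_left)
qed

text \<open>For the shape \<open>(2\<^sup>8, 0\<^sup>1\<^sup>6)\<close> the number of negative signs is even, since the sum of the coordinates is
  divisible by 8. By \<open>golay_prescribe_octad\<close> all signs can then be made positive.\<close>

lemma short_vec_even:
  assumes f: "leech_coords f" and norm: "(\<Sum>i\<in>UNIV. f i * f i) = 32" and ev: "even (f i0)"
  shows "co0_to (ivec f) short_vec"
proof (cases "{i. f i mod 4 = 2} = {}")
  case True
  have "f i mod 4 = 0" for i
  proof -
    have "f i mod 4 \<noteq> 2"
      using True by auto
    with even_coords(1)[OF f ev, of i] show ?thesis
      by presburger
  qed
  then show ?thesis
    using norm by (rule short_vec_zero_mod_4[rotated])
next
  case False
  define K where "K = {i. f i mod 4 = 2}"
  have q: "f i * f i \<ge> 4 * ind K i" for i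
    using mod_4_eq_2[of "f i"] by (simp add: K_def ind_def)
  have KC: "K \<in> golay_code"
    unfolding K_def by (rule even_coords(2)[OF f ev])
  have Kne: "K \<noteq> {}"
    using False unfolding K_def .
  note part = octad_of_twos[where q = "\<lambda>i. f i * f i", OF KC Kne q]
  have K: "K \<in> octads"
    by (rule part(1)) (simp add: norm)
  have fK: "f i * f i = 4 * ind K i" for i
    by (rule part(2)) (simp add: norm)
  obtain p q where pq: "p \<notin> K" "q \<notin> K" "p \<noteq> q"
    using K by (rule octad_two_points_outside)
  obtain a b where ab: "a \<in> K" "b \<in> K" "a \<noteq> b"
    using K by (rule octad_two_points)
  define E where "E = {i \<in> K. f i = -2}"
  have f_eq: "f i = (if i \<in> E then - (2 * ind K i) else 2 * ind K i)" for i
    using fK[of i] sq_eq_4[of "f i"] by (auto simp: E_def ind_def split: if_splits)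
  have "(\<Sum>i\<in>E. 2 * ind K i) = (\<Sum>i\<in>E. 2)"
    by (rule sum.cong) (auto simp: E_def ind_def)
  then have "(\<Sum>i\<in>UNIV. f i) = 16 - 4 * int (card E)"
    using sum_signed[OF f_eq] K by (simp add: sum_ind_mult octads_def)
  then have "even (card E)"
    using even_coords(3)[OF f ev] by presburger
  moreover have "E \<inter> K = E"
    by (auto simp: E_def)
  ultimately obtain A where A: "A \<in> golay_code" "A \<inter> (K \<union> {p, q}) = E"
    using golay_prescribe_octad[OF K pq, of E] by (auto simp: E_def)
  have first: "pt 23 \<in> pt ` set first_octad" "pt 0 \<in> pt ` set first_octad"
    by (simp_all add: first_octad_def)
  obtain p' q' where pq': "p' \<notin> pt ` set first_octad" "q' \<notin> pt ` set first_octad" "p' \<noteq> q'"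
    using first_octad by (rule octad_two_points_outside)
  obtain \<sigma> where \<sigma>: "\<sigma> \<in> golay_aut" "\<sigma> ` K = pt ` set first_octad"
    by (rule octad_transport[OF K ab pq first_octad first _ pq']) (simp add: pt_eq_iff)
  have twos_nth: "lvec twos $ i = 2 * of_int (ind (pt ` set first_octad) i)" for i
  proof -
    obtain k where k: "k < 24" "i = pt k"
      using pt_cases by blast
    have "pt k \<in> pt ` set first_octad \<longleftrightarrow> k \<in> set first_octad"
      using k(1) by (auto simp: first_octad_def pt_eq_iff)
    then show ?thesis
      unfolding k(2) using k(1) by (simp add: lvec_nth twos_def nth_points ind_def)
  qed
  have step1: "co0_to (ivec f) (lvec twos)"
  proof (rule co0_to_monomial[OF A(1) \<sigma>(1)])
    fix i
    have "\<sigma> i \<in> pt ` set first_octad \<longleftrightarrow> i \<in> K"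
      unfolding \<sigma>(2)[symmetric] using golay_aut_bij[OF \<sigma>(1)] by (simp add: bij_is_inj inj_image_mem_iff)
    moreover have "i \<in> A \<longleftrightarrow> i \<in> E" if "i \<in> K"
      using A(2) that by blast
    moreover have "i \<notin> K \<Longrightarrow> i \<notin> E"
      by (simp add: E_def)
    ultimately show "lvec twos $ \<sigma> i = (if i \<in> A then - real_of_int (f i) else real_of_int (f i))"
      unfolding twos_nth f_eq by (cases "i \<in> K") (simp_all add: ind_def)
  qed
  have "co0_to (lvec twos) (lvec (twist twos))"
    using twist_twos by (intro co0_to_twist) (simp_all add: twos_def)
  with step1 have step2: "co0_to (ivec f) (lvec (twist twos))"
    by (rule co0_to_trans)
  have "co0_to (lvec (twist twos)) short_vec"
    unfolding lvec_def
  proof (rule short_vec_zero_mod_4)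
    show "(\<Sum>x\<in>UNIV. twist twos ! idx x * twist twos ! idx x) = 32"
      using sum_from_co0_to[OF step2[unfolded lvec_def] norm] .
    show "twist twos ! idx x mod 4 = 0" for x
      using twist_twos by (intro list_all_coord[where P = "\<lambda>a. a mod 4 = 0"]) simp_all
  qed
  with step2 show ?thesis
    by (rule co0_to_trans)
qed

definition odd_list :: "int list" where
  "odd_list = map (\<lambda>k. if k = 23 then -3 else 1) [0..<24]"

lemma twist_odd_list: "even_tetrads (sign_list twist_word odd_list) \<and> even (twist odd_list ! 0)"
  by code_simp

lemma odd_sq: "a mod 2 = 1 \<Longrightarrow> a * a = 1 \<or> a * a = 9 \<or> a * a \<ge> 25" for a :: int
proof -
  assume "a mod 2 = 1"
  then have "a = 1 \<or> a = -1 \<or> a = 3 \<or> a = -3 \<or> 5 \<le> \<bar>a\<bar>"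
    by presburger
  then show ?thesis
    using sq_ge[of 5 a] by auto
qed

text \<open>It remains to treat odd vectors. The coordinates that are 3 modulo 4 form a codeword, and
  changing their signs makes all coordinates 1 modulo 4, so the shape is \<open>(-3, 1\<^sup>2\<^sup>3)\<close> with these very signs.\<close>

theorem short_vec_transitive:
  assumes x: "x \<in> leech_lattice" and norm: "x \<bullet> x = 32"
  shows "co0_to x short_vec"
proof -
  obtain f where f: "x = ivec f" "leech_coords f"
    using x by (rule leech_cases)
  have norm': "(\<Sum>i\<in>UNIV. f i * f i) = 32"
    using norm unfolding f(1) sum_sq_ivec[of f 32, simplified] .
  show ?thesis
  proof (cases "even (f None)")
    case True
    then show ?thesis
      unfolding f(1) using f(2) norm' by (intro short_vec_even)
  next
    case False
    let ?A = "{i. f i mod 4 = 3}"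
    define g where "g i = (if i \<in> ?A then - f i else f i)" for i
    have A: "?A \<in> golay_code" and odd: "f i mod 2 = 1" for i
      using odd_coords_sets[OF f(2) False] by auto
    have g4: "g i mod 4 = 1" for i
      unfolding g_def using odd[of i] by simp presburger
    have gsq: "g i * g i = f i * f i" for i
      by (simp add: g_def)
    have "(\<Sum>i\<in>UNIV. f i * f i - 1) = 8"
      using norm' by (simp add: sum_subtractf)
    moreover have ge: "f i * f i - 1 = 0 \<or> f i * f i - 1 \<ge> 8" for i
      using odd_sq[OF odd[of i]] by auto
    ultimately obtain a where a: "f a * f a - 1 \<ge> 8"
      by (metis (no_types, lifting) sum.neutral zero_neq_numeral)
    have others: "f j * f j - 1 = 0" if "j \<noteq> a" for j
      using \<open>(\<Sum>i\<in>UNIV. f i * f i - 1) = 8\<close> a ge that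
      by (intro sum_eq_member[of "\<lambda>i. f i * f i - 1" a j]) (auto, smt (verit) ge)
    have "f a * f a \<le> 9"
    proof -
      have "f a * f a - 1 \<le> (\<Sum>i\<in>UNIV. f i * f i - 1)"
        using ge by (intro member_le_sum) (auto, smt (verit) ge)
      then show ?thesis
        using \<open>(\<Sum>i\<in>UNIV. f i * f i - 1) = 8\<close> by linarith
    qed
    then have "g a * g a = 3 * 3"
      unfolding gsq using a by linarith
    then have "g a = 3 \<or> g a = - 3"
      by (simp only: square_eq_iff)
    then have ga: "g a = -3"
      using g4[of a] by auto
    have gj: "g j = 1" if "j \<noteq> a" for j
    proof -
      have "g j * g j = 1 * 1"
        unfolding gsq using others[OF that] by simp
      then have "g j = 1 \<or> g j = - 1"
        by (simp only: square_eq_iff)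
      then show ?thesis
        using g4[of j] by auto
    qed
    obtain b c d where "distinct [a, b, c, d]"
    proof -
      obtain b where "b \<notin> set [a]" using ex_point_notin[of "[a]"] by auto
      moreover obtain c where "c \<notin> set [a, b]" using ex_point_notin[of "[a, b]"] by auto
      moreover obtain d where "d \<notin> set [a, b, c]" using ex_point_notin[of "[a, b, c]"] by auto
      ultimately show ?thesis
        by (intro that[of b c d]) auto
    qed
    then obtain \<sigma> where \<sigma>: "\<sigma> \<in> golay_aut" "\<sigma> a = pt 23"
      by (rule golay_aut_transitive_4)
    have step1: "co0_to (ivec f) (lvec odd_list)"
    proof (rule co0_to_monomial[OF A \<sigma>(1)])
      fix i
      have odd_nth: "lvec odd_list $ j = (if j = pt 23 then -3 else 1)" for j
      proof -
        obtain k where "k < 24" "j = pt k"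
          using pt_cases by blast
        then show ?thesis
          by (simp add: lvec_nth odd_list_def pt_eq_iff del: upt_rec_numeral)
      qed
      have "lvec odd_list $ \<sigma> i = of_int (g i)"
        unfolding odd_nth \<sigma>(2)[symmetric] golay_aut_inj[OF \<sigma>(1)] using ga gj by simp
      then show "lvec odd_list $ \<sigma> i = (if i \<in> ?A then - real_of_int (f i) else real_of_int (f i))"
        by (simp add: g_def)
    qed
    have "co0_to (lvec odd_list) (lvec (twist odd_list))"
      using twist_odd_list by (intro co0_to_twist) (simp_all add: odd_list_def)
    with step1 have step2: "co0_to (ivec f) (lvec (twist odd_list))"
      by (rule co0_to_trans)
    have "co0_to (lvec (twist odd_list)) short_vec"
      unfolding lvec_def
    proof (rule short_vec_even)
      show "leech_coords (\<lambda>x. twist odd_list ! idx x)"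
        using co0_to_leech[OF step2] x unfolding f(1) lvec_def ivec_in_leech_iff by blast
      show "(\<Sum>x\<in>UNIV. twist odd_list ! idx x * twist odd_list ! idx x) = 32"
        using sum_from_co0_to[OF step2[unfolded lvec_def] norm'] .
      show "even (twist odd_list ! idx (pt 0))"
        using twist_odd_list by (simp add: idx_pt)
    qed
    with step2 show ?thesis
      unfolding f(1) by (rule co0_to_trans)
  qed
qed

section \<open>Vectors of squared length 64\<close>

definition frame_vec :: "real ^ P1" where
  "frame_vec = 8 *\<^sub>R nu (pt 23)"

lemma sq_abs: "\<bar>a\<bar> = k \<Longrightarrow> a * a = k * k" for a k :: int
  by (metis abs_mult_self_eq)

text \<open>The simplest of the shapes of squared length 64 that occur below. The other ones are led back to
  it by the sextet map: \<open>(5, 3\<^sup>2, 1\<^sup>2\<^sup>1)\<close> leads to \<open>(6, 2\<^sup>7)\<close>, and the shapes \<open>(6, 2\<^sup>7)\<close> and \<open>(4\<^sup>2, 2\<^sup>8)\<close> lead to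
  coordinates divisible by 4, that is, to \<open>(8)\<close> or \<open>(4\<^sup>4)\<close>.\<close>

lemma to_frame_single:
  assumes norm: "(\<Sum>i\<in>UNIV. f i * f i) = 64" and a: "\<bar>f a\<bar> = 8"
  shows "co0_to (ivec f) frame_vec"
proof -
  have fa: "f a * f a = 64"
    using sq_abs[OF a] by simp
  have others: "f j = 0" if "j \<noteq> a" for j
    using sum_eq_member[of "\<lambda>i. f i * f i" a j] that norm fa by auto
  obtain b where b: "b \<notin> set [a]" using ex_point_notin[of "[a]"] by auto
  obtain c where c: "c \<notin> set [a, b]" using ex_point_notin[of "[a, b]"] by auto
  obtain d where d: "d \<notin> set [a, b, c]" using ex_point_notin[of "[a, b, c]"] by auto
  have dist: "distinct [a, b, c, d]"
    using b c d by auto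
  obtain A where A: "A \<in> golay_code" "A \<inter> {a, b, c, d} = {i \<in> {a}. f i = -8}"
    using golay_prescribe_4[OF dist, of "{i \<in> {a}. f i = -8}"] by auto
  obtain \<sigma> where \<sigma>: "\<sigma> \<in> golay_aut" "\<sigma> a = pt 23"
    using dist by (rule golay_aut_transitive_4)
  show ?thesis
  proof (rule co0_to_monomial[OF A(1) \<sigma>(1)])
    fix i
    have val: "frame_vec $ \<sigma> i = (if i = a then 8 else 0)"
      by (simp add: frame_vec_def nu_nth \<sigma>(2)[symmetric] golay_aut_inj[OF \<sigma>(1)])
    show "frame_vec $ \<sigma> i = (if i \<in> A then - real_of_int (f i) else real_of_int (f i))"
    proof (cases "i = a")
      case True
      have "a \<in> A \<longleftrightarrow> f a = -8"
        using A(2) by blast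
      moreover have "f a = 8 \<or> f a = -8"
        using a by linarith
      ultimately show ?thesis
        unfolding val using True by auto
    qed (simp add: val others)
  qed
qed

definition four_list :: "int list" where
  "four_list = map (\<lambda>b. if b then 4 else 0) (points [23, 0, 1, 2])"

lemma twist_four_list: "even_tetrads (sign_list twist_word four_list) \<and> \<bar>twist four_list ! 23\<bar> = 8"
  by code_simp

lemma to_frame_zero_mod_4:
  assumes norm: "(\<Sum>i\<in>UNIV. f i * f i) = 64" and 4: "\<And>i. f i mod 4 = 0"
  shows "co0_to (ivec f) frame_vec"
proof (cases "\<exists>a. \<bar>f a\<bar> = 8")
  case True
  then show ?thesis
    using norm to_frame_single by blast
next
  case False
  obtain h where h: "\<And>i. f i = 4 * h i" "(\<Sum>i\<in>UNIV. h i * h i) = 4"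
    using divide_by_4[of f 4] norm 4 by auto
  have unit: "h i = -1 \<or> h i = 0 \<or> h i = 1" for i
  proof (rule sq_less_4)
    have "h i * h i \<le> 2 * 2"
      using member_le_sum_sq[of h i] h(2) by simp
    moreover have "h i * h i \<noteq> 2 * 2"
    proof
      assume "h i * h i = 2 * 2"
      then have "h i = 2 \<or> h i = - 2"
        by (simp only: square_eq_iff)
      moreover have "\<bar>f i\<bar> \<noteq> 8"
        using False by blast
      ultimately show False
        using h(1)[of i] by auto
    qed
    ultimately show "h i * h i < 4"
      by simp
  qed
  then have "card {i. h i \<noteq> 0} = 4"
    using support_of_units[of h] h(2) by simp
  then obtain a b c d where S: "{i. h i \<noteq> 0} = {a, b, c, d}" "distinct [a, b, c, d]"
    by (auto simp: card_Suc_eq numeral_eq_Suc)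
  obtain A where A: "A \<in> golay_code" "A \<inter> {a, b, c, d} = {i \<in> {a, b, c, d}. h i = -1}"
    using golay_prescribe_4[OF S(2), of "{i \<in> {a, b, c, d}. h i = -1}"] by auto
  obtain \<sigma> where \<sigma>: "\<sigma> \<in> golay_aut" "\<sigma> a = pt 23" "\<sigma> b = pt 0" "\<sigma> c = pt 1" "\<sigma> d = pt 2"
    by (rule golay_aut_transitive_4[OF S(2)])
  have "lvec four_list $ j = (if j \<in> {pt 23, pt 0, pt 1, pt 2} then 4 else 0)" for j
  proof -
    obtain k where "k < 24" "j = pt k"
      using pt_cases by blast
    then show ?thesis
      by (simp add: lvec_nth four_list_def nth_points pt_eq_iff)
  qed
  then have val: "lvec four_list $ \<sigma> i = (if i \<in> {a, b, c, d} then 4 else 0)" for i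
    unfolding \<sigma>(2-5)[symmetric] by (simp add: golay_aut_inj[OF \<sigma>(1)])
  have step1: "co0_to (ivec f) (lvec four_list)"
  proof (rule co0_to_monomial[OF A(1) \<sigma>(1)])
    fix i
    show "lvec four_list $ \<sigma> i = (if i \<in> A then - real_of_int (f i) else real_of_int (f i))"
    proof (cases "i \<in> {a, b, c, d}")
      case True
      have "i \<in> A \<longleftrightarrow> h i = -1"
        using A(2) True by blast
      moreover have "h i \<noteq> 0"
        using S(1) True by blast
      ultimately show ?thesis
        unfolding val using True unit[of i] by (auto simp: h(1))
    next
      case False
      then have "h i = 0"
        using S(1) by blast
      then show ?thesis
        unfolding val using False by (simp add: h(1))
    qed
  qed
  have "co0_to (lvec four_list) (lvec (twist four_list))"
    using twist_four_list by (intro co0_to_twist) (simp_all add: four_list_def)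
  with step1 have step2: "co0_to (ivec f) (lvec (twist four_list))"
    by (rule co0_to_trans)
  have "co0_to (lvec (twist four_list)) frame_vec"
    unfolding lvec_def
  proof (rule to_frame_single)
    show "(\<Sum>x\<in>UNIV. twist four_list ! idx x * twist four_list ! idx x) = 64"
      using sum_from_co0_to[OF step2[unfolded lvec_def] norm] .
    show "\<bar>twist four_list ! idx (pt 23)\<bar> = 8"
      using twist_four_list by (simp add: idx_pt)
  qed
  with step2 show ?thesis
    by (rule co0_to_trans)
qed

definition six_list :: "int list" where
  "six_list = map (\<lambda>k. if k = 23 then 6 else if k = 0 then -2 else if k \<in> set first_octad then 2 else 0) [0..<24]"

lemma twist_six_list: "even_tetrads (sign_list twist_word six_list) \<and> list_all (\<lambda>a. a mod 4 = 0) (twist six_list)"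
  by code_simp

text \<open>In the shape \<open>(6, 2\<^sup>7)\<close> an odd number of signs is negative. All of them can be removed but one, which is placed
  at a second point \<open>b\<close>.\<close>

lemma to_frame_six:
  assumes f: "leech_coords f" and norm: "(\<Sum>i\<in>UNIV. f i * f i) = 64" and a: "\<bar>f a\<bar> = 6"
  shows "co0_to (ivec f) frame_vec"
proof -
  have ev: "even (f a)"
    using a by presburger
  define K where "K = {i. f i mod 4 = 2}"
  have aK: "a \<in> K"
    unfolding K_def mem_Collect_eq using a by presburger
  \<comment> \<open>The coordinate 6 counts like a coordinate 2, which leaves squared length 32.\<close>
  define q where "q i = (if i = a then 4 else f i * f i)" for i
  have "(\<Sum>i\<in>UNIV. f i * f i) = f a * f a + (\<Sum>i\<in>UNIV - {a}. f i * f i)"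
    by (rule sum.remove) auto
  moreover have "(\<Sum>i\<in>UNIV. q i) = q a + (\<Sum>i\<in>UNIV - {a}. q i)"
    by (rule sum.remove) auto
  moreover have "(\<Sum>i\<in>UNIV - {a}. q i) = (\<Sum>i\<in>UNIV - {a}. f i * f i)"
    by (rule sum.cong) (auto simp: q_def)
  ultimately have sum_q: "(\<Sum>i\<in>UNIV. q i) = 32"
    using norm sq_abs[OF a] by (simp add: q_def)
  have q: "q i \<ge> 4 * ind K i" for i
    using mod_4_eq_2[of "f i"] by (simp add: K_def ind_def q_def)
  have KC: "K \<in> golay_code"
    unfolding K_def by (rule even_coords(2)[OF f ev])
  have Kne: "K \<noteq> {}"
    using aK by auto
  have K: "K \<in> octads"
    by (rule octad_of_twos(1)[OF KC Kne q]) (simp add: sum_q)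
  have qK: "q i = 4 * ind K i" for i
    by (rule octad_of_twos(2)[OF KC Kne q]) (simp add: sum_q)
  obtain p r where pr: "p \<notin> K" "r \<notin> K" "p \<noteq> r"
    using K by (rule octad_two_points_outside)
  obtain b where b: "b \<in> K" "b \<noteq> a"
    using K by (metis octad_two_points)
  define c where "c i = 2 * ind K i + 4 * ind {a} i" for i
  define E where "E = {i \<in> K. f i < 0}"
  have f_eq: "f i = (if i \<in> E then - c i else c i)" for i
  proof (cases "i = a")
    case True
    then show ?thesis
      using a aK by (auto simp: E_def c_def ind_def)
  next
    case False
    then have "f i * f i = 4 * ind K i"
      using qK[of i] by (simp add: q_def)
    then show ?thesis
      using False sq_eq_4[of "f i"] by (auto simp: E_def c_def ind_def split: if_splits)
  qed
  have "(\<Sum>i\<in>E. c i) = (\<Sum>i\<in>E. 2 + 4 * ind {a} i)"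
    by (rule sum.cong) (auto simp: E_def c_def ind_def)
  also have "\<dots> = 2 * int (card E) + 4 * (\<Sum>i\<in>E. ind {a} i)"
    by (simp add: sum.distrib sum_distrib_left)
  finally have "(\<Sum>i\<in>UNIV. f i) = 20 - 4 * int (card E) - 8 * (\<Sum>i\<in>E. ind {a} i)"
    using sum_signed[OF f_eq] K by (simp add: c_def sum.distrib sum_ind_mult octads_def)
  then have oddE: "odd (card E)"
    using even_coords(3)[OF f ev] by presburger
  \<comment> \<open>One more negative sign, at \<open>b\<close>, makes the number of sign changes even.\<close>
  define E' where "E' = sym_diff E {b}"
  have E': "E' \<inter> K = E'" "E' \<subseteq> K \<union> {p, r}"
    using b(1) by (auto simp: E'_def E_def)
  have "even (card E')"
    using card_sym_diff[of E "{b}"] oddE by (simp add: E'_def) presburger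
  then obtain A where A: "A \<in> golay_code" "A \<inter> (K \<union> {p, r}) = E'"
    using golay_prescribe_octad[OF K pr E'(2)] E'(1) by auto
  have first: "pt 23 \<in> pt ` set first_octad" "pt 0 \<in> pt ` set first_octad"
    by (simp_all add: first_octad_def)
  obtain p' r' where pr': "p' \<notin> pt ` set first_octad" "r' \<notin> pt ` set first_octad" "p' \<noteq> r'"
    using first_octad by (rule octad_two_points_outside)
  obtain \<sigma> where \<sigma>: "\<sigma> \<in> golay_aut" "\<sigma> a = pt 23" "\<sigma> b = pt 0" "\<sigma> ` K = pt ` set first_octad"
    by (rule octad_transport[OF K aK b(1) b(2)[symmetric] pr first_octad first _ pr']) (simp add: pt_eq_iff)
  have six_nth: "lvec six_list $ j =
      (if j = pt 23 then 6 else if j = pt 0 then -2 else 2 * of_int (ind (pt ` set first_octad) j))" for j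
  proof -
    obtain k where k: "k < 24" "j = pt k"
      using pt_cases by blast
    have "pt k \<in> pt ` set first_octad \<longleftrightarrow> k \<in> set first_octad"
      using k(1) by (auto simp: first_octad_def pt_eq_iff)
    then show ?thesis
      unfolding k(2) using k(1) by (simp add: lvec_nth six_list_def ind_def pt_eq_iff del: upt_rec_numeral)
  qed
  have step1: "co0_to (ivec f) (lvec six_list)"
  proof (rule co0_to_monomial[OF A(1) \<sigma>(1)])
    fix i
    have mem: "\<sigma> i \<in> pt ` set first_octad \<longleftrightarrow> i \<in> K"
      unfolding \<sigma>(4)[symmetric] using golay_aut_bij[OF \<sigma>(1)] by (simp add: bij_is_inj inj_image_mem_iff)
    have val: "lvec six_list $ \<sigma> i = (if i = a then 6 else if i = b then -2 else 2 * of_int (ind K i))"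
      unfolding six_nth \<sigma>(2,3)[symmetric] golay_aut_inj[OF \<sigma>(1)] by (simp add: ind_def mem)
    have "i \<in> A \<longleftrightarrow> (i \<in> E) \<noteq> (i = b)" if "i \<in> K"
      using A(2) that unfolding E'_def by blast
    moreover have "i \<notin> K \<Longrightarrow> i \<notin> E"
      by (simp add: E_def)
    ultimately show "lvec six_list $ \<sigma> i = (if i \<in> A then - real_of_int (f i) else real_of_int (f i))"
      unfolding val f_eq using aK b by (cases "i \<in> K"; cases "i = a"; cases "i = b") (simp_all add: ind_def c_def)
  qed
  have "co0_to (lvec six_list) (lvec (twist six_list))"
    using twist_six_list by (intro co0_to_twist) (simp_all add: six_list_def)
  with step1 have step2: "co0_to (ivec f) (lvec (twist six_list))"
    by (rule co0_to_trans)
  have "co0_to (lvec (twist six_list)) frame_vec"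
    unfolding lvec_def
  proof (rule to_frame_zero_mod_4)
    show "(\<Sum>x\<in>UNIV. twist six_list ! idx x * twist six_list ! idx x) = 64"
      using sum_from_co0_to[OF step2[unfolded lvec_def] norm] .
    show "twist six_list ! idx x mod 4 = 0" for x
      using twist_six_list by (intro list_all_coord[where P = "\<lambda>a. a mod 4 = 0"]) simp_all
  qed
  with step2 show ?thesis
    by (rule co0_to_trans)
qed

definition five_list :: "int list" where
  "five_list = map (\<lambda>k. if k = 23 then 5 else if k = 0 \<or> k = 1 then -3 else 1) [0..<24]"

lemma twist_five_list: "even_tetrads (sign_list twist_word five_list) \<and> list_ex (\<lambda>k. \<bar>twist five_list ! k\<bar> = 6) [0..<24]"
  by code_simp

text \<open>Once all coordinates are 1 modulo 4 the shape is \<open>(5, -3, -3, 1\<^sup>2\<^sup>1)\<close>, because the squares of the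
  coordinates other than 5 exceed 1 by a total of 16, and each by 0, by 8 or by at least 24.\<close>

lemma to_frame_five:
  assumes f: "leech_coords f" and norm: "(\<Sum>i\<in>UNIV. f i * f i) = 64" and a: "\<bar>f a\<bar> = 5"
  shows "co0_to (ivec f) frame_vec"
proof -
  have od: "odd (f a)"
    using a by presburger
  let ?A = "{i. f i mod 4 = 3}"
  define g where "g i = (if i \<in> ?A then - f i else f i)" for i
  have A: "?A \<in> golay_code" and odd: "f i mod 2 = 1" for i
    using odd_coords_sets[OF f od] by auto
  have g4: "g i mod 4 = 1" for i
    unfolding g_def using odd[of i] by simp presburger
  have gsq: "g i * g i = f i * f i" for i
    by (simp add: g_def)
  have gabs: "\<bar>g i\<bar> = \<bar>f i\<bar>" for i
    by (simp add: g_def)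
  have ga: "g a = 5"
  proof -
    have "g a = 5 \<or> g a = -5"
      using gabs[of a] a by linarith
    then show ?thesis
      using g4[of a] by auto
  qed
  \<comment> \<open>The excess of the squares over 1, apart from the coordinate 5, is \<open>64 - 24 - 24\<close> in total.\<close>
  define q where "q i = (if i = a then 0 else g i * g i - 1)" for i
  have q: "q i = 0 \<or> q i \<ge> 8" for i
    unfolding q_def gsq using odd_sq[OF odd[of i]] by auto
  have q0: "q i \<ge> 0" for i
    using q[of i] by linarith
  have sum_q: "(\<Sum>i\<in>UNIV. q i) = 16"
  proof -
    have "(\<Sum>i\<in>UNIV. g i * g i - 1) = 40"
      using norm by (simp add: gsq sum_subtractf)
    moreover have "(\<Sum>i\<in>UNIV. g i * g i - 1) = (g a * g a - 1) + (\<Sum>i\<in>UNIV - {a}. g i * g i - 1)"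
      by (rule sum.remove) auto
    moreover have "(\<Sum>i\<in>UNIV. q i) = q a + (\<Sum>i\<in>UNIV - {a}. q i)"
      by (rule sum.remove) auto
    moreover have "(\<Sum>i\<in>UNIV - {a}. q i) = (\<Sum>i\<in>UNIV - {a}. g i * g i - 1)"
      by (rule sum.cong) (auto simp: q_def)
    ultimately show ?thesis
      by (simp add: ga q_def)
  qed
  have q_le: "q i \<le> 16" for i
    using member_le_sum[of i UNIV q] q0 sum_q by simp
  have q8: "q i = 0 \<or> q i = 8" for i
  proof -
    have "q i = 0 \<or> g i * g i = 9 \<or> g i * g i \<ge> 25" if "i \<noteq> a"
      using odd_sq[OF odd[of i]] that by (auto simp: q_def gsq)
    then show ?thesis
      using q_le[of i] by (cases "i = a") (auto simp: q_def)
  qed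
  define T where "T = {i. q i \<noteq> 0}"
  have "(\<Sum>i\<in>UNIV. q i) = (\<Sum>i\<in>UNIV. 8 * ind T i)"
  proof (rule sum.cong)
    fix i
    show "q i = 8 * ind T i"
      using q8[of i] by (auto simp: T_def ind_def)
  qed simp
  then have "card T = 2"
    using sum_q by (simp add: sum_ind_mult)
  then obtain b c where T: "T = {b, c}" "b \<noteq> c"
    by (auto simp: card_2_iff)
  have "a \<notin> T"
    by (simp add: T_def q_def)
  then have dist3: "distinct [a, b, c]"
    using T by auto
  obtain d where d: "d \<notin> set [a, b, c]" using ex_point_notin[of "[a, b, c]"] by auto
  then have dist: "distinct [a, b, c, d]"
    using dist3 by auto
  have g_vals: "g i = (if i = a then 5 else if i = b \<or> i = c then -3 else 1)" for i
  proof (cases "i = a")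
    case False
    show ?thesis
    proof (cases "i \<in> T")
      case True
      then have "g i * g i = 3 * 3"
        using q8[of i] False by (auto simp: T_def q_def)
      then have "g i = 3 \<or> g i = - 3"
        by (simp only: square_eq_iff)
      then show ?thesis
        using g4[of i] True T(1) False by auto
    next
      case notT: False
      then have "g i * g i = 1 * 1"
        using False by (simp add: T_def q_def)
      then have "g i = 1 \<or> g i = - 1"
        by (simp only: square_eq_iff)
      then show ?thesis
        using g4[of i] notT T(1) False by auto
    qed
  qed (simp add: ga)
  obtain \<sigma> where \<sigma>: "\<sigma> \<in> golay_aut" "\<sigma> a = pt 23" "\<sigma> b = pt 0" "\<sigma> c = pt 1"
    using dist by (rule golay_aut_transitive_4)
  have step1: "co0_to (ivec f) (lvec five_list)"
  proof (rule co0_to_monomial[OF A \<sigma>(1)])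
    fix i
    have five_nth: "lvec five_list $ j = (if j = pt 23 then 5 else if j = pt 0 \<or> j = pt 1 then -3 else 1)" for j
    proof -
      obtain k where "k < 24" "j = pt k"
        using pt_cases by blast
      then show ?thesis
        by (simp add: lvec_nth five_list_def pt_eq_iff del: upt_rec_numeral)
    qed
    have "lvec five_list $ \<sigma> i = of_int (g i)"
      unfolding five_nth \<sigma>(2-4)[symmetric] golay_aut_inj[OF \<sigma>(1)] g_vals by simp
    then show "lvec five_list $ \<sigma> i = (if i \<in> ?A then - real_of_int (f i) else real_of_int (f i))"
      by (simp add: g_def)
  qed
  have "co0_to (lvec five_list) (lvec (twist five_list))"
    using twist_five_list by (intro co0_to_twist) (simp_all add: five_list_def)
  with step1 have step2: "co0_to (ivec f) (lvec (twist five_list))"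
    by (rule co0_to_trans)
  obtain k where k: "k < 24" "\<bar>twist five_list ! k\<bar> = 6"
    using twist_five_list by (auto simp: list_ex_iff simp del: upt_rec_numeral)
  have "co0_to (lvec (twist five_list)) frame_vec"
    unfolding lvec_def
  proof (rule to_frame_six)
    have "ivec f \<in> leech_lattice"
      using f by (simp add: ivec_in_leech_iff)
    then show "leech_coords (\<lambda>x. twist five_list ! idx x)"
      using co0_to_leech[OF step2] unfolding lvec_def ivec_in_leech_iff by blast
    show "(\<Sum>x\<in>UNIV. twist five_list ! idx x * twist five_list ! idx x) = 64"
      using sum_from_co0_to[OF step2[unfolded lvec_def] norm] .
    show "\<bar>twist five_list ! idx (pt k)\<bar> = 6"
      using k by (simp add: idx_pt)
  qed
  with step2 show ?thesis
    by (rule co0_to_trans)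
qed

definition second_octad :: "nat list" where
  "second_octad = [4, 13, 16, 22, 3, 5, 14, 17]"

lemma second_octad: "pt ` set second_octad \<in> octads"
  using sextet_words octad_word by (simp only: second_octad_def)

definition four_two_list :: "int list" where
  "four_two_list = map (\<lambda>k. if k = 23 \<or> k = 0 then 4 else if k \<in> set second_octad then 2 else 0) [0..<24]"

lemma twist_four_two_list: "even_tetrads (sign_list twist_word four_two_list) \<and> list_all (\<lambda>a. a mod 4 = 0) (twist four_two_list)"
  by code_simp

text \<open>The octad of the coordinates \<open>\<plusminus>2\<close> together with the two places of the coordinates \<open>\<plusminus>4\<close> is the situation of
  \<open>golay_prescribe_octad\<close>.\<close>

lemma to_frame_four_two:
  assumes f: "leech_coords f" and norm: "(\<Sum>i\<in>UNIV. f i * f i) = 64"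
    and pr: "p \<noteq> r" "\<bar>f p\<bar> = 4" "\<bar>f r\<bar> = 4" and z: "f z mod 4 = 2"
  shows "co0_to (ivec f) frame_vec"
proof -
  have ev: "even (f z)"
    using z by presburger
  define K where "K = {i. f i mod 4 = 2}"
  have out: "p \<notin> K" "r \<notin> K"
    unfolding K_def mem_Collect_eq using pr(2,3) by presburger+
  have sq: "f p * f p = 16" "f r * f r = 16"
    using sq_abs[OF pr(2)] sq_abs[OF pr(3)] by simp_all
  \<comment> \<open>Without the two coordinates \<open>\<plusminus>4\<close> squared length 32 is left.\<close>
  define q where "q i = f i * f i - 16 * ind {p, r} i" for i
  have sum_q: "(\<Sum>i\<in>UNIV. q i) = 32"
    using norm pr(1) by (simp add: q_def sum_subtractf sum_ind_mult)
  have q: "q i \<ge> 4 * ind K i" for i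
    using mod_4_eq_2[of "f i"] out sq by (auto simp: K_def ind_def q_def)
  have KC: "K \<in> golay_code"
    unfolding K_def by (rule even_coords(2)[OF f ev])
  have Kne: "K \<noteq> {}"
    using z by (auto simp: K_def)
  have K: "K \<in> octads"
    by (rule octad_of_twos(1)[OF KC Kne q]) (simp add: sum_q)
  have qK: "q i = 4 * ind K i" for i
    by (rule octad_of_twos(2)[OF KC Kne q]) (simp add: sum_q)
  obtain a b where ab: "a \<in> K" "b \<in> K" "a \<noteq> b"
    using K by (rule octad_two_points)
  define c where "c i = 2 * ind K i + 4 * ind {p, r} i" for i
  define E where "E = {i \<in> K \<union> {p, r}. f i < 0}"
  have f_eq: "f i = (if i \<in> E then - c i else c i)" for i
  proof (cases "i \<in> {p, r}")
    case True
    then show ?thesis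
      using pr(2,3) out by (auto simp: E_def c_def ind_def)
  next
    case False
    then have "f i * f i = 4 * ind K i"
      using qK[of i] by (simp add: q_def ind_def)
    then show ?thesis
      using False sq_eq_4[of "f i"] by (auto simp: E_def c_def ind_def split: if_splits)
  qed
  have "(\<Sum>i\<in>E. c i) = (\<Sum>i\<in>E \<inter> K. c i) + (\<Sum>i\<in>E - K. c i)"
    by (rule sum.Int_Diff) simp
  also have "(\<Sum>i\<in>E \<inter> K. c i) = (\<Sum>i\<in>E \<inter> K. 2)"
    by (rule sum.cong) (use out in \<open>auto simp: c_def ind_def\<close>)
  also have "(\<Sum>i\<in>E - K. c i) = (\<Sum>i\<in>E - K. 4)"
    by (rule sum.cong) (auto simp: c_def ind_def E_def)
  finally have "(\<Sum>i\<in>UNIV. f i) = 24 - 4 * int (card (E \<inter> K)) - 8 * int (card (E - K))"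
    using sum_signed[OF f_eq] K pr(1) by (simp add: c_def sum.distrib sum_ind_mult octads_def)
  then have "even (card (E \<inter> K))"
    using even_coords(3)[OF f ev] by presburger
  moreover have "E \<subseteq> K \<union> {p, r}"
    by (auto simp: E_def)
  ultimately obtain A where A: "A \<in> golay_code" "A \<inter> (K \<union> {p, r}) = E"
    using golay_prescribe_octad[OF K out pr(1)] by blast
  have second: "pt 23 \<notin> pt ` set second_octad" "pt 0 \<notin> pt ` set second_octad"
    by (simp_all add: second_octad_def pt_eq_iff)
  obtain a' b' where ab': "a' \<in> pt ` set second_octad" "b' \<in> pt ` set second_octad" "a' \<noteq> b'"
    using second_octad by (rule octad_two_points)
  obtain \<sigma> where \<sigma>: "\<sigma> \<in> golay_aut" "\<sigma> p = pt 23" "\<sigma> r = pt 0" "\<sigma> ` K = pt ` set second_octad"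
    by (rule octad_transport[OF K ab out pr(1) second_octad ab' second]) (simp add: pt_eq_iff)
  have list_nth: "lvec four_two_list $ j =
      (if j = pt 23 \<or> j = pt 0 then 4 else 2 * of_int (ind (pt ` set second_octad) j))" for j
  proof -
    obtain k where k: "k < 24" "j = pt k"
      using pt_cases by blast
    have "pt k \<in> pt ` set second_octad \<longleftrightarrow> k \<in> set second_octad"
      using k(1) by (auto simp: second_octad_def pt_eq_iff)
    then show ?thesis
      unfolding k(2) using k(1) by (simp add: lvec_nth four_two_list_def ind_def pt_eq_iff del: upt_rec_numeral)
  qed
  have step1: "co0_to (ivec f) (lvec four_two_list)"
  proof (rule co0_to_monomial[OF A(1) \<sigma>(1)])
    fix i
    have mem: "\<sigma> i \<in> pt ` set second_octad \<longleftrightarrow> i \<in> K"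
      unfolding \<sigma>(4)[symmetric] using golay_aut_bij[OF \<sigma>(1)] by (simp add: bij_is_inj inj_image_mem_iff)
    have val: "lvec four_two_list $ \<sigma> i = (if i = p \<or> i = r then 4 else 2 * of_int (ind K i))"
      unfolding list_nth \<sigma>(2,3)[symmetric] golay_aut_inj[OF \<sigma>(1)] by (simp add: ind_def mem)
    have "i \<in> A \<longleftrightarrow> i \<in> E" if "i \<in> K \<union> {p, r}"
      using A(2) that by blast
    moreover have "i \<notin> K \<union> {p, r} \<Longrightarrow> i \<notin> E"
      by (simp add: E_def)
    ultimately show "lvec four_two_list $ \<sigma> i = (if i \<in> A then - real_of_int (f i) else real_of_int (f i))"
      unfolding val f_eq using out by (cases "i \<in> K"; cases "i = p"; cases "i = r") (simp_all add: ind_def c_def)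
  qed
  have "co0_to (lvec four_two_list) (lvec (twist four_two_list))"
    using twist_four_two_list by (intro co0_to_twist) (simp_all add: four_two_list_def)
  with step1 have step2: "co0_to (ivec f) (lvec (twist four_two_list))"
    by (rule co0_to_trans)
  have "co0_to (lvec (twist four_two_list)) frame_vec"
    unfolding lvec_def
  proof (rule to_frame_zero_mod_4)
    show "(\<Sum>x\<in>UNIV. twist four_two_list ! idx x * twist four_two_list ! idx x) = 64"
      using sum_from_co0_to[OF step2[unfolded lvec_def] norm] .
    show "twist four_two_list ! idx x mod 4 = 0" for x
      using twist_four_two_list by (intro list_all_coord[where P = "\<lambda>a. a mod 4 = 0"]) simp_all
  qed
  with step2 show ?thesis
    by (rule co0_to_trans)
qed

lemma sum_two_le:
  fixes f :: "P1 \<Rightarrow> int"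
  assumes "a \<noteq> b" "(\<Sum>i\<in>UNIV. f i * f i) = N"
  shows "f a * f a + f b * f b \<le> N"
proof -
  have "(\<Sum>i\<in>{a, b}. f i * f i) \<le> (\<Sum>i\<in>UNIV. f i * f i)"
    by (rule sum_mono2) auto
  then show ?thesis
    using assms by simp
qed

lemma no_coordinate_7:
  assumes f: "leech_coords f" and norm: "(\<Sum>i\<in>UNIV. f i * f i) = 64"
  shows "\<bar>f a\<bar> \<noteq> 7"
proof
  assume a: "\<bar>f a\<bar> = 7"
  then have "odd (f a)"
    by presburger
  then have odd: "f i mod 2 = 1" for i
    by (rule odd_coords_sets(1)[OF f])
  have "f a * f a - 1 \<le> (\<Sum>i\<in>UNIV. f i * f i - 1)"
  proof (rule member_le_sum)
    show "0 \<le> f i * f i - 1" for i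
      using odd_sq[OF odd[of i]] by auto
  qed auto
  then show False
    using norm sq_abs[OF a] by (simp add: sum_subtractf)
qed

text \<open>The vectors of squared length 64 form a single orbit of \<open>Co\<^sub>0\<close>, but their shapes are numerous. The
  second hypothesis, which says that the vector has product 32 with a vector of shape \<open>(4\<^sup>2, 0\<^sup>2\<^sup>2)\<close>, excludes the
  shapes \<open>(2\<^sup>1\<^sup>6, 0\<^sup>8)\<close> and \<open>(3\<^sup>5, 1\<^sup>1\<^sup>9)\<close>: two coordinates with sum 8 are at least 4 on average.\<close>

theorem to_frame:
  assumes f: "leech_coords f" and norm: "(\<Sum>i\<in>UNIV. f i * f i) = 64"
    and ab: "a \<noteq> b" "f a + f b = 8"
  shows "co0_to (ivec f) frame_vec"
proof -
  have le: "f a * f a + f b * f b \<le> 64"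
    using sum_two_le[OF ab(1) norm] .
  have "\<not> 9 \<le> \<bar>f a\<bar>" "\<not> 9 \<le> \<bar>f b\<bar>"
    using sq_ge[of 9 "f a"] sq_ge[of 9 "f b"] le zero_le_square[of "f a"] zero_le_square[of "f b"] by auto
  then have "f a \<in> {0, 1, 2, 3, 4, 5, 6, 7, 8}"
    using ab(2) by auto
  moreover have fb: "f b = 8 - f a"
    using ab(2) by simp
  ultimately consider "\<bar>f a\<bar> = 8 \<or> \<bar>f b\<bar> = 8" | "\<bar>f a\<bar> = 6 \<or> \<bar>f b\<bar> = 6" | "\<bar>f a\<bar> = 5 \<or> \<bar>f b\<bar> = 5" | "f a = 4" "f b = 4"
    | "\<bar>f a\<bar> = 7 \<or> \<bar>f b\<bar> = 7"
    by (elim insertE emptyE) (simp_all add: fb)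
  then show ?thesis
  proof cases
    case 1
    then show ?thesis using to_frame_single[OF norm] by blast
  next
    case 2
    then show ?thesis using to_frame_six[OF f norm] by blast
  next
    case 3
    then show ?thesis using to_frame_five[OF f norm] by blast
  next
    case 4
    show ?thesis
    proof (cases "\<exists>z. f z mod 4 = 2")
      case True
      then show ?thesis
        using to_frame_four_two[OF f norm ab(1)] 4 by auto
    next
      case False
      have "f i mod 4 = 0" for i
      proof -
        have "f i mod 4 \<noteq> 2"
          using False by blast
        moreover have "f i mod 2 = 0"
          by (rule even_coords(1)[OF f, of a]) (simp add: 4)
        ultimately show ?thesis
          by presburger
      qed
      then show ?thesis
        using to_frame_zero_mod_4[OF norm] by blast
    qed
  next
    case 5
    then show ?thesis using no_coordinate_7[OF f norm] by blast
  qed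
qed

section \<open>Automorphisms of the fundamental domain\<close>

text \<open>The lattice is integral and even for the form scaled by \<open>1/8\<close>. Both statements pass from the
  generators to their differences.\<close>

lemma leech_inner_int:
  assumes "x \<in> leech_lattice" "y \<in> leech_lattice"
  shows "x \<bullet> y / 8 \<in> \<int>" "x \<bullet> x / 16 \<in> \<int>"
proof -
  let ?G = "{2 *\<^sub>R nu_set K | K. K \<in> octads} \<union> {nu_set UNIV - 4 *\<^sub>R nu None}"
  have oct: "(2 *\<^sub>R nu_set K) \<bullet> (2 *\<^sub>R nu_set L) = 4 * real (card (K \<inter> L))" for K L
  proof -
    have "(\<Sum>i\<in>UNIV. 2 * ind K i * (2 * ind L i)) = 4 * (\<Sum>i\<in>UNIV. ind (K \<inter> L) i)"
      unfolding sum_distrib_left by (rule sum.cong) (auto simp: ind_def)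
    then show ?thesis
      unfolding octad_vec ivec_inner by (simp add: sum_ind)
  qed
  have mix: "(2 *\<^sub>R nu_set K) \<bullet> ivec odd_coords = 16 - 8 * of_int (ind K None)" if "K \<in> octads" for K
  proof -
    have "(\<Sum>i\<in>UNIV. 2 * ind K i * odd_coords i) = (\<Sum>i\<in>UNIV. 2 * ind K i - 8 * ind K None * ind {None} i)"
      by (rule sum.cong) (auto simp: ind_def odd_coords_def)
    also have "\<dots> = 2 * int (card K) - 8 * ind K None"
      by (simp add: sum_subtractf sum_ind_mult)
    finally show ?thesis
      using that unfolding octad_vec ivec_inner by (simp add: octads_def)
  qed
  have odd: "ivec odd_coords \<bullet> ivec odd_coords = 32"
  proof -
    have "(\<Sum>i\<in>UNIV. odd_coords i * odd_coords i) = (\<Sum>i\<in>UNIV. 1 + 8 * ind {None} i)"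
      by (rule sum.cong) (auto simp: ind_def odd_coords_def)
    then show ?thesis
      unfolding ivec_inner by (simp add: sum.distrib sum_ind_mult)
  qed
  have even: "\<exists>k. card (K \<inter> L) = 2 * k" if "K \<in> octads" "L \<in> octads" for K L
    using golay_self_orthogonal[of K L] that by (auto simp: octads_def elim: evenE)
  have gen: "x \<bullet> y / 8 \<in> \<int>" "x \<bullet> x / 16 \<in> \<int>" if x: "x \<in> ?G" and y: "y \<in> ?G" for x y
  proof -
    have "x \<bullet> y / 8 \<in> \<int>" if "x = 2 *\<^sub>R nu_set K" "y = 2 *\<^sub>R nu_set L" "K \<in> octads" "L \<in> octads" for K L
      using even[OF that(3,4)] that oct[of K L] by auto
    moreover have "x \<bullet> y / 8 \<in> \<int>" if "x = 2 *\<^sub>R nu_set K" "y = ivec odd_coords" "K \<in> octads" for K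
      using that mix[of K] by (auto simp: ind_def)
    moreover have "x \<bullet> y / 8 \<in> \<int>" if "y = 2 *\<^sub>R nu_set K" "x = ivec odd_coords" "K \<in> octads" for K
      using that mix[of K] by (auto simp: ind_def inner_commute)
    moreover have "x \<bullet> y / 8 \<in> \<int>" if "y = ivec odd_coords" "x = ivec odd_coords"
      using that odd by simp
    ultimately show "x \<bullet> y / 8 \<in> \<int>"
      using x y unfolding odd_vec by blast
    have "x \<bullet> x = 32"
      using x odd oct by (auto simp: odd_vec octads_def)
    then show "x \<bullet> x / 16 \<in> \<int>"
      by simp
  qed
  have int1: "x \<bullet> y / 8 \<in> \<int>" if "x \<in> leech_lattice" "y \<in> insert 0 ?G" for x y
    using that(1)[unfolded leech_lattice_def]
  proof (induction rule: group_closure.induct)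
    case (base s)
    then show ?case using gen(1)[of s y] that(2) by auto
  next
    case (diff s t)
    then show ?case by (simp add: inner_diff_left diff_divide_distrib)
  qed
  have int2: "x \<bullet> y / 8 \<in> \<int>" if x: "x \<in> leech_lattice" and y: "y \<in> leech_lattice" for x y
    using y[unfolded leech_lattice_def]
  proof (induction rule: group_closure.induct)
    case (base s)
    then show ?case using int1[OF x] by blast
  next
    case (diff s t)
    then show ?case by (simp add: inner_diff_right diff_divide_distrib)
  qed
  show "x \<bullet> y / 8 \<in> \<int>"
    using int2 assms by blast
  have "x \<in> leech_lattice \<and> x \<bullet> x / 16 \<in> \<int>"
    using assms(1)[unfolded leech_lattice_def]
  proof (induction rule: group_closure.induct)
    case (base s)
    moreover have "s \<in> leech_lattice"
      using base unfolding leech_lattice_def by (rule group_closure.base)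
    ultimately show ?case using gen(2)[of s s] by auto
  next
    case (diff s t)
    have "(s - t) \<bullet> (s - t) / 16 = s \<bullet> s / 16 + t \<bullet> t / 16 - s \<bullet> t / 8"
      by (simp add: inner_diff inner_commute field_simps)
    also have "\<dots> \<in> \<int>"
      using diff int2[of s t] by simp
    finally show ?case
      using diff leech_diff by blast
  qed
  then show "x \<bullet> x / 16 \<in> \<int>" ..
qed

text \<open>Evenness gives the bound 16. The true minimum is 32, but any bound that keeps lattice points apart
  suffices to recognize the walls.\<close>

lemma leech_sq_ge:
  assumes "x \<in> leech_lattice" "x \<noteq> 0"
  shows "x \<bullet> x \<ge> 16"
proof -
  obtain k :: int where k: "x \<bullet> x / 16 = of_int k"
    using leech_inner_int(2)[OF assms(1) assms(1)] by (elim Ints_cases)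
  moreover have "x \<bullet> x > 0"
    using assms(2) by simp
  ultimately have "real_of_int k > 0"
    by (metis divide_pos_pos zero_less_numeral)
  then have "k \<ge> 1"
    by simp
  then have "real_of_int k \<ge> 1"
    by simp
  then show ?thesis
    using k by simp
qed

text \<open>The Leech root of the lattice point \<open>X\<close>, written in the standard scalar product.\<close>

definition leech_root :: "real ^ P1 \<Rightarrow> amb" where
  "leech_root X = (X, 1, X \<bullet> X / 16 - 1)"

lemma leech_roots_eq: "leech_roots = leech_root ` leech_lattice"
proof
  show "leech_roots \<subseteq> leech_root ` leech_lattice"
  proof
    fix r assume r: "r \<in> leech_roots"
    obtain x l m where [simp]: "r = (x, l, m)"
      by (cases r)
    have "l = 1" "x \<in> leech_lattice" "- (x \<bullet> x) / 8 + 2 * m = -2"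
      using r by (auto simp: leech_roots_def weyl_def leech_form_def Pi_lattice_def)
    then show "r \<in> leech_root ` leech_lattice"
      by (auto simp: leech_root_def intro!: image_eqI[of _ _ x])
  qed
  show "leech_root ` leech_lattice \<subseteq> leech_roots"
    using leech_inner_int(2)
    by (auto simp: leech_root_def leech_roots_def weyl_def leech_form_def Pi_lattice_def)
qed

lemma Pi_form_root: "Pi_form (x, l, m) (leech_root Y) = l * (Y \<bullet> Y / 16 - 1) + m - x \<bullet> Y / 8"
  by (simp add: leech_root_def leech_form_def)

lemma Pi_form_roots: "Pi_form (leech_root X) (leech_root Y) = (X - Y) \<bullet> (X - Y) / 16 - 2"
  by (simp add: leech_root_def leech_form_def inner_diff inner_commute field_simps)

lemma Pi_form_commute: "Pi_form u v = Pi_form v u"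
  by (cases u; cases v) (simp add: leech_form_def inner_commute algebra_simps)

lemma Pi_form_add: "Pi_form (u + v) w = Pi_form u w + Pi_form v w"
  by (cases u; cases v; cases w) (simp add: leech_form_def inner_add_left algebra_simps add_divide_distrib diff_divide_distrib)

lemma Pi_form_scale: "Pi_form (c *\<^sub>R u) w = c * Pi_form u w"
  by (cases u; cases w) (simp add: leech_form_def algebra_simps)

lemma Pi_form_diff: "Pi_form (u - v) w = Pi_form u w - Pi_form v w"
  using Pi_form_add[of "u - v" v w] by simp

lemma Pi_form_add_right: "Pi_form w (u + v) = Pi_form w u + Pi_form w v"
  by (metis Pi_form_add Pi_form_commute)

lemma Pi_form_scale_right: "Pi_form w (c *\<^sub>R u) = c * Pi_form w u"
  by (metis Pi_form_scale Pi_form_commute)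

lemma Pi_form_nondegenerate:
  assumes "\<And>d. Pi_form u d = 0"
  shows "u = 0"
proof -
  obtain x l m where u: "u = (x, l, m)"
    by (cases u)
  have "x \<bullet> x = 0"
    using assms[of "(x, 0, 0)"] by (simp add: u leech_form_def)
  moreover have "l = 0" "m = 0"
    using assms[of "(0, 0, 1)"] assms[of "(0, 1, 0)"] by (simp_all add: u leech_form_def)
  ultimately show ?thesis
    by (simp add: u zero_prod_def)
qed

subsection \<open>The positive cone\<close>

text \<open>On the set of vectors of positive norm the coordinate \<open>l\<close> does not vanish, and its sign separates
  the two components.\<close>

definition upper_cone :: "amb set" where
  "upper_cone = {v. Pi_form v v > 0 \<and> fst (snd v) > 0}"

lemma Pi_form_self: "Pi_form (x, l, m) (x, l, m) = 2 * l * m - x \<bullet> x / 8"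
  by (simp add: leech_form_def)

declare Pi_form.simps [simp del]

lemma cone_nonzero: "Pi_form v v > 0 \<Longrightarrow> fst (snd v) \<noteq> 0"
  by (cases v) (auto simp: Pi_form_self, metis inner_ge_zero not_less)

text \<open>For fixed \<open>x\<close> and \<open>l > 0\<close> the norm is positive exactly if \<open>m\<close> exceeds \<open>x\<^sup>2/16l\<close>; this makes the cone a
  continuous image of a product of convex sets.\<close>

lemma connected_upper_cone: "connected upper_cone"
proof -
  let ?f = "\<lambda>(x :: real ^ P1, l :: real, t :: real). (x, l, x \<bullet> x / (16 * l) + t)"
  let ?S = "UNIV \<times> {0<..} \<times> {0<..} :: amb set"
  have "continuous_on ?S ?f"
    unfolding case_prod_unfold by (intro continuous_intros) auto
  moreover have "connected ?S"
    by (intro connected_Times) auto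
  ultimately have "connected (?f ` ?S)"
    by (rule connected_continuous_image)
  also have "?f ` ?S = upper_cone"
  proof
    show "?f ` ?S \<subseteq> upper_cone"
      by (auto simp: upper_cone_def Pi_form_self field_simps)
    show "upper_cone \<subseteq> ?f ` ?S"
    proof
      fix v assume v: "v \<in> upper_cone"
      obtain x l m where [simp]: "v = (x, l, m)"
        by (cases v)
      have l: "l > 0" "2 * l * m > x \<bullet> x / 8"
        using v by (auto simp: upper_cone_def Pi_form_self)
      then have "m - x \<bullet> x / (16 * l) > 0"
        by (simp add: field_simps)
      then show "v \<in> ?f ` ?S"
        using l by (auto intro!: image_eqI[of _ _ "(x, l, m - x \<bullet> x / (16 * l))"])
    qed
  qed
  finally show ?thesis .
qed

lemma pos_cone_eq: "pos_cone = upper_cone"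
  unfolding pos_cone_def
proof (rule the_equality)
  let ?S = "{v. Pi_form v v > 0}"
  have cont: "continuous_on T (\<lambda>v. fst (snd v))" for T :: "amb set"
    by (intro continuous_intros)
  have one: "(0, 1, 1) \<in> upper_cone"
    by (simp add: upper_cone_def Pi_form_self)
  have max: "T \<subseteq> upper_cone" if T: "connected T" "T \<subseteq> ?S" "T \<inter> upper_cone \<noteq> {}" for T
  proof
    fix v assume v: "v \<in> T"
    obtain u where u: "u \<in> T" "fst (snd u) > 0"
      using T(3) by (auto simp: upper_cone_def)
    have "connected ((\<lambda>v. fst (snd v)) ` T)"
      using T(1) cont by (intro connected_continuous_image)
    moreover have "0 \<notin> (\<lambda>v. fst (snd v)) ` T"
      using T(2) cone_nonzero by fastforce
    ultimately have "\<not> fst (snd v) \<le> 0"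
      using connectedD_interval[of "(\<lambda>v. fst (snd v)) ` T" "fst (snd v)" "fst (snd u)" 0] u v by auto
    then show "v \<in> upper_cone"
      using T(2) v by (auto simp: upper_cone_def)
  qed
  have comp: "upper_cone \<in> components ?S"
    unfolding in_components_maximal
  proof (intro conjI allI impI)
    show "upper_cone \<noteq> {}" "upper_cone \<subseteq> ?S" "connected upper_cone"
      using one connected_upper_cone by (auto simp only: upper_cone_def)
    fix T assume T: "T \<noteq> {} \<and> upper_cone \<subseteq> T \<and> T \<subseteq> ?S \<and> connected T"
    then have "T \<inter> upper_cone \<noteq> {}"
      using one by blast
    then show "T = upper_cone"
      using T max[of T] by blast
  qed
  moreover have "weyl \<in> closure upper_cone"
    unfolding closure_approachable
  proof (intro allI impI)
    fix e :: real assume e: "e > 0"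
    have "(0, e / 2, 1) \<in> upper_cone"
      using e by (simp add: upper_cone_def Pi_form_self)
    moreover have "dist (0 :: real ^ P1, e / 2, 1 :: real) weyl < e"
      using e by (simp add: weyl_def dist_prod_def)
    ultimately show "\<exists>y\<in>upper_cone. dist y weyl < e"
      by blast
  qed
  ultimately show "upper_cone \<in> components ?S \<and> weyl \<in> closure upper_cone"
    by blast
  fix P assume P: "P \<in> components ?S \<and> weyl \<in> closure P"
  show "P = upper_cone"
  proof (rule ccontr)
    assume "P \<noteq> upper_cone"
    then have "P \<inter> upper_cone = {}"
      using P comp components_nonoverlap by blast
    then have "P \<subseteq> {v. snd (snd v) \<le> 0}"
    proof (intro subsetI)
      fix v assume v: "v \<in> P"
      obtain x l m where [simp]: "v = (x, l, m)"
        by (cases v)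
      have "2 * l * m - x \<bullet> x / 8 > 0"
        using P v in_components_subset[of P ?S] by (auto simp: Pi_form_self)
      moreover have "\<not> l > 0"
        using \<open>P \<inter> upper_cone = {}\<close> v calculation by (auto simp: upper_cone_def Pi_form_self)
      ultimately have "2 * l * m > 0" "l \<le> 0"
        using inner_ge_zero[of x] by linarith+
      then have "m \<le> 0"
        by (auto simp: zero_less_mult_iff)
      then show "v \<in> {v. snd (snd v) \<le> 0}"
        by simp
    qed
    moreover have "closed {v :: amb. snd (snd v) \<le> 0}"
      by (intro closed_Collect_le continuous_intros)
    ultimately have "weyl \<in> {v. snd (snd v) \<le> 0}"
      using P closure_minimal by blast
    then show False
      by (simp add: weyl_def)
  qed
qed

lemma domain_D_iff: "v \<in> domain_D \<longleftrightarrow> Pi_form v v > 0 \<and> Pi_form v weyl > 0 \<and> (\<forall>r\<in>leech_roots. Pi_form v r \<ge> 0)"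
  unfolding domain_D_def pos_cone_eq upper_cone_def
  by (cases v) (simp add: weyl_def leech_form_def Pi_form.simps)

subsection \<open>Isometries\<close>

lemma isometry_bij:
  assumes "linear \<phi>" "\<And>u v. Pi_form (\<phi> u) (\<phi> v) = Pi_form u v"
  shows "bij (\<phi> :: amb \<Rightarrow> amb)"
proof -
  have "inj \<phi>"
  proof (subst linear_injective_0[OF assms(1)], intro allI impI)
    fix u assume "\<phi> u = 0"
    then have "Pi_form u d = 0" for d
      using assms(2)[of u d] Pi_form_scale[of 0 0 "\<phi> d"] by simp
    then show "u = 0"
      by (rule Pi_form_nondegenerate)
  qed
  then show ?thesis
    using assms(1) linear_injective_imp_surjective by (auto simp: bij_def)
qed

text \<open>An isometry of the lattice that fixes the Weyl vector permutes the Leech roots, by their definition, and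
  preserves the cone, which is also characterized by the sign of the product with the Weyl vector.\<close>

lemma Aut_D_memI:
  assumes lin: "linear \<phi>" and form: "\<And>u v. Pi_form (\<phi> u) (\<phi> v) = Pi_form u v"
    and lat: "\<phi> ` Pi_lattice = Pi_lattice" and w: "\<phi> weyl = weyl"
  shows "\<phi> \<in> Aut_D_carrier"
proof -
  have b: "bij \<phi>"
    using lin form by (rule isometry_bij)
  have lat_iff: "\<phi> r \<in> Pi_lattice \<longleftrightarrow> r \<in> Pi_lattice" for r
    using lat b by (metis bij_is_inj inj_image_mem_iff)
  have roots: "\<phi> r \<in> leech_roots \<longleftrightarrow> r \<in> leech_roots" for r
    using lat_iff[of r] form[of r r] form[of r weyl] by (simp add: leech_roots_def w)
  have D: "\<phi> v \<in> domain_D \<longleftrightarrow> v \<in> domain_D" for v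
  proof -
    have "(\<forall>r\<in>leech_roots. Pi_form (\<phi> v) r \<ge> 0) \<longleftrightarrow> (\<forall>r\<in>leech_roots. Pi_form v r \<ge> 0)"
    proof (intro iffI ballI)
      fix r assume "\<forall>r\<in>leech_roots. 0 \<le> Pi_form (\<phi> v) r" "r \<in> leech_roots"
      then show "0 \<le> Pi_form v r"
        using roots[of r] form[of v r] by auto
    next
      fix r assume *: "\<forall>r\<in>leech_roots. 0 \<le> Pi_form v r" "r \<in> leech_roots"
      obtain s where "r = \<phi> s"
        using b by (metis bij_pointE)
      then show "0 \<le> Pi_form (\<phi> v) r"
        using roots[of s] form[of v s] * by auto
    qed
    then show ?thesis
      using form[of v weyl] form[of v v] by (simp add: domain_D_iff w)
  qed
  have "\<phi> ` domain_D = domain_D"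
  proof
    show "\<phi> ` domain_D \<subseteq> domain_D"
      using D by blast
    show "domain_D \<subseteq> \<phi> ` domain_D"
    proof
      fix v assume "v \<in> domain_D"
      moreover obtain u where "v = \<phi> u"
        using b by (metis bij_pointE)
      ultimately show "v \<in> \<phi> ` domain_D"
        using D by blast
    qed
  qed
  then show ?thesis
    unfolding Aut_D_carrier_def using lin form lat by blast
qed

lemma Aut_D_linear: "\<phi> \<in> Aut_D_carrier \<Longrightarrow> linear \<phi>"
  and Aut_D_form: "\<phi> \<in> Aut_D_carrier \<Longrightarrow> Pi_form (\<phi> u) (\<phi> v) = Pi_form u v"
  and Aut_D_lattice: "\<phi> \<in> Aut_D_carrier \<Longrightarrow> \<phi> ` Pi_lattice = Pi_lattice"
  and Aut_D_domain: "\<phi> \<in> Aut_D_carrier \<Longrightarrow> \<phi> ` domain_D = domain_D"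
  unfolding Aut_D_carrier_def by blast+

lemma Aut_D_carrierI:
  "linear \<phi> \<Longrightarrow> (\<And>u v. Pi_form (\<phi> u) (\<phi> v) = Pi_form u v) \<Longrightarrow> \<phi> ` Pi_lattice = Pi_lattice \<Longrightarrow>
   \<phi> ` domain_D = domain_D \<Longrightarrow> \<phi> \<in> Aut_D_carrier"
  unfolding Aut_D_carrier_def by blast

lemma Aut_D_bij: "\<phi> \<in> Aut_D_carrier \<Longrightarrow> bij \<phi>"
  by (rule isometry_bij) (simp_all add: Aut_D_linear Aut_D_form)

lemma Aut_D_comp:
  assumes "\<phi> \<in> Aut_D_carrier" "\<psi> \<in> Aut_D_carrier"
  shows "\<phi> \<circ> \<psi> \<in> Aut_D_carrier"
proof -
  have "(\<phi> \<circ> \<psi>) ` Pi_lattice = Pi_lattice" "(\<phi> \<circ> \<psi>) ` domain_D = domain_D"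
    by (metis Aut_D_lattice assms image_comp) (metis Aut_D_domain assms image_comp)
  moreover have "linear (\<phi> \<circ> \<psi>)"
    using assms by (intro linear_compose Aut_D_linear)
  ultimately show ?thesis
    by (intro Aut_D_carrierI) (simp_all add: Aut_D_form assms)
qed

lemma Aut_D_inv:
  assumes \<phi>: "\<phi> \<in> Aut_D_carrier"
  shows "inv' \<phi> \<in> Aut_D_carrier"
proof -
  have b: "bij \<phi>"
    using \<phi> by (rule Aut_D_bij)
  have "linear (inv' \<phi>)"
  proof (rule linearI)
    show "inv' \<phi> (x + y) = inv' \<phi> x + inv' \<phi> y" for x y
      by (rule inv_f_eq[OF bij_is_inj[OF b]])
        (simp add: linear_add[OF Aut_D_linear[OF \<phi>]] surj_f_inv_f[OF bij_is_surj[OF b]])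
    show "inv' \<phi> (c *\<^sub>R x) = c *\<^sub>R inv' \<phi> x" for c x
      by (rule inv_f_eq[OF bij_is_inj[OF b]])
        (simp add: linear_scale[OF Aut_D_linear[OF \<phi>]] surj_f_inv_f[OF bij_is_surj[OF b]])
  qed
  moreover have "Pi_form (inv' \<phi> u) (inv' \<phi> v) = Pi_form u v" for u v
    using Aut_D_form[OF \<phi>, of "inv' \<phi> u" "inv' \<phi> v"] b by (simp add: bij_is_surj surj_f_inv_f)
  moreover have "inv' \<phi> ` Pi_lattice = Pi_lattice" "inv' \<phi> ` domain_D = domain_D"
    using image_inv_f_f[OF bij_is_inj[OF b], of Pi_lattice] Aut_D_lattice[OF \<phi>]
      image_inv_f_f[OF bij_is_inj[OF b], of domain_D] Aut_D_domain[OF \<phi>] by simp_all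
  ultimately show ?thesis
    by (intro Aut_D_carrierI)
qed

subsection \<open>Leech roots are the walls of the domain\<close>

lemma root_in: "X \<in> leech_lattice \<Longrightarrow> leech_root X \<in> leech_roots"
  by (simp add: leech_roots_eq)

lemma root_self: "r \<in> leech_roots \<Longrightarrow> Pi_form r r = -2"
  by (simp add: leech_roots_def)

text \<open>As a function of the lattice point \<open>Y\<close>, the product with a vector of the cone is a multiple of the squared
  distance from a centre, up to a constant. So only the roots of the finitely many lattice points near the centre can have a small product.\<close>

lemma Pi_form_root_centre:
  assumes "l \<noteq> 0"
  shows "Pi_form (x, l, m) (leech_root Y) =
    l / 16 * ((Y - (1 / l) *\<^sub>R x) \<bullet> (Y - (1 / l) *\<^sub>R x)) + (m - l - (x \<bullet> x) / (16 * l))"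
proof -
  have "(Y - (1 / l) *\<^sub>R x) \<bullet> (Y - (1 / l) *\<^sub>R x) = Y \<bullet> Y - 2 / l * (x \<bullet> Y) + (x \<bullet> x) / (l * l)"
    by (simp add: inner_diff inner_commute algebra_simps)
  then show ?thesis
    unfolding Pi_form_root using assms by (simp add: field_simps)
qed

text \<open>A perturbation of a vector changes its products with the roots at most by a rate that is quadratic in the distance
  of the lattice point from any chosen centre, the same order as in \<open>Pi_form_root_centre\<close>.\<close>

lemma Pi_form_root_bound:
  obtains C where "C > 0" "\<And>Y. \<bar>Pi_form d (leech_root Y)\<bar> \<le> C * (1 + (Y - a) \<bullet> (Y - a))"
proof -
  obtain x l m where d: "d = (x, l, m)"
    by (cases d)
  define A where "A = \<bar>l * (a \<bullet> a / 16 - 1) + m - x \<bullet> a / 8\<bar>"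
  define b where "b = (l / 8) *\<^sub>R a - (1 / 8) *\<^sub>R x"
  let ?C = "A + norm b + \<bar>l\<bar> + 1"
  have "\<bar>Pi_form d (leech_root Y)\<bar> \<le> ?C * (1 + (Y - a) \<bullet> (Y - a))" for Y
  proof -
    define w where "w = Y - a"
    have Y: "Y = a + w"
      by (simp add: w_def)
    have sq: "w \<bullet> w = norm w * norm w"
      by (simp add: power2_norm_eq_inner[symmetric] power2_eq_square)
    have nw: "norm w \<le> 1 + w \<bullet> w"
    proof -
      have "0 \<le> (norm w - 1) * (norm w - 1)"
        by simp
      also have "\<dots> = 1 + norm w * norm w - 2 * norm w"
        by (simp add: algebra_simps)
      finally show ?thesis
        unfolding sq using norm_ge_zero[of w] by linarith
    qed
    have "Pi_form d (leech_root Y) = (l * (a \<bullet> a / 16 - 1) + m - x \<bullet> a / 8) + b \<bullet> w + l * (w \<bullet> w) / 16"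
    proof -
      have "b \<bullet> w = l / 8 * (a \<bullet> w) - x \<bullet> w / 8"
        by (simp add: b_def inner_diff_left)
      moreover have "Y \<bullet> Y = a \<bullet> a + 2 * (a \<bullet> w) + w \<bullet> w" "x \<bullet> Y = x \<bullet> a + x \<bullet> w"
        by (simp_all add: Y inner_add inner_commute)
      ultimately show ?thesis
        unfolding d Pi_form_root by (simp add: field_simps)
    qed
    moreover have "\<bar>l * (w \<bullet> w) / 16\<bar> = \<bar>l\<bar> * (w \<bullet> w) / 16"
      by (simp add: abs_mult)
    ultimately have "\<bar>Pi_form d (leech_root Y)\<bar> \<le> A + \<bar>b \<bullet> w\<bar> + \<bar>l\<bar> * (w \<bullet> w) / 16"
      unfolding A_def by linarith
    also have "\<dots> \<le> A + norm b * norm w + \<bar>l\<bar> * (w \<bullet> w)"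
    proof -
      have "\<bar>l\<bar> * (w \<bullet> w) \<ge> 0"
        by simp
      then show ?thesis
        using Cauchy_Schwarz_ineq2[of b w] by linarith
    qed
    also have "\<dots> \<le> A * (1 + w \<bullet> w) + norm b * (1 + w \<bullet> w) + \<bar>l\<bar> * (1 + w \<bullet> w) + 1 * (1 + w \<bullet> w)"
    proof -
      have "A \<le> A * (1 + w \<bullet> w)" "norm b * norm w \<le> norm b * (1 + w \<bullet> w)" "\<bar>l\<bar> * (w \<bullet> w) \<le> \<bar>l\<bar> * (1 + w \<bullet> w)"
        using nw mult_left_mono[of 1 "1 + w \<bullet> w" A] by (simp_all add: A_def mult_left_mono)
      then show ?thesis
        by (intro add_increasing2 add_mono) (simp_all add: add_nonneg_nonneg)
    qed
    also have "\<dots> = ?C * (1 + w \<bullet> w)"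
      by (simp add: algebra_simps)
    finally show ?thesis
      by (simp add: w_def)
  qed
  moreover have "?C > 0"
    by (simp add: A_def add_nonneg_pos)
  ultimately show ?thesis
    using that by blast
qed

lemma cone_open:
  assumes v: "Pi_form v v > 0" "Pi_form v weyl > 0"
  obtains e where "e > 0" "\<And>t. 0 \<le> t \<Longrightarrow> t < e \<Longrightarrow> Pi_form (v + t *\<^sub>R d) (v + t *\<^sub>R d) > 0 \<and> Pi_form (v + t *\<^sub>R d) weyl > 0"
proof -
  have expand: "Pi_form (v + t *\<^sub>R d) (v + t *\<^sub>R d) = Pi_form v v + t * (2 * Pi_form v d + t * Pi_form d d)" for t
    using Pi_form_commute[of d v]
    by (simp add: Pi_form_add Pi_form_add_right Pi_form_scale Pi_form_scale_right algebra_simps)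
  have "isCont (\<lambda>t. Pi_form v v + t * (2 * Pi_form v d + t * Pi_form d d)) 0"
    by (intro continuous_intros)
  then have "((\<lambda>t. Pi_form v v + t * (2 * Pi_form v d + t * Pi_form d d)) \<longlongrightarrow> Pi_form v v) (at 0)"
    by (simp add: isCont_def)
  then have 1: "\<forall>\<^sub>F t in at 0. Pi_form (v + t *\<^sub>R d) (v + t *\<^sub>R d) > 0"
    unfolding expand using v(1) by (rule order_tendstoD)
  have "isCont (\<lambda>t. Pi_form v weyl + t * Pi_form d weyl) 0"
    by (intro continuous_intros)
  then have "((\<lambda>t. Pi_form v weyl + t * Pi_form d weyl) \<longlongrightarrow> Pi_form v weyl) (at 0)"
    by (simp add: isCont_def)
  then have 2: "\<forall>\<^sub>F t in at 0. Pi_form (v + t *\<^sub>R d) weyl > 0"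
    unfolding Pi_form_add Pi_form_scale using v(2) by (rule order_tendstoD)
  from eventually_conj[OF 1 2] obtain e where "e > 0"
    and e: "\<And>t. t \<noteq> 0 \<Longrightarrow> dist t 0 < e \<Longrightarrow> Pi_form (v + t *\<^sub>R d) (v + t *\<^sub>R d) > 0 \<and> Pi_form (v + t *\<^sub>R d) weyl > 0"
    unfolding eventually_at by auto
  then show ?thesis
    using v by (intro that[of e]) (metis add.right_neutral dist_real_def abs_of_nonneg diff_zero scaleR_zero_left)+
qed

text \<open>The sum of the root and \<open>2w\<close>, a multiple of the orthogonal projection of the Weyl vector \<open>w\<close> to the hyperplane of the root. By
  \<open>wall_point_root\<close> this point of the domain lies on no other hyperplane.\<close>

definition wall_point :: "real ^ P1 \<Rightarrow> amb" where
  "wall_point Y = (Y, 1, Y \<bullet> Y / 16 + 1)"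

lemma wall_point_root: "Pi_form (wall_point Y) (leech_root Z) = (Z - Y) \<bullet> (Z - Y) / 16"
  by (simp add: wall_point_def Pi_form_root inner_diff inner_commute field_simps)

lemma wall_point_cone: "Pi_form (wall_point Y) (wall_point Y) > 0" "Pi_form (wall_point Y) weyl > 0"
  by (simp_all add: wall_point_def Pi_form_self weyl_def Pi_form.simps leech_form_def)

lemma wall_point_domain: "wall_point Y \<in> domain_D"
  unfolding domain_D_iff leech_roots_eq using wall_point_cone by (auto simp: wall_point_root)

text \<open>Near such a point the domain is the half-space of the root. All other products are at least
  \<open>s/16\<close>, where \<open>s \<ge> 16\<close> is the squared distance of the lattice points, so a perturbation by at most
  \<open>(1 + s)/32\<close> keeps them positive.\<close>

lemma wall_point_inside:
  assumes Y: "Y \<in> leech_lattice" and d: "Pi_form d (leech_root Y) \<ge> 0"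
  obtains e where "e > 0" "\<And>t. 0 \<le> t \<Longrightarrow> t < e \<Longrightarrow> wall_point Y + t *\<^sub>R d \<in> domain_D"
proof -
  obtain e0 where e0: "e0 > 0" and cone: "\<And>t. 0 \<le> t \<Longrightarrow> t < e0 \<Longrightarrow>
      Pi_form (wall_point Y + t *\<^sub>R d) (wall_point Y + t *\<^sub>R d) > 0 \<and> Pi_form (wall_point Y + t *\<^sub>R d) weyl > 0"
    using cone_open[OF wall_point_cone, of Y d] by blast
  obtain C where C: "C > 0" "\<And>Z. \<bar>Pi_form d (leech_root Z)\<bar> \<le> C * (1 + (Z - Y) \<bullet> (Z - Y))"
    using Pi_form_root_bound[of d Y] by blast
  define e where "e = min e0 (1 / (32 * C))"
  have "wall_point Y + t *\<^sub>R d \<in> domain_D" if t: "0 \<le> t" "t < e" for t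
    unfolding domain_D_iff
  proof (intro conjI)
    show "0 < Pi_form (wall_point Y + t *\<^sub>R d) (wall_point Y + t *\<^sub>R d)" "0 < Pi_form (wall_point Y + t *\<^sub>R d) weyl"
      using cone[of t] t by (auto simp: e_def)
    show "\<forall>r\<in>leech_roots. 0 \<le> Pi_form (wall_point Y + t *\<^sub>R d) r"
    proof
      fix r assume "r \<in> leech_roots"
      then obtain Z where Z: "Z \<in> leech_lattice" "r = leech_root Z"
        by (auto simp: leech_roots_eq)
      let ?s = "(Z - Y) \<bullet> (Z - Y)"
      have form: "Pi_form (wall_point Y + t *\<^sub>R d) r = ?s / 16 + t * Pi_form d (leech_root Z)"
        by (simp add: Z(2) Pi_form_add Pi_form_scale wall_point_root)
      show "0 \<le> Pi_form (wall_point Y + t *\<^sub>R d) r"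
      proof (cases "Z = Y")
        case True
        then show ?thesis
          unfolding form using t d by simp
      next
        case False
        then have s: "?s \<ge> 16"
          using Z(1) Y leech_diff by (intro leech_sq_ge) auto
        have "t * C \<le> 1 / 32"
          using t C(1) by (simp add: e_def field_simps)
        then have "t * C * (1 + ?s) \<le> 1 / 32 * (1 + ?s)"
          using s by (intro mult_right_mono) auto
        moreover have "t * \<bar>Pi_form d (leech_root Z)\<bar> \<le> t * (C * (1 + ?s))"
          using C(2)[of Z] t by (intro mult_left_mono)
        moreover have "t * Pi_form d (leech_root Z) \<ge> - (t * \<bar>Pi_form d (leech_root Z)\<bar>)"
          using t by (smt (verit) mult_left_mono mult_minus_right)
        ultimately have "t * Pi_form d (leech_root Z) \<ge> - (1 / 32 * (1 + ?s))"
          by (simp only: mult.assoc[of t C "1 + ?s"])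
        moreover have "0 \<le> u / 16 + p" if "p \<ge> - (1 / 32 * (1 + u))" "16 \<le> u" for u p :: real
          using that by (simp add: field_simps)
        ultimately show ?thesis
          unfolding form using s by blast
      qed
    qed
  qed
  moreover have "e > 0"
    using e0 C(1) by (simp add: e_def)
  ultimately show ?thesis
    using that by blast
qed

lemma finite_leech_ball: "finite {Y \<in> leech_lattice. (Y - a) \<bullet> (Y - a) \<le> B}"
proof -
  obtain N :: nat where N: "norm a + sqrt B \<le> of_nat N"
    using real_arch_simple by blast
  have "{Y \<in> leech_lattice. (Y - a) \<bullet> (Y - a) \<le> B} \<subseteq> ivec ` (UNIV \<rightarrow>\<^sub>E {- int N..int N})"
  proof
    fix Y assume "Y \<in> {Y \<in> leech_lattice. (Y - a) \<bullet> (Y - a) \<le> B}"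
    then have Y: "Y \<in> leech_lattice" "norm (Y - a) \<le> sqrt B"
      by (auto simp: norm_eq_sqrt_inner)
    obtain f where f: "Y = ivec f"
      using Y(1) by (rule leech_cases)
    have "norm Y \<le> of_nat N"
      using Y(2) N norm_triangle_ineq[of a "Y - a"] by simp
    then have "\<bar>Y $ i\<bar> \<le> of_nat N" for i
      using component_le_norm_cart[of Y i] by linarith
    then have "real_of_int \<bar>f i\<bar> \<le> real_of_int (int N)" for i
      unfolding f by simp
    then have "\<bar>f i\<bar> \<le> int N" for i
      by (simp only: of_int_le_iff)
    then have "f i \<in> {- int N..int N}" for i
      by (simp add: abs_le_iff) (metis minus_le_iff)
    then show "Y \<in> ivec ` (UNIV \<rightarrow>\<^sub>E {- int N..int N})"
      unfolding f by blast
  qed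
  moreover have "finite (ivec ` (UNIV \<rightarrow>\<^sub>E {- int N..int N}))"
    by (intro finite_imageI finite_PiE) auto
  ultimately show ?thesis
    by (rule finite_subset)
qed

text \<open>Only finitely many roots have a small product with a point of the domain, so a direction that leaves the
  domain at once violates a wall through the point.\<close>

lemma wall_through:
  assumes V: "V \<in> domain_D" and out: "\<And>e. e > 0 \<Longrightarrow> \<exists>t. 0 < t \<and> t < e \<and> V + t *\<^sub>R R \<notin> domain_D"
  shows "\<exists>r\<in>leech_roots. Pi_form V r = 0"
proof (rule ccontr)
  assume "\<not> ?thesis"
  then have pos: "Pi_form V r > 0" if "r \<in> leech_roots" for r
    using V that unfolding domain_D_iff by force
  obtain x l m where Vx: "V = (x, l, m)"
    by (cases V)
  have l: "l > 0"
    using V by (simp add: domain_D_iff Vx weyl_def Pi_form.simps leech_form_def)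
  define a where "a = (1 / l) *\<^sub>R x"
  define k where "k = m - l - (x \<bullet> x) / (16 * l)"
  have formV: "Pi_form V (leech_root Y) = l / 16 * ((Y - a) \<bullet> (Y - a)) + k" for Y
    using l by (simp add: Vx Pi_form_root_centre a_def k_def)
  obtain C where C: "C > 0" "\<And>Y. \<bar>Pi_form R (leech_root Y)\<bar> \<le> C * (1 + (Y - a) \<bullet> (Y - a))"
    using Pi_form_root_bound[of R a] by blast
  obtain e0 where e0: "e0 > 0" and cone: "\<And>t. 0 \<le> t \<Longrightarrow> t < e0 \<Longrightarrow>
      Pi_form (V + t *\<^sub>R R) (V + t *\<^sub>R R) > 0 \<and> Pi_form (V + t *\<^sub>R R) weyl > 0"
    using cone_open[of V R] V by (auto simp: domain_D_iff)
  \<comment> \<open>Beyond this squared distance from the centre, the product with \<open>V\<close> is larger than half of its quadratic part.\<close>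
  define B where "B = 1 + 32 * \<bar>k\<bar> / l"
  define F where "F = {Y \<in> leech_lattice. (Y - a) \<bullet> (Y - a) \<le> B}"
  have finF: "finite F"
    unfolding F_def by (rule finite_leech_ball)
  have "\<exists>\<delta>>0. \<forall>Y\<in>F. \<delta> \<le> Pi_form V (leech_root Y)"
  proof (cases "F = {}")
    case False
    let ?\<delta> = "Min ((\<lambda>Y. Pi_form V (leech_root Y)) ` F)"
    have "?\<delta> > 0"
      using finF False pos root_in by (subst Min_gr_iff) (auto simp: F_def)
    moreover have "\<forall>Y\<in>F. ?\<delta> \<le> Pi_form V (leech_root Y)"
      using finF by auto
    ultimately show ?thesis
      by blast
  qed (auto intro: exI[of _ 1])
  then obtain \<delta> where \<delta>: "\<delta> > 0" "\<And>Y. Y \<in> F \<Longrightarrow> \<delta> \<le> Pi_form V (leech_root Y)"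
    by blast
  have B0: "B \<ge> 1"
    using l by (simp add: B_def)
  \<comment> \<open>The first bound keeps the cone, the second one controls the far roots, the third one the near roots.\<close>
  define e where "e = min e0 (min (l / (64 * C)) (\<delta> / (C * (1 + B))))"
  have "e > 0"
    using e0 l C(1) \<delta>(1) B0 by (simp add: e_def)
  then obtain t where t: "0 < t" "t < e" "V + t *\<^sub>R R \<notin> domain_D"
    using out by blast
  then obtain Y where Y: "Y \<in> leech_lattice" "Pi_form (V + t *\<^sub>R R) (leech_root Y) < 0"
    using cone[of t] by (auto simp: domain_D_iff leech_roots_eq e_def not_le)
  let ?s = "(Y - a) \<bullet> (Y - a)"
  have neg: "Pi_form V (leech_root Y) + t * Pi_form R (leech_root Y) < 0"
    using Y(2) by (simp add: Pi_form_add Pi_form_scale)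
  have "t * \<bar>Pi_form R (leech_root Y)\<bar> \<le> t * (C * (1 + ?s))"
    using C(2)[of Y] t(1) by (intro mult_left_mono) auto
  moreover have "t * Pi_form R (leech_root Y) \<ge> - (t * \<bar>Pi_form R (leech_root Y)\<bar>)"
    using t(1) by (smt (verit) mult_left_mono mult_minus_right)
  ultimately have neg': "Pi_form V (leech_root Y) < t * C * (1 + ?s)"
    using neg by (simp add: mult.assoc)
  show False
  proof (cases "?s \<le> B")
    case True
    then have "\<delta> \<le> Pi_form V (leech_root Y)"
      using Y(1) \<delta>(2) by (simp add: F_def)
    moreover have "t * C * (1 + ?s) \<le> t * C * (1 + B)"
      using True t(1) C(1) by (intro mult_left_mono) auto
    moreover have "t * (C * (1 + B)) \<le> \<delta>"
      using t(2) C(1) B0 by (simp add: e_def pos_less_divide_eq)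
    ultimately show False
      using neg' by (simp add: mult.assoc)
  next
    case False
    then have s: "?s > 1 + 32 * \<bar>k\<bar> / l"
      by (simp add: B_def)
    have "t * C \<le> l / 64"
      using t(2) C(1) by (simp add: e_def pos_less_divide_eq field_simps)
    then have "t * C * (1 + ?s) \<le> l / 64 * (1 + ?s)"
      by (intro mult_right_mono) (auto simp: add_nonneg_nonneg)
    also have "\<dots> \<le> l / 64 * (2 * ?s)"
    proof (rule mult_left_mono)
      have "32 * \<bar>k\<bar> / l \<ge> 0"
        using l by simp
      then show "1 + ?s \<le> 2 * ?s"
        using s by linarith
    qed (use l in simp)
    also have "\<dots> = l / 32 * ?s"
      by simp
    finally have "l / 16 * ?s + k < l / 32 * ?s"
      using neg' unfolding formV by linarith
    then have "l * ?s < - 32 * k"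
      by (simp add: field_simps)
    moreover have "l * ?s > l * (1 + 32 * \<bar>k\<bar> / l)"
      using s l by (intro mult_strict_left_mono)
    moreover have "l * (1 + 32 * \<bar>k\<bar> / l) = l + 32 * \<bar>k\<bar>"
      using l by (simp add: field_simps)
    ultimately show False
      using l by linarith
  qed
qed

text \<open>The image of a wall point of \<open>r\<close> lies on some wall, say that of a root \<open>\<phi> s\<close>. The domain near the wall point is the
  half-space of \<open>r\<close>, so the half-space of \<open>s\<close> contains that of \<open>r\<close>. Hence \<open>s\<close> is a positive multiple of
  \<open>r\<close>, and they are equal because they have the same norm.\<close>

lemma Aut_D_root:
  assumes \<phi>: "\<phi> \<in> Aut_D_carrier" and Y: "Y \<in> leech_lattice"
  shows "\<phi> (leech_root Y) \<in> leech_roots"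
proof -
  note lin = Aut_D_linear[OF \<phi>] and form = Aut_D_form[OF \<phi>] and b = Aut_D_bij[OF \<phi>]
  have dom: "\<phi> v \<in> domain_D \<longleftrightarrow> v \<in> domain_D" for v
    using inj_image_mem_iff[OF bij_is_inj[OF b], of v domain_D] by (simp only: Aut_D_domain[OF \<phi>])
  let ?V = "\<phi> (wall_point Y)" and ?r = "leech_root Y"
  have r2: "Pi_form ?r ?r = -2" and r0: "Pi_form (wall_point Y) ?r = 0"
    using root_self[OF root_in[OF Y]] by (simp_all add: wall_point_root)
  have "\<exists>r\<in>leech_roots. Pi_form ?V r = 0"
  proof (rule wall_through[where R = "\<phi> ?r"])
    show "?V \<in> domain_D"
      using dom wall_point_domain by blast
    fix e :: real assume e: "e > 0"
    have "wall_point Y + (e / 2) *\<^sub>R ?r \<notin> domain_D"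
    proof
      assume "wall_point Y + (e / 2) *\<^sub>R ?r \<in> domain_D"
      then have "Pi_form (wall_point Y + (e / 2) *\<^sub>R ?r) ?r \<ge> 0"
        using root_in[OF Y] by (simp add: domain_D_iff)
      then show False
        using e by (simp add: Pi_form_add Pi_form_scale r0 r2)
    qed
    moreover have "?V + (e / 2) *\<^sub>R \<phi> ?r = \<phi> (wall_point Y + (e / 2) *\<^sub>R ?r)"
      by (simp only: linear_add[OF lin] linear_scale[OF lin])
    ultimately have "?V + (e / 2) *\<^sub>R \<phi> ?r \<notin> domain_D"
      by (simp only: dom simp_thms)
    then show "\<exists>t. 0 < t \<and> t < e \<and> ?V + t *\<^sub>R \<phi> ?r \<notin> domain_D"
      using e by (intro exI[of _ "e / 2"]) auto
  qed
  then obtain r' where r': "r' \<in> leech_roots" "Pi_form ?V r' = 0"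
    by blast
  obtain s where s: "r' = \<phi> s"
    using b by (metis bij_pointE)
  have s2: "Pi_form s s = -2" and s0: "Pi_form (wall_point Y) s = 0"
    using r' root_self[OF r'(1)] form by (simp_all add: s)
  have half: "Pi_form d s \<ge> 0" if d: "Pi_form d ?r \<ge> 0" for d
  proof -
    obtain e where e: "e > 0" "\<And>t. 0 \<le> t \<Longrightarrow> t < e \<Longrightarrow> wall_point Y + t *\<^sub>R d \<in> domain_D"
      using wall_point_inside[OF Y d] by blast
    have "\<phi> (wall_point Y + (e / 2) *\<^sub>R d) \<in> domain_D"
      using e dom by simp
    then have "Pi_form (\<phi> (wall_point Y + (e / 2) *\<^sub>R d)) (\<phi> s) \<ge> 0"
      using r'(1) by (simp add: domain_D_iff s)
    then have "(e / 2) * Pi_form d s \<ge> 0"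
      by (simp add: form Pi_form_add Pi_form_scale s0)
    then show ?thesis
      using e(1) by (simp add: zero_le_mult_iff)
  qed
  \<comment> \<open>By the inclusion of half-spaces \<open>s\<close> vanishes on the hyperplane of \<open>r\<close>; \<open>s + (c/2) r\<close> is the component of \<open>s\<close> orthogonal to \<open>r\<close>.\<close>
  define c where "c = Pi_form ?r s"
  have "s + (c / 2) *\<^sub>R ?r = 0"
  proof (rule Pi_form_nondegenerate)
    fix d
    define k where "k = Pi_form d ?r"
    have 0: "Pi_form (d + (k / 2) *\<^sub>R ?r) ?r = 0"
      by (simp add: Pi_form_add Pi_form_scale r2 k_def)
    have "Pi_form (d + (k / 2) *\<^sub>R ?r) s \<ge> 0"
      using 0 by (intro half) simp
    moreover have "Pi_form ((-1) *\<^sub>R (d + (k / 2) *\<^sub>R ?r)) s \<ge> 0"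
      by (rule half, unfold Pi_form_scale) (use 0 in simp)
    ultimately have "Pi_form (d + (k / 2) *\<^sub>R ?r) s = 0"
      unfolding Pi_form_scale by linarith
    then have "Pi_form d s + k / 2 * c = 0"
      by (simp add: Pi_form_add Pi_form_scale c_def)
    then show "Pi_form (s + (c / 2) *\<^sub>R ?r) d = 0"
      by (simp add: Pi_form_add Pi_form_scale Pi_form_commute[of s d] Pi_form_commute[of ?r d] k_def mult.commute)
  qed
  then have s_eq: "s = (- c / 2) *\<^sub>R ?r"
    by (simp add: eq_neg_iff_add_eq_0)
  have "Pi_form ((-1) *\<^sub>R ?r) s \<ge> 0"
    by (rule half, unfold Pi_form_scale r2) simp
  then have c: "c \<le> 0"
    unfolding Pi_form_scale c_def by simp
  have "(- c / 2) * ((- c / 2) * (-2)) = -2"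
    using s2 unfolding s_eq Pi_form_scale Pi_form_scale_right r2 .
  then have "c * c = 2 * 2"
    by simp
  then have "c = 2 \<or> c = -2"
    by (simp only: square_eq_iff)
  then have "s = ?r"
    using c s_eq by auto
  then show ?thesis
    using r'(1) s by simp
qed

text \<open>The lattice points 0 and \<open>\<plusminus>8\<nu>\<^sub>i\<close> give enough equations.\<close>

lemma orthogonal_to_roots:
  assumes "\<And>Z. Z \<in> leech_lattice \<Longrightarrow> Pi_form u (leech_root Z) = 0"
  shows "u = 0"
proof -
  obtain x l m where u: "u = (x, l, m)"
    by (cases u)
  have m: "m = l"
    using assms[OF leech_zero] by (simp add: u Pi_form_root)
  have val: "l * (Z \<bullet> Z) / 16 = x \<bullet> Z / 8" if "Z \<in> leech_lattice" for Z
    using assms[OF that] by (simp add: u Pi_form_root m algebra_simps)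
  have "8 *\<^sub>R nu i \<in> leech_lattice" "- (8 *\<^sub>R nu i) \<in> leech_lattice" for i
    using leech_8 leech_minus by blast+
  note v = val[OF this(1)] val[OF this(2)]
  have nn: "nu i \<bullet> nu i = 1" "x \<bullet> nu i = x $ i" for i
    by (simp_all add: nu_def inner_axis)
  have "l = 0" "x $ i = 0" for i
    using v[of i] by (simp_all add: nn)
  then show ?thesis
    by (simp add: u m zero_prod_def vec_eq_iff)
qed

text \<open>Leech roots are permuted, so the image of the Weyl vector has product 1 with all of them, like the Weyl
  vector itself.\<close>

theorem Aut_D_weyl:
  assumes \<phi>: "\<phi> \<in> Aut_D_carrier"
  shows "\<phi> weyl = weyl"
proof -
  have "\<phi> weyl - weyl = 0"
  proof (rule orthogonal_to_roots)
    fix Z assume Z: "Z \<in> leech_lattice"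
    have b: "bij \<phi>"
      using \<phi> by (rule Aut_D_bij)
    have "inv' \<phi> (leech_root Z) \<in> leech_roots"
      using Aut_D_root[OF Aut_D_inv[OF \<phi>] Z] .
    then have "Pi_form weyl (inv' \<phi> (leech_root Z)) = 1"
      by (simp add: leech_roots_def Pi_form_commute)
    then have "Pi_form (\<phi> weyl) (\<phi> (inv' \<phi> (leech_root Z))) = 1"
      by (simp only: Aut_D_form[OF \<phi>])
    then have "Pi_form (\<phi> weyl) (leech_root Z) = 1"
      by (simp only: surj_f_inv_f[OF bij_is_surj[OF b]])
    moreover have "Pi_form weyl (leech_root Z) = 1"
      using root_in[OF Z] by (simp add: leech_roots_def Pi_form_commute)
    ultimately show "Pi_form (\<phi> weyl - weyl) (leech_root Z) = 0"
      by (simp add: Pi_form_diff)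
  qed
  then show ?thesis
    by simp
qed

subsection \<open>Affine isometries of the Leech lattice\<close>

text \<open>The isometries of the lattice induced by the linear automorphisms of \<open>\<Lambda>\<close> and, next, by its translations. On
  Leech roots they act as on the lattice points (\<open>linear_lift_root\<close>, \<open>translation_root\<close>).\<close>

definition linear_lift :: "(real ^ P1 \<Rightarrow> real ^ P1) \<Rightarrow> amb \<Rightarrow> amb" where
  "linear_lift g v = (g (fst v), snd v)"

definition translation :: "real ^ P1 \<Rightarrow> amb \<Rightarrow> amb" where
  "translation t v = (let x = fst v; l = fst (snd v); m = snd (snd v) in
     (x + l *\<^sub>R t, l, m + x \<bullet> t / 8 + l * (t \<bullet> t) / 16))"

lemma linear_lift_Pair [simp]: "linear_lift g (x, l, m) = (g x, l, m)"
  by (simp add: linear_lift_def)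

lemma translation_Pair [simp]:
  "translation t (x, l, m) = (x + l *\<^sub>R t, l, m + x \<bullet> t / 8 + l * (t \<bullet> t) / 16)"
  by (simp add: translation_def)

lemma linear_lift_Aut_D:
  assumes g: "g \<in> co0"
  shows "linear_lift g \<in> Aut_D_carrier"
proof (rule Aut_D_memI)
  show "linear (linear_lift g)"
    by (rule linearI) (auto simp: linear_add[OF co0_linear[OF g]] linear_scale[OF co0_linear[OF g]])
  show "Pi_form (linear_lift g u) (linear_lift g v) = Pi_form u v" for u v
    by (cases u; cases v) (simp add: Pi_form.simps leech_form_def co0_inner[OF g])
  have "linear_lift g ` (leech_lattice \<times> B) = (g ` leech_lattice) \<times> B" for B :: "(real \<times> real) set"
    by (auto simp: linear_lift_def image_iff)
  then show "linear_lift g ` Pi_lattice = Pi_lattice"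
    unfolding Pi_lattice_def by (simp add: co0_image[OF g])
  show "linear_lift g weyl = weyl"
    by (simp add: weyl_def linear_0[OF co0_linear[OF g]])
qed

lemma linear_lift_root: "g \<in> co0 \<Longrightarrow> linear_lift g (leech_root X) = leech_root (g X)"
  by (simp add: leech_root_def co0_inner)

lemma translation_Aut_D:
  assumes t: "t \<in> leech_lattice"
  shows "translation t \<in> Aut_D_carrier"
proof (rule Aut_D_memI)
  show "linear (translation t)"
    by (rule linearI) (auto simp: inner_add_left algebra_simps add_divide_distrib)
  show "Pi_form (translation t u) (translation t v) = Pi_form u v" for u v
    by (cases u; cases v) (simp add: Pi_form.simps leech_form_def inner_add_left inner_add_right inner_commute field_simps)
  have sub: "translation s v \<in> Pi_lattice" if s: "s \<in> leech_lattice" and v: "v \<in> Pi_lattice" for s v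
  proof -
    obtain x l m where [simp]: "v = (x, l, m)"
      by (cases v)
    have v': "x \<in> leech_lattice" "l \<in> \<int>" "m \<in> \<int>"
      using v by (simp_all add: Pi_lattice_def)
    obtain k where k: "l = of_int k"
      using v'(2) by (elim Ints_cases)
    have "x \<bullet> s / 8 \<in> \<int>" "s \<bullet> s / 16 \<in> \<int>"
      using leech_inner_int[OF v'(1) s] leech_inner_int(2)[OF s s] by blast+
    then have "m + x \<bullet> s / 8 + l * (s \<bullet> s / 16) \<in> \<int>"
      using v' by (intro Ints_add Ints_mult)
    moreover have "x + l *\<^sub>R s \<in> leech_lattice"
      unfolding k using v'(1) s by (intro leech_add leech_scale_int)
    ultimately show ?thesis
      using v' by (simp add: Pi_lattice_def)
  qed
  have "v \<in> translation t ` Pi_lattice" if "v \<in> Pi_lattice" for v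
  proof (rule image_eqI)
    show "translation (- t) v \<in> Pi_lattice"
      using sub[OF leech_minus[OF t] that] .
    show "v = translation t (translation (- t) v)"
      by (cases v) (simp add: inner_diff_left algebra_simps diff_divide_distrib)
  qed
  then show "translation t ` Pi_lattice = Pi_lattice"
    using sub[OF t] by blast
  show "translation t weyl = weyl"
    by (simp add: weyl_def)
qed

lemma translation_root: "translation t (leech_root X) = leech_root (X + t)"
  by (simp add: leech_root_def inner_add inner_commute field_simps)

section \<open>A normal form for the six lattice points\<close>

definition pair_vec :: "nat \<Rightarrow> nat \<Rightarrow> real ^ P1" where
  "pair_vec j k = 4 *\<^sub>R nu (pt j) + 4 *\<^sub>R nu (pt k)"

definition c_star :: "real ^ P1" where
  "c_star = ivec (\<lambda>i. 4 * ind (pt ` {23, 0, 1}) i - 1)"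

definition r_star :: "real ^ P1" where
  "r_star = ivec (\<lambda>i. 2 * ind (of_bits std_octad) i + 4 * ind {pt 1} i - 1)"

text \<open>The normal form, in the order of the nodes of the diagram: the points with indices 0 and 1 and those with
  indices 2 and 3 are joined. \<open>c_star\<close> has coordinate 3 at \<open>\<infinity>, 0, 1\<close> and \<open>-1\<close> elsewhere; \<open>r_star\<close> has
  coordinate 3 at 1, coordinate 1 on the standard octad and \<open>-1\<close> elsewhere.\<close>

definition stars :: "(real ^ P1) list" where
  "stars = [c_star, 0, pair_vec 23 0, r_star, pair_vec 23 1, pair_vec 0 1]"

text \<open>The squared distances of points whose roots form the diagram: joined roots have product 1, which is
  squared distance 48, and the others have product 0, which is squared distance 32.\<close>

definition config :: "(nat \<Rightarrow> real ^ P1) \<Rightarrow> bool" where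
  "config X \<longleftrightarrow> (\<forall>i<6. X i \<in> leech_lattice) \<and>
     (\<forall>i<6. \<forall>j<6. i \<noteq> j \<longrightarrow>
       (X i - X j) \<bullet> (X i - X j) = (if {i, j} \<in> {{0, 1}, {2, 3}} then 48 else 32))"

lemma nu_inner: "nu a \<bullet> nu b = (if a = b then 1 else 0)"
  by (simp add: nu_def inner_axis_axis)

lemma inner_nu: "x \<bullet> nu i = x $ i" "nu i \<bullet> x = x $ i"
  by (simp_all add: nu_def inner_axis inner_commute[of "axis i 1"])

lemma perm_map_nu: "\<sigma> \<in> golay_aut \<Longrightarrow> perm_map \<sigma> (nu a) = nu (\<sigma> a)"
  by (intro perm_map_eqI golay_aut_bij) (auto simp: nu_nth golay_aut_inj)

lemma sign_map_nu: "sign_map A (nu a) = (if a \<in> A then -1 else 1) *\<^sub>R nu a"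
  by (auto simp: vec_eq_iff nu_nth)

text \<open>In a vector of squared length 32, a coordinate 4 occurs in the shape \<open>(4\<^sup>2, 0\<^sup>2\<^sup>2)\<close> only.\<close>

lemma zero_mod_4_if_four:
  assumes f: "leech_coords f" and norm: "(\<Sum>i\<in>UNIV. f i * f i) = 32" and a: "f a = 4"
  shows "f i mod 4 = 0"
proof -
  have ev: "even (f a)"
    using a by simp
  define K where "K = {i. f i mod 4 = 2}"
  have KC: "K \<in> golay_code"
    unfolding K_def by (rule even_coords(2)[OF f ev])
  have q: "f i * f i \<ge> 4 * ind K i" for i
    using mod_4_eq_2[of "f i"] by (simp add: K_def ind_def)
  have "K = {}"
  proof (rule ccontr)
    assume "K \<noteq> {}"
    from octad_of_twos(2)[where q = "\<lambda>i. f i * f i", OF KC this q, of a] norm have "f a * f a = 4 * ind K a"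
      by simp
    then show False
      using a by (simp add: ind_def split: if_splits)
  qed
  then have "f i mod 4 \<noteq> 2"
    by (auto simp: K_def)
  with even_coords(1)[OF f ev, of i] show ?thesis
    by presburger
qed

text \<open>Here \<open>w\<close> is a vector of squared length 64 that is congruent to \<open>8\<nu>\<^sub>a\<close> modulo \<open>2\<Lambda>\<close> and orthogonal to it. Half
  their sum is a lattice vector of squared length 32 with a coordinate 4, so that \<open>w\<close> is \<open>\<plusminus>8\<nu>\<^sub>j\<close> for some \<open>j\<close>. In other
  words, one axis of a coordinate frame determines the frame.\<close>

lemma frame_neighbour:
  assumes y: "y \<in> leech_lattice" and w: "2 *\<^sub>R y = w + 8 *\<^sub>R nu a" and norm: "w \<bullet> w = 64" and orth: "w \<bullet> nu a = 0"
  obtains j s where "j \<noteq> a" "s = 1 \<or> s = -1" "w = (8 * s) *\<^sub>R nu j"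
proof -
  obtain f where f: "y = ivec f" "leech_coords f"
    using y by (rule leech_cases)
  have y_eq: "y = (1 / 2) *\<^sub>R (w + 8 *\<^sub>R nu a)"
    unfolding w[symmetric] by simp
  have "y \<bullet> y = 32"
    unfolding y_eq using norm orth by (simp add: inner_add nu_inner inner_commute[of "nu a"])
  then have norm': "(\<Sum>i\<in>UNIV. f i * f i) = 32"
    using sum_sq_ivec[of f 32] by (simp add: f(1))
  have "y $ a = 4"
    unfolding y_eq using orth by (simp add: inner_nu nu_nth)
  then have fa: "f a = 4"
    by (simp add: f(1))
  obtain h where h: "\<And>i. f i = 4 * h i" "(\<Sum>i\<in>UNIV. h i * h i) = 2"
    using divide_by_4[of f 2] zero_mod_4_if_four[OF f(2) norm' fa] norm' by auto
  have unit: "h i = -1 \<or> h i = 0 \<or> h i = 1" for i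
    using member_le_sum_sq[of h i] h(2) by (intro sq_less_4) simp
  then have "card {i. h i \<noteq> 0} = 2"
    using support_of_units[of h] h(2) by simp
  moreover have ha: "h a = 1"
    using fa h(1)[of a] by simp
  then have "a \<in> {i. h i \<noteq> 0}"
    by simp
  ultimately obtain u u' where xy: "{i. h i \<noteq> 0} = {u, u'}" "u \<noteq> u'" "a = u \<or> a = u'"
    by (auto simp: card_2_iff)
  obtain j where j: "{i. h i \<noteq> 0} = {a, j}" "j \<noteq> a"
  proof (cases "a = u")
    case True
    then show ?thesis
      using that[of u'] xy(1,2) by simp
  next
    case False
    then have "a = u'"
      using xy(3) by simp
    then show ?thesis
      using that[of u] xy(1,2) by (simp add: insert_commute)
  qed
  have "h j \<noteq> 0"
    using j(1) by blast
  then have s: "real_of_int (h j) = 1 \<or> real_of_int (h j) = -1"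
    using unit[of j] by auto
  have "w = 2 *\<^sub>R y - 8 *\<^sub>R nu a"
    using w by simp
  also have "\<dots> = (8 * real_of_int (h j)) *\<^sub>R nu j"
    unfolding vec_eq_iff
  proof
    fix i
    have "h i = 0" if "i \<noteq> a" "i \<noteq> j"
      using that j(1) by blast
    then show "(2 *\<^sub>R y - 8 *\<^sub>R nu a) $ i = ((8 * real_of_int (h j)) *\<^sub>R nu j) $ i"
      using ha j(2) by (cases "i = a"; cases "i = j") (auto simp: f(1) h(1) nu_nth)
  qed
  finally show ?thesis
    using that[OF j(2) s] by blast
qed

lemma Int_eqD: "A \<inter> S = E \<Longrightarrow> x \<in> S \<Longrightarrow> x \<in> A \<longleftrightarrow> x \<in> E"
  by blast

text \<open>The distances give all scalar products of the points, as one of them is 0. The points 2, 4, 5 are brought to the form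
  \<open>(4, 4, 0)\<close>, \<open>(4, 0, 4)\<close>, \<open>(0, 4, 4)\<close> first; the maps applied after that fix these three vectors.\<close>

theorem config_normal_form:
  assumes X: "config X" and X1: "X 1 = 0"
  shows "\<exists>g\<in>co0. \<forall>i<6. g (X i) = stars ! i"
proof -
  note [simp del] = One_nat_def
  have mem: "X i \<in> leech_lattice" if "i < 6" for i
    using X that by (simp add: config_def)
  have dist: "(X i - X j) \<bullet> (X i - X j) = (if {i, j} \<in> {{0, 1}, {2, 3}} then 48 else 32)"
    if "i < 6" "j < 6" "i \<noteq> j" for i j
    using X that by (simp add: config_def)
  have norms: "X 0 \<bullet> X 0 = 48" "X 2 \<bullet> X 2 = 32" "X 3 \<bullet> X 3 = 32" "X 4 \<bullet> X 4 = 32" "X 5 \<bullet> X 5 = 32"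
    using dist[of 0 1] dist[of 2 1] dist[of 3 1] dist[of 4 1] dist[of 5 1] by (simp_all add: X1 doubleton_eq_iff)
  have expand: "(u - v) \<bullet> (u - v) = u \<bullet> u + v \<bullet> v - 2 * (u \<bullet> v)" for u v :: "real ^ P1"
    by (simp add: inner_diff inner_commute)
  have prods: "X 0 \<bullet> X 2 = 24" "X 0 \<bullet> X 3 = 24" "X 0 \<bullet> X 4 = 24" "X 0 \<bullet> X 5 = 24"
      "X 2 \<bullet> X 3 = 8" "X 2 \<bullet> X 4 = 16" "X 2 \<bullet> X 5 = 16" "X 3 \<bullet> X 4 = 16" "X 3 \<bullet> X 5 = 16" "X 4 \<bullet> X 5 = 16"
    using dist[of 0 2] dist[of 0 3] dist[of 0 4] dist[of 0 5] dist[of 2 3] dist[of 2 4] dist[of 2 5]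
      dist[of 3 4] dist[of 3 5] dist[of 4 5] norms
    by (simp_all add: expand doubleton_eq_iff)
  obtain g1 where g1: "g1 \<in> co0" "g1 (X 2) = short_vec"
    using short_vec_transitive[OF mem norms(2)] by (auto simp: co0_to_def)
  \<comment> \<open>This vector of squared length 64 becomes an axis of the coordinate frame.\<close>
  let ?v = "X 2 + X 4 - X 5"
  have v: "?v \<in> leech_lattice" "?v \<bullet> ?v = 64" "?v \<bullet> X 2 = 32"
    using mem norms prods by (auto intro!: leech_add leech_diff simp: inner_add inner_diff prods[THEN trans[OF inner_commute]])
  obtain f where f: "g1 ?v = ivec f" "leech_coords f"
    using co0_leech[OF g1(1) v(1)] by (rule leech_cases)
  have "(\<Sum>i\<in>UNIV. f i * f i) = 64"
    using v(2) sum_sq_ivec[of f 64] co0_inner[OF g1(1), of ?v ?v] by (simp add: f(1))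
  moreover have "g1 ?v \<bullet> short_vec = 32"
    unfolding g1(2)[symmetric] co0_inner[OF g1(1)] by (rule v(3))
  then have "4 * real_of_int (f (pt 23)) + 4 * real_of_int (f (pt 0)) = 32"
    by (simp add: f(1) short_vec_def inner_add_right inner_nu)
  then have "f (pt 23) + f (pt 0) = 8"
    by linarith
  ultimately obtain g2 where g2: "g2 \<in> co0" "g2 (g1 ?v) = frame_vec"
    using to_frame[OF f(2), of "pt 23" "pt 0"] by (auto simp: pt_eq_iff f(1) co0_to_def)
  define Z where "Z i = g2 (g1 (X i))" for i
  have Zin: "Z i \<bullet> Z j = X i \<bullet> X j" for i j
    by (simp add: Z_def co0_inner g1 g2)
  have Zmem: "Z i \<in> leech_lattice" if "i < 6" for i
    using mem[OF that] g1(1) g2(1) by (simp add: Z_def co0_leech)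
  have Z245: "Z 2 + Z 4 - Z 5 = 8 *\<^sub>R nu (pt 23)"
    using g2(2) unfolding frame_vec_def Z_def
    by (simp add: linear_add[OF co0_linear] linear_diff[OF co0_linear] g1(1) g2(1))
  \<comment> \<open>Together with it, these vectors form three orthogonal vectors of a frame, congruent modulo \<open>2\<Lambda>\<close>.\<close>
  let ?w2 = "Z 2 - Z 4 + Z 5" and ?w3 = "Z 4 - Z 2 + Z 5"
  have w: "?w2 \<bullet> ?w2 = 64" "?w3 \<bullet> ?w3 = 64" "?w2 \<bullet> ?w3 = 0"
    "?w2 \<bullet> (Z 2 + Z 4 - Z 5) = 0" "?w3 \<bullet> (Z 2 + Z 4 - Z 5) = 0"
    using norms prods prods[THEN trans[OF inner_commute]] by (simp_all add: inner_add inner_diff Zin)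
  have half: "2 *\<^sub>R Z 2 = ?w2 + 8 *\<^sub>R nu (pt 23)" "2 *\<^sub>R Z 4 = ?w3 + 8 *\<^sub>R nu (pt 23)" "2 *\<^sub>R Z 5 = ?w2 + ?w3"
    unfolding Z245[symmetric] by (simp_all add: scaleR_2)
  have orth: "?w2 \<bullet> nu (pt 23) = 0" "?w3 \<bullet> nu (pt 23) = 0"
    using w(4,5) unfolding Z245 by simp_all
  obtain a s where a: "a \<noteq> pt 23" "s = 1 \<or> s = -1" "?w2 = (8 * s) *\<^sub>R nu a"
    using frame_neighbour[OF Zmem half(1) w(1) orth(1)] by auto
  obtain b t where b: "b \<noteq> pt 23" "t = 1 \<or> t = -1" "?w3 = (8 * t) *\<^sub>R nu b"
    using frame_neighbour[OF Zmem half(2) w(2) orth(2)] by auto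
  have ab: "a \<noteq> b"
    using w(3) a(2) b(2) unfolding a(3) b(3) by (auto simp: nu_inner)
  have halve: "y = (1 / 2) *\<^sub>R z" if "2 *\<^sub>R y = z" for y z :: "real ^ P1"
    unfolding that[symmetric] by simp
  have Z2: "Z 2 = 4 *\<^sub>R nu (pt 23) + (4 * s) *\<^sub>R nu a"
    and Z4: "Z 4 = 4 *\<^sub>R nu (pt 23) + (4 * t) *\<^sub>R nu b"
    and Z5: "Z 5 = (4 * s) *\<^sub>R nu a + (4 * t) *\<^sub>R nu b"
    using half[THEN halve] unfolding a(3) b(3) by (simp_all add: scaleR_right_distrib)
  obtain d where "d \<notin> set [pt 23, a, b]"
    using ex_point_notin[of "[pt 23, a, b]"] by auto
  then have distinct: "distinct [pt 23, a, b, d]"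
    using a(1) b(1) ab by auto
  \<comment> \<open>Signs are made positive on the two new axes, which are then moved to the points 0 and 1.\<close>
  let ?E = "{i \<in> {a, b}. (i = a \<and> s = -1) \<or> (i = b \<and> t = -1)}"
  obtain A where A: "A \<in> golay_code" "A \<inter> {pt 23, a, b, d} = ?E"
    using golay_prescribe_4[OF distinct, of ?E] by auto
  have Amem: "pt 23 \<notin> A" "a \<in> A \<longleftrightarrow> s = -1" "b \<in> A \<longleftrightarrow> t = -1"
  proof -
    have "x \<in> A \<longleftrightarrow> x \<in> ?E" if "x \<in> {pt 23, a, b, d}" for x
      by (rule Int_eqD[OF A(2) that])
    from this[of "pt 23"] this[of a] this[of b] show "pt 23 \<notin> A" "a \<in> A \<longleftrightarrow> s = -1" "b \<in> A \<longleftrightarrow> t = -1"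
      using a(1) b(1) ab by auto
  qed
  obtain \<sigma> where \<sigma>: "\<sigma> \<in> golay_aut" "\<sigma> (pt 23) = pt 23" "\<sigma> a = pt 0" "\<sigma> b = pt 1"
    using distinct by (rule golay_aut_transitive_4)
  define p where "p = perm_map \<sigma> \<circ> sign_map A"
  have p: "p \<in> co0"
    unfolding p_def using A(1) \<sigma>(1) by (intro co0_comp perm_map_co0 sign_map_co0)
  have p_nu: "p (nu i) = (if i \<in> A then -1 else 1) *\<^sub>R nu (\<sigma> i)" for i
    using linear_scale[OF co0_linear[OF perm_map_co0[OF \<sigma>(1)]]]
    by (simp add: p_def sign_map_nu perm_map_nu[OF \<sigma>(1)])
  define Y where "Y i = p (Z i)" for i
  have Yin: "Y i \<bullet> Y j = X i \<bullet> X j" for i j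
    by (simp add: Y_def co0_inner[OF p] Zin)
  have Ymem: "Y i \<in> leech_lattice" if "i < 6" for i
    using Zmem[OF that] by (simp add: Y_def co0_leech[OF p])
  have signs: "(4 * s) *\<^sub>R p (nu a) = 4 *\<^sub>R nu (pt 0)" "(4 * t) *\<^sub>R p (nu b) = 4 *\<^sub>R nu (pt 1)" "p (nu (pt 23)) = nu (pt 23)"
    unfolding p_nu using a(2) b(2) Amem by (auto simp: \<sigma>)
  have Y245: "Y 2 = pair_vec 23 0" "Y 4 = pair_vec 23 1" "Y 5 = pair_vec 0 1"
    unfolding Y_def Z2 Z4 Z5 pair_vec_def
    by (simp_all add: linear_add[OF co0_linear[OF p]] linear_scale[OF co0_linear[OF p]] signs)
  have Y1: "Y 1 = 0"
    by (simp add: Y_def Z_def X1 linear_0[OF co0_linear] g1 g2 p)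
  \<comment> \<open>The first point now has three coordinates equal to 3 and is otherwise determined up to signs.\<close>
  obtain f0 where f0: "Y 0 = ivec f0" "leech_coords f0"
    using Ymem[of 0] by (auto elim: leech_cases)
  have pair_inner: "ivec f \<bullet> pair_vec j k = of_int (4 * (f (pt j) + f (pt k)))" for f j k
    by (simp add: pair_vec_def inner_add_right inner_nu)
  have solve3: "f (pt j) + f (pt k) = n" if "ivec f \<bullet> pair_vec j k = of_int (4 * n)" for f j k n
    using that unfolding pair_inner of_int_eq_iff by simp
  have "f0 (pt 23) + f0 (pt 0) = 6" "f0 (pt 23) + f0 (pt 1) = 6" "f0 (pt 0) + f0 (pt 1) = 6"
    using Yin[of 0 2] Yin[of 0 4] Yin[of 0 5] prods by (intro solve3; simp add: Y245 f0(1))+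
  then have f0_vals: "f0 (pt 23) = 3" "f0 (pt 0) = 3" "f0 (pt 1) = 3"
    by linarith+
  have odd0: "odd (f0 (pt 23))"
    by (simp add: f0_vals)
  have norm0: "(\<Sum>i\<in>UNIV. f0 i * f0 i) = 48"
    using Yin[of 0 0] norms(1) sum_sq_ivec[of f0 48] by (simp add: f0(1))
  have three: "pt ` {23, 0, 1} = {pt 23, pt 0, pt 1}" "card {pt 23, pt 0, pt 1} = 3"
    by (simp_all add: pt_eq_iff)
  have rest0: "f0 i * f0 i = 1" if "i \<notin> {pt 23, pt 0, pt 1}" for i
  proof -
    define q where "q i = f0 i * f0 i - 1 - 8 * ind {pt 23, pt 0, pt 1} i" for i
    have "q i \<ge> 0" for i
      using odd_sq[OF odd_coords_sets(1)[OF f0(2) odd0, of i]] f0_vals by (auto simp: q_def ind_def)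
    moreover have "(\<Sum>i\<in>UNIV. q i) = 0"
      unfolding q_def sum_subtractf sum_ind_mult norm0 three(2) by simp
    ultimately have "q i = 0"
      by (simp add: sum_nonneg_eq_0_iff)
    then show ?thesis
      using that by (simp add: q_def ind_def)
  qed
  define B where "B = - {i. f0 i mod 4 = 3}"
  have B: "B \<in> golay_code"
    unfolding B_def by (intro golay_compl odd_coords_sets(2)[OF f0(2) odd0])
  have Bout: "pt 23 \<notin> B" "pt 0 \<notin> B" "pt 1 \<notin> B"
    unfolding B_def Compl_iff mem_Collect_eq f0_vals by simp_all
  have b_co0: "sign_map B \<in> co0"
    using B by (rule sign_map_co0)
  have b_pair: "sign_map B (pair_vec j k) = pair_vec j k" if "pt j \<notin> B" "pt k \<notin> B" for j k
    using that by (simp add: pair_vec_def linear_add[OF co0_linear[OF b_co0]] linear_scale[OF co0_linear[OF b_co0]] sign_map_nu)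
  have b_c: "sign_map B (Y 0) = c_star"
    unfolding f0(1) sign_map_ivec c_star_def ivec_inject
  proof
    fix i
    show "(if i \<in> B then - f0 i else f0 i) = 4 * ind (pt ` {23, 0, 1}) i - 1"
    proof (cases "i \<in> {pt 23, pt 0, pt 1}")
      case True
      then show ?thesis
        unfolding three(1) using f0_vals Bout by (auto simp: ind_def)
    next
      case False
      have "f0 i * f0 i = 1 * 1"
        using rest0[OF False] by simp
      then have "f0 i = 1 \<or> f0 i = - 1"
        by (simp only: square_eq_iff)
      then show ?thesis
        unfolding three(1) using False by (auto simp: ind_def B_def)
    qed
  qed
  define V where "V i = sign_map B (Y i)" for i
  have Vin: "V i \<bullet> V j = X i \<bullet> X j" for i j
    by (simp add: V_def co0_inner[OF b_co0] Yin)
  have V: "V 0 = c_star" "V 1 = 0" "V 2 = pair_vec 23 0" "V 4 = pair_vec 23 1" "V 5 = pair_vec 0 1"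
    by (simp_all add: V_def b_c Y245 Y1 b_pair Bout linear_0[OF co0_linear[OF b_co0]])
  \<comment> \<open>The fourth point is given by an octad through two of the three coordinates.\<close>
  have "V 3 \<in> leech_lattice"
    using Ymem[of 3] by (simp add: V_def co0_leech[OF b_co0])
  then obtain f3 where f3: "V 3 = ivec f3" "leech_coords f3"
    by (rule leech_cases)
  have "f3 (pt 23) + f3 (pt 0) = 2" "f3 (pt 23) + f3 (pt 1) = 4" "f3 (pt 0) + f3 (pt 1) = 4"
    using Vin[of 3 2] Vin[of 3 4] Vin[of 3 5] prods by (intro solve3; simp add: V f3(1) inner_commute)+
  then have f3_vals: "f3 (pt 23) = 1" "f3 (pt 0) = 1" "f3 (pt 1) = 3"
    by linarith+
  have odd3: "odd (f3 (pt 23))"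
    by (simp add: f3_vals)
  have norm3: "(\<Sum>i\<in>UNIV. f3 i * f3 i) = 32"
    using Vin[of 3 3] norms(3) sum_sq_ivec[of f3 32] by (simp add: f3(1))
  have rest3: "f3 i * f3 i = 1" if "i \<noteq> pt 1" for i
  proof -
    define q where "q i = f3 i * f3 i - 1 - 8 * ind {pt 1} i" for i
    have "q i \<ge> 0" for i
      using odd_sq[OF odd_coords_sets(1)[OF f3(2) odd3, of i]] f3_vals by (auto simp: q_def ind_def)
    moreover have "(\<Sum>i\<in>UNIV. q i) = 0"
      unfolding q_def sum_subtractf sum_ind_mult norm3 by simp
    ultimately have "q i = 0"
      by (simp add: sum_nonneg_eq_0_iff)
    then show ?thesis
      using that by (simp add: q_def ind_def)
  qed
  define K where "K = - {i. f3 i mod 4 = 3}"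
  have K: "K \<in> golay_code"
    unfolding K_def by (intro golay_compl odd_coords_sets(2)[OF f3(2) odd3])
  have Kmem: "pt 23 \<in> K" "pt 0 \<in> K" "pt 1 \<notin> K"
    unfolding K_def Compl_iff mem_Collect_eq f3_vals by simp_all
  have f3_eq: "f3 i = 2 * ind K i + 4 * ind {pt 1} i - 1" for i
  proof (cases "i = pt 1")
    case True
    then show ?thesis
      using f3_vals Kmem by (simp add: ind_def)
  next
    case False
    have "f3 i * f3 i = 1 * 1"
      using rest3[OF False] by simp
    then have "f3 i = 1 \<or> f3 i = - 1"
      by (simp only: square_eq_iff)
    then show ?thesis
      using False by (auto simp: ind_def K_def)
  qed
  \<comment> \<open>The product with \<open>c_star\<close> determines the number of coordinates \<open>1\<close>.\<close>
  have "card K = 8"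
  proof -
    have "f3 i * (4 * ind {pt 23, pt 0, pt 1} i - 1) =
        8 * (ind {pt 23} i + ind {pt 0} i) - 2 * ind K i - 4 * ind {pt 23, pt 0, pt 1} i + 1 + 12 * ind {pt 1} i" for i
      unfolding f3_eq using Kmem by (auto simp: ind_def pt_eq_iff)
    then have "(\<Sum>i\<in>UNIV. f3 i * (4 * ind {pt 23, pt 0, pt 1} i - 1)) = 16 - 2 * int (card K) - 12 + 24 + 12"
      by (simp only: sum.distrib sum_subtractf sum_ind_mult three(2) distrib_left) simp
    moreover have "(\<Sum>i\<in>UNIV. f3 i * (4 * ind {pt 23, pt 0, pt 1} i - 1)) = 24"
    proof -
      have "ivec f3 \<bullet> c_star = 24"
        using Vin[of 3 0] prods(2) by (simp add: V f3(1) inner_commute)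
      then show ?thesis
        unfolding c_star_def ivec_inner three(1) by (simp only: of_int_eq_numeral_iff)
    qed
    ultimately show ?thesis
      by simp
  qed
  with K have Koct: "K \<in> octads"
    by (simp add: octads_def)
  obtain q where q: "q \<notin> K" "q \<noteq> pt 1"
    using octad_two_points_outside[OF Koct] by metis
  obtain \<tau> where \<tau>: "\<tau> \<in> golay_aut" "\<tau> (pt 23) = pt 23" "\<tau> (pt 0) = pt 0" "\<tau> (pt 1) = pt 1" "\<tau> ` K = of_bits std_octad"
    by (rule golay_aut_transitive_octad[OF Koct Kmem(1,2) _ Kmem(3) q(1) q(2)[symmetric]]) (simp add: pt_eq_iff)
  have t_co0: "perm_map \<tau> \<in> co0"
    using \<tau>(1) by (rule perm_map_co0)
  have t_pair: "perm_map \<tau> (pair_vec j k) = pair_vec j k" if "\<tau> (pt j) = pt j" "\<tau> (pt k) = pt k" for j k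
    using that by (simp add: pair_vec_def linear_add[OF co0_linear[OF t_co0]] linear_scale[OF co0_linear[OF t_co0]] perm_map_nu[OF \<tau>(1)])
  have t_in: "\<tau> i = pt k \<longleftrightarrow> i = pt k" if "\<tau> (pt k) = pt k" for i k
    using that golay_aut_inj[OF \<tau>(1), of i "pt k"] by simp
  have t_c: "perm_map \<tau> c_star = c_star"
    unfolding c_star_def using \<tau>(2-4)
    by (intro perm_map_eqI golay_aut_bij[OF \<tau>(1)]) (simp add: ind_def t_in)
  have t_r: "perm_map \<tau> (V 3) = r_star"
    unfolding r_star_def f3(1) \<tau>(5)[symmetric]
  proof (rule perm_map_eqI[OF golay_aut_bij[OF \<tau>(1)]])
    fix i
    have "\<tau> i \<in> \<tau> ` K \<longleftrightarrow> i \<in> K"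
      using golay_aut_bij[OF \<tau>(1)] by (simp add: bij_is_inj inj_image_mem_iff)
    then show "ivec (\<lambda>i. 2 * ind (\<tau> ` K) i + 4 * ind {pt 1} i - 1) $ \<tau> i = ivec f3 $ i"
      using \<tau>(4) by (simp add: f3_eq ind_def t_in)
  qed
  define g where "g = perm_map \<tau> \<circ> (sign_map B \<circ> (p \<circ> (g2 \<circ> g1)))"
  have "g \<in> co0"
    unfolding g_def using t_co0 b_co0 p g2(1) g1(1) by (intro co0_comp)
  moreover have gX: "g (X i) = perm_map \<tau> (V i)" for i
    by (simp add: g_def V_def Y_def Z_def)
  have "g (X 0) = c_star" "g (X 1) = 0" "g (X 2) = pair_vec 23 0" "g (X 3) = r_star" "g (X 4) = pair_vec 23 1" "g (X 5) = pair_vec 0 1"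
    unfolding gX t_r V t_c using \<tau>(2-4) by (simp_all add: t_pair linear_0[OF co0_linear[OF t_co0]])
  then have "\<forall>i\<in>{0, 1, 2, 3, 4, 5}. g (X i) = stars ! i"
    by (simp add: stars_def)
  moreover have "i \<in> {0, 1, 2, 3, 4, 5}" if "i < 6" for i :: nat
    using that by auto
  ultimately show ?thesis
    by blast
qed

section \<open>The stabilizer of an octad, two of its points and a point outside\<close>

definition hex :: "nat list" where
  "hex = [3, 4, 5, 12, 13, 18]"

definition hexad :: "P1 set" where
  "hexad = pt ` set hex"

text \<open>The hexad is the standard octad without its points \<open>\<infinity>\<close> and 0. The stabilizer of an octad and of a point outside
  acts on the octad as the alternating group of degree 8; fixing two points of the octad leaves degree 6.\<close>

definition hexad_stab :: "(P1 \<Rightarrow> P1) set" where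
  "hexad_stab = {\<sigma> \<in> golay_aut. \<sigma> (pt 23) = pt 23 \<and> \<sigma> (pt 0) = pt 0 \<and> \<sigma> (pt 1) = pt 1 \<and> \<sigma> ` hexad = hexad}"

lemma std_octad_eq: "of_bits std_octad = hexad \<union> {pt 23, pt 0}"
  unfolding std_octad_def hexad_def hex_def by (subst of_bits_points) (auto simp: insert_commute)

lemma hexad_stab_aut: "\<sigma> \<in> hexad_stab \<Longrightarrow> \<sigma> \<in> golay_aut"
  and hexad_stab_fix: "\<sigma> \<in> hexad_stab \<Longrightarrow> \<sigma> (pt 23) = pt 23" "\<sigma> \<in> hexad_stab \<Longrightarrow> \<sigma> (pt 0) = pt 0" "\<sigma> \<in> hexad_stab \<Longrightarrow> \<sigma> (pt 1) = pt 1"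
  and hexad_stab_image: "\<sigma> \<in> hexad_stab \<Longrightarrow> \<sigma> ` hexad = hexad"
  by (simp_all add: hexad_stab_def)

lemma hexad_stab_id: "id \<in> hexad_stab"
  by (simp add: hexad_stab_def golay_aut_id)

lemma hexad_stab_comp:
  assumes "\<sigma> \<in> hexad_stab" "\<tau> \<in> hexad_stab"
  shows "\<sigma> \<circ> \<tau> \<in> hexad_stab"
proof -
  have "(\<sigma> \<circ> \<tau>) ` hexad = hexad"
    by (metis assms hexad_stab_image image_comp)
  then show ?thesis
    using assms by (simp add: hexad_stab_def golay_aut_comp)
qed

lemma hexad_stab_inv:
  assumes \<sigma>: "\<sigma> \<in> hexad_stab"
  shows "inv' \<sigma> \<in> hexad_stab"
proof -
  have inj: "inj \<sigma>"
    using hexad_stab_aut[OF \<sigma>] by (intro bij_is_inj golay_aut_bij)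
  have "inv' \<sigma> ` hexad = hexad"
    using image_inv_f_f[OF inj, of hexad] by (simp only: hexad_stab_image[OF \<sigma>])
  moreover have "inv' \<sigma> (pt k) = pt k" if "\<sigma> (pt k) = pt k" for k
    using inv_f_f[OF inj, of "pt k"] by (simp only: that)
  ultimately show ?thesis
    using \<sigma> by (simp add: hexad_stab_def golay_aut_inv)
qed

text \<open>Two octads with five common points are equal, since their sum has weight at most 6.\<close>

lemma octad_preserved:
  assumes B: "B \<in> octads" and \<sigma>: "\<sigma> \<in> golay_aut" and F: "F \<subseteq> B" "card F \<ge> 5" "\<And>x. x \<in> F \<Longrightarrow> \<sigma> x = x"
  shows "\<sigma> ` B = B"
proof (rule ccontr)
  assume ne: "\<sigma> ` B \<noteq> B"
  have "F \<subseteq> \<sigma> ` B"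
    using F(1,3) by force
  then have "card F \<le> card (B \<inter> \<sigma> ` B)"
    using F(1) by (intro card_mono) auto
  moreover have "card (\<sigma> ` B) = card B"
    using golay_aut_bij[OF \<sigma>] by (intro card_image inj_on_subset[OF bij_is_inj]) auto
  moreover have "card B = 8"
    using B by (simp add: octads_def)
  ultimately have "card (sym_diff B (\<sigma> ` B)) \<le> 6"
    using card_sym_diff[of B "\<sigma> ` B"] F(2) by linarith
  moreover have "sym_diff B (\<sigma> ` B) \<in> golay_code"
    using B golay_aut_image[OF \<sigma>] by (intro golay_code.add) (simp_all add: octads_def)
  moreover have "sym_diff B (\<sigma> ` B) \<noteq> {}"
    using ne by blast
  ultimately show False
    using golay_min_weight by fastforce
qed

lemma octad_word_preserved:
  assumes B: "octad_word ks" and \<sigma>: "\<sigma> \<in> golay_aut" and js: "distinct js" "length js = 5" "set js \<subseteq> set ks"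
    and fixed: "\<And>j. j \<in> set js \<Longrightarrow> \<sigma> (pt j) = pt j"
  shows "\<sigma> x \<in> pt ` set ks \<longleftrightarrow> x \<in> pt ` set ks"
proof -
  have "set ks \<subseteq> {..<24}"
    using B by (auto simp: octad_word_def list_all_iff)
  then have "inj_on pt (set js)"
    using js(3) by (intro inj_on_subset[OF inj_on_pt]) blast
  then have "card (pt ` set js) = 5"
    using js(1,2) by (simp add: card_image distinct_card)
  then have "\<sigma> ` pt ` set ks = pt ` set ks"
    using js(3) fixed by (intro octad_preserved[OF octad_word[OF B] \<sigma>, of "pt ` set js"]) auto
  then show ?thesis
    using golay_aut_bij[OF \<sigma>] by (metis bij_is_inj inj_image_mem_iff)
qed

text \<open>Octads with five of their points among the nine points that are fixed when the hexad is fixed pointwise (the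
  second list). By \<open>octad_preserved\<close> they are preserved, and they were chosen so that they separate the
  points outside the standard octad.\<close>

definition probes :: "(nat list \<times> nat list) list" where
  "probes = [([0, 1, 3, 4, 9, 13, 14, 15], [0, 1, 3, 4, 13]), ([0, 1, 5, 9, 11, 13, 21, 23], [0, 1, 5, 13, 23]),
    ([0, 1, 7, 12, 13, 14, 20, 23], [0, 1, 12, 13, 23]), ([1, 2, 5, 7, 10, 13, 18, 23], [1, 5, 13, 18, 23]),
    ([1, 4, 5, 6, 8, 10, 12, 18], [1, 4, 5, 12, 18]), ([1, 4, 5, 11, 16, 17, 18, 23], [1, 4, 5, 18, 23]),
    ([1, 5, 8, 12, 13, 17, 22, 23], [1, 5, 12, 13, 23])]"

definition outside :: "nat list" where
  "outside = [1, 2, 6, 7, 8, 9, 10, 11, 14, 15, 16, 17, 19, 20, 21, 22]"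

definition probe_word :: "nat \<Rightarrow> bool list" where
  "probe_word k = map (\<lambda>(ks, js). elem k ks) probes"

lemma probes_octads:
  "list_all (\<lambda>(ks, js). octad_word ks \<and> distinct js \<and> length js = 5 \<and> all_in js ks \<and> all_in js [23, 0, 1, 3, 4, 5, 12, 13, 18]) probes"
  by code_simp

lemma probe_words_distinct: "distinct (map probe_word outside)"
  by code_simp

lemma hexad_stab_rigid:
  assumes \<sigma>: "\<sigma> \<in> hexad_stab" and fixed: "\<And>x. x \<in> hexad \<Longrightarrow> \<sigma> x = x"
  shows "\<sigma> = id"
proof
  fix x
  have aut: "\<sigma> \<in> golay_aut"
    using \<sigma> by (rule hexad_stab_aut)
  have fix_pt: "\<sigma> (pt j) = pt j" if "j \<in> set [23, 0, 1, 3, 4, 5, 12, 13, 18]" for j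
    using that hexad_stab_fix[OF \<sigma>] fixed by (auto simp: hexad_def hex_def)
  obtain k where k: "k < 24" "x = pt k"
    using pt_cases by blast
  obtain j where j: "j < 24" "\<sigma> x = pt j"
    using pt_cases by blast
  have split: "i \<in> set [23, 0, 3, 4, 5, 12, 13, 18] \<or> i \<in> set outside" if "i < 24" for i
  proof -
    have "i \<in> set [0..<24]"
      using that by simp
    then show ?thesis
      unfolding upt_0_24 outside_def by simp argo
  qed
  show "\<sigma> x = id x"
  proof (cases "k \<in> set outside")
    case False
    then show ?thesis
      using split[OF k(1)] fix_pt[of k] k(2) by auto
  next
    case True
    have j_out: "j \<in> set outside"
    proof (rule ccontr)
      assume "j \<notin> set outside"
      then have "\<sigma> (pt j) = pt j"
        using split[OF j(1)] fix_pt[of j] by auto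
      then have "\<sigma> (pt j) = \<sigma> x"
        using j(2) by simp
      then have "pt j = x"
        by (simp only: golay_aut_inj[OF aut])
      then show False
        using \<open>j \<notin> set outside\<close> True j(1) k by (simp add: pt_eq_iff)
    qed
    have "probe_word j = probe_word k"
      unfolding probe_word_def
    proof (rule map_cong[OF refl], clarify)
      fix ks js assume "(ks, js) \<in> set probes"
      then have p: "octad_word ks" "distinct js" "length js = 5" "set js \<subseteq> set ks" "set js \<subseteq> set [23, 0, 1, 3, 4, 5, 12, 13, 18]"
        using probes_octads unfolding list_all_iff all_in_iff by blast+
      have "\<sigma> x \<in> pt ` set ks \<longleftrightarrow> x \<in> pt ` set ks"
        using p(5) by (intro octad_word_preserved[OF p(1) aut p(2-4)] fix_pt) blast
      moreover have "pt i \<in> pt ` set ks \<longleftrightarrow> i \<in> set ks" if "i < 24" for i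
        using that p(1) by (auto simp: octad_word_def list_all_iff pt_eq_iff)
      ultimately show "elem j ks = elem k ks"
        using j k by (simp add: elem_iff)
    qed
    then have "j = k"
      using probe_words_distinct True j_out by (auto simp: distinct_map dest: inj_onD)
    then show ?thesis
      using j k by simp
  qed
qed

lemma no_transposition_words:
  "octad_word [1, 2, 5, 7, 10, 13, 18, 23] \<and> octad_word [0, 1, 2, 5, 6, 12, 13, 15] \<and> octad_word [0, 1, 2, 3, 13, 18, 20, 21]"
  by code_simp

text \<open>If only 3 and 4 were exchanged, then two octads that meet the hexad in fixed points show that the point 2 is fixed.
  A third octad, with five fixed points because it contains 2, contains 3 but not 4.\<close>

lemma hexad_stab_no_transposition:
  assumes \<sigma>: "\<sigma> \<in> hexad_stab" and swap: "\<sigma> (pt 3) = pt 4"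
    and fixed: "\<sigma> (pt 5) = pt 5" "\<sigma> (pt 12) = pt 12" "\<sigma> (pt 13) = pt 13" "\<sigma> (pt 18) = pt 18"
  shows False
proof -
  have aut: "\<sigma> \<in> golay_aut"
    using \<sigma> by (rule hexad_stab_aut)
  note fixpts = fixed hexad_stab_fix[OF \<sigma>]
  have 1: "\<sigma> x \<in> pt ` set [1, 2, 5, 7, 10, 13, 18, 23] \<longleftrightarrow> x \<in> pt ` set [1, 2, 5, 7, 10, 13, 18, 23]" for x
    using no_transposition_words fixpts by (intro octad_word_preserved[OF _ aut, of _ "[1, 5, 13, 18, 23]"]) auto
  have 2: "\<sigma> x \<in> pt ` set [0, 1, 2, 5, 6, 12, 13, 15] \<longleftrightarrow> x \<in> pt ` set [0, 1, 2, 5, 6, 12, 13, 15]" for x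
    using no_transposition_words fixpts by (intro octad_word_preserved[OF _ aut, of _ "[0, 1, 5, 12, 13]"]) auto
  have "\<sigma> (pt 2) \<in> pt ` set [1, 2, 5, 7, 10, 13, 18, 23] \<inter> pt ` set [0, 1, 2, 5, 6, 12, 13, 15]"
    using 1[of "pt 2"] 2[of "pt 2"] by simp
  also have "\<dots> = pt ` (set [1, 2, 5, 7, 10, 13, 18, 23] \<inter> set [0, 1, 2, 5, 6, 12, 13, 15])"
    by (rule pt_image_Int) auto
  \<comment> \<open>Of the four common points of the two octads, three are fixed and different from 2.\<close>
  finally have "\<sigma> (pt 2) \<in> {pt 1, pt 2, pt 5, pt 13}"
    by simp
  moreover have "\<sigma> (pt 2) \<noteq> pt k" if "\<sigma> (pt k) = pt k" "k \<in> {1, 5, 13}" for k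
    using that golay_aut_inj[OF aut, of "pt 2" "pt k"] by (auto simp: pt_eq_iff)
  ultimately have "\<sigma> (pt 2) = pt 2"
    using fixpts by auto
  then have "\<sigma> (pt 3) \<in> pt ` set [0, 1, 2, 3, 13, 18, 20, 21] \<longleftrightarrow> pt 3 \<in> pt ` set [0, 1, 2, 3, 13, 18, 20, 21]"
    using no_transposition_words fixpts by (intro octad_word_preserved[OF _ aut, of _ "[0, 1, 2, 13, 18]"]) auto
  then show False
    unfolding swap by (simp add: pt_eq_iff)
qed

subsection \<open>The action on the remaining six points\<close>

text \<open>The numbering of the hexad by \<open>1, ..., 6\<close>, the points on which the alternating group acts.\<close>

definition label :: "nat \<Rightarrow> P1" where
  "label j = pt (hex ! (j - 1))"

definition relabel :: "(P1 \<Rightarrow> P1) \<Rightarrow> nat \<Rightarrow> nat" where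
  "relabel \<sigma> j = (if j \<in> {1..6} then inv_into {1..6} label (\<sigma> (label j)) else j)"

lemma atLeastAtMost_1_6: "{1..6} = {1, 2, 3, 4, 5, 6 :: nat}"
  by auto

lemma label_values: "label 1 = pt 3" "label 2 = pt 4" "label 3 = pt 5" "label 4 = pt 12" "label 5 = pt 13" "label 6 = pt 18"
  by (simp_all add: label_def hex_def)

lemma bij_label: "bij_betw label {1..6} hexad"
  unfolding atLeastAtMost_1_6 hexad_def hex_def
  by (auto simp: bij_betw_def inj_on_def label_values[simplified] pt_eq_iff)

lemma label_relabel:
  assumes \<sigma>: "\<sigma> \<in> hexad_stab" and j: "j \<in> {1..6}"
  shows "label (relabel \<sigma> j) = \<sigma> (label j)" "relabel \<sigma> j \<in> {1..6}"
proof -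
  have "\<sigma> (label j) \<in> hexad"
    using bij_label j hexad_stab_image[OF \<sigma>] by (metis bij_betwE image_eqI)
  then have "\<sigma> (label j) \<in> label ` {1..6}"
    using bij_label by (simp only: bij_betw_imp_surj_on)
  then show "label (relabel \<sigma> j) = \<sigma> (label j)" "relabel \<sigma> j \<in> {1..6}"
    unfolding relabel_def using j by (simp_all only: if_True f_inv_into_f inv_into_into)
qed

lemma label_inject: "i \<in> {1..6} \<Longrightarrow> j \<in> {1..6} \<Longrightarrow> label i = label j \<longleftrightarrow> i = j"
  using bij_label by (meson bij_betw_imp_inj_on inj_on_eq_iff)

lemma relabel_eqI:
  assumes \<sigma>: "\<sigma> \<in> hexad_stab" and "\<And>j. j \<in> {1..6} \<Longrightarrow> p j \<in> {1..6} \<and> label (p j) = \<sigma> (label j)"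
    and "\<And>j. j \<notin> {1..6} \<Longrightarrow> p j = j"
  shows "relabel \<sigma> = p"
proof
  fix j
  show "relabel \<sigma> j = p j"
  proof (cases "j \<in> {1..6}")
    case True
    have "label (relabel \<sigma> j) = label (p j)"
      using label_relabel(1)[OF \<sigma> True] assms(2)[OF True] by simp
    then show ?thesis
      using label_inject[OF label_relabel(2)[OF \<sigma> True]] assms(2)[OF True] by blast
  next
    case False
    then show ?thesis
      unfolding assms(3)[OF False] by (simp only: relabel_def if_False)
  qed
qed

lemma relabel_comp:
  assumes "\<sigma> \<in> hexad_stab" "\<tau> \<in> hexad_stab"
  shows "relabel (\<sigma> \<circ> \<tau>) = relabel \<sigma> \<circ> relabel \<tau>"
proof (rule relabel_eqI[OF hexad_stab_comp[OF assms]])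
  show "(relabel \<sigma> \<circ> relabel \<tau>) j \<in> {1..6} \<and> label ((relabel \<sigma> \<circ> relabel \<tau>) j) = (\<sigma> \<circ> \<tau>) (label j)" if "j \<in> {1..6}" for j
    using label_relabel[OF assms(2) that] label_relabel[OF assms(1) label_relabel(2)[OF assms(2) that]]
    by (simp only: comp_apply simp_thms)
  show "(relabel \<sigma> \<circ> relabel \<tau>) j = j" if "j \<notin> {1..6}" for j
    using that by (simp only: comp_apply relabel_def if_False)
qed

lemma relabel_id: "relabel id = id"
  by (rule relabel_eqI[OF hexad_stab_id]) simp_all

lemma relabel_inj:
  assumes \<sigma>: "\<sigma> \<in> hexad_stab" and eq: "relabel \<sigma> = id"
  shows "\<sigma> = id"
proof (rule hexad_stab_rigid[OF \<sigma>])
  fix x assume "x \<in> hexad"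
  then obtain j where "j \<in> {1..6}" "x = label j"
    using bij_label by (metis bij_betw_imp_surj_on imageE)
  then show "\<sigma> x = x"
    using label_relabel(1)[OF \<sigma>, of j] by (simp only: eq id_apply)
qed

lemma relabel_permutes:
  assumes \<sigma>: "\<sigma> \<in> hexad_stab"
  shows "relabel \<sigma> permutes {1..6}"
proof -
  have "inj_on (relabel \<sigma>) {1..6}"
  proof (rule inj_onI)
    fix i j assume ij: "i \<in> {1..6}" "j \<in> {1..6}" "relabel \<sigma> i = relabel \<sigma> j"
    then have "\<sigma> (label i) = \<sigma> (label j)"
      using label_relabel(1)[OF \<sigma>] by metis
    then show "i = j"
      using label_inject[OF ij(1,2)] by (simp only: golay_aut_inj[OF hexad_stab_aut[OF \<sigma>]])
  qed
  moreover have "relabel \<sigma> ` {1..6} \<subseteq> {1..6}"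
    using label_relabel(2)[OF \<sigma>] by blast
  ultimately have "bij_betw (relabel \<sigma>) {1..6} {1..6}"
    by (simp add: bij_betw_def endo_inj_surj)
  then show ?thesis
    by (rule bij_imp_permutes) (simp only: relabel_def if_False)
qed

text \<open>Only the action on the hexad is prescribed.\<close>

definition three_cycle :: "(P1 \<Rightarrow> P1) \<Rightarrow> P1 \<Rightarrow> P1 \<Rightarrow> P1 \<Rightarrow> bool" where
  "three_cycle \<tau> a b c \<longleftrightarrow> \<tau> a = b \<and> \<tau> b = c \<and> \<tau> c = a \<and> (\<forall>x\<in>hexad - {a, b, c}. \<tau> x = x)"

lemma three_cycle_conjugate:
  assumes \<sigma>: "\<sigma> \<in> hexad_stab" and \<tau>: "three_cycle \<tau> a b c"
  shows "three_cycle (\<sigma> \<circ> \<tau> \<circ> inv' \<sigma>) (\<sigma> a) (\<sigma> b) (\<sigma> c)"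
proof -
  have inj: "inj \<sigma>"
    using hexad_stab_aut[OF \<sigma>] by (intro bij_is_inj golay_aut_bij)
  have "(\<sigma> \<circ> \<tau> \<circ> inv' \<sigma>) x = x" if x: "x \<in> hexad - {\<sigma> a, \<sigma> b, \<sigma> c}" for x
  proof -
    obtain y where y: "y \<in> hexad" "x = \<sigma> y"
      using x hexad_stab_image[OF \<sigma>] by blast
    then have "\<tau> y = y"
      using x \<tau> unfolding three_cycle_def by blast
    then show ?thesis
      using y(2) inj by simp
  qed
  then show ?thesis
    using \<tau> inj unfolding three_cycle_def by simp
qed

text \<open>The two generators act transitively on the ordered triples of distinct points of the hexad, so every
  3-cycle is conjugate to the one given by the first generator.\<close>

lemma hexad_triples_orbit:
  "all_in (concat (map (\<lambda>a. concat (map (\<lambda>b. map (\<lambda>c. [a, b, c]) (filter (\<lambda>c. c \<noteq> a \<and> c \<noteq> b) hex)) (filter (\<lambda>b. b \<noteq> a) hex))) hex))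
     (reach [map ((!) p_hex1), map ((!) p_hex2)] 12 [[3, 4, 5]])"
  by code_simp

lemma hexad_perms:
  "list_all (\<lambda>L. L ! 23 = 23 \<and> L ! 0 = 0 \<and> L ! 1 = 1 \<and> all_in (map ((!) L) hex) hex) [p_hex1, p_hex2]"
  by code_simp

lemma hexad_perm_stab:
  assumes L: "L \<in> {p_hex1, p_hex2}"
  shows "perm L \<in> hexad_stab"
proof -
  have aut: "perm L \<in> golay_aut"
    using L valid_perm_list perm_in_golay_aut by blast
  have vals: "L ! 23 = 23" "L ! 0 = 0" "L ! 1 = 1" "\<forall>j\<in>set hex. L ! j \<in> set hex"
    using hexad_perms L by (auto simp: all_in_iff)
  have less: "j \<in> set hex \<Longrightarrow> j < 24" for j
    by (auto simp: hex_def)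
  have "perm L ` hexad \<subseteq> hexad"
    unfolding hexad_def using vals(4) less by (auto simp: perm_pt)
  then have "perm L ` hexad = hexad"
    by (rule endo_inj_surj[OF finite _ inj_on_subset[OF bij_is_inj[OF golay_aut_bij[OF aut]]]]) simp
  then show ?thesis
    using aut vals(1-3) by (simp add: hexad_stab_def perm_pt)
qed

lemma hexad_stab_three_cycle:
  assumes abc: "a \<in> set hex" "b \<in> set hex" "c \<in> set hex" "distinct [a, b, c]"
  shows "\<exists>\<tau>\<in>hexad_stab. three_cycle \<tau> (pt a) (pt b) (pt c)"
proof -
  define P where "P l \<longleftrightarrow> length l = 3 \<and> (\<forall>k\<in>set l. k < 24) \<and> (\<exists>\<tau>\<in>hexad_stab. three_cycle \<tau> (pt (l ! 0)) (pt (l ! 1)) (pt (l ! 2)))" for l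
  have "[a, b, c] \<in> set (reach [map ((!) p_hex1), map ((!) p_hex2)] 12 [[3, 4, 5]])"
    by (rule subsetD[OF hexad_triples_orbit[unfolded all_in_iff]]) (use abc in \<open>auto intro!: bexI[of _ a] exI[of _ b] image_eqI[of _ _ c]\<close>)
  then have "P [a, b, c]"
  proof (rule reach_invariant)
    fix l :: "nat list" assume "l \<in> set [[3, 4, 5]]"
    moreover have "three_cycle (perm p_hex1) (pt 3) (pt 4) (pt 5)"
    proof -
      have "p_hex1 ! 3 = 4 \<and> p_hex1 ! 4 = 5 \<and> p_hex1 ! 5 = 3 \<and> p_hex1 ! 12 = 12 \<and> p_hex1 ! 13 = 13 \<and> p_hex1 ! 18 = 18"
        by code_simp
      then show ?thesis
        by (auto simp: three_cycle_def perm_pt hexad_def hex_def)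
    qed
    ultimately show "P l"
      using hexad_perm_stab[of p_hex1] by (auto simp: P_def)
  next
    fix f :: "nat list \<Rightarrow> nat list" and l
    assume "f \<in> set [map ((!) p_hex1), map ((!) p_hex2)]" and Pl: "P l"
    then obtain L where L: "L \<in> {p_hex1, p_hex2}" "f = map ((!) L)"
      by auto
    obtain \<tau> where \<tau>: "\<tau> \<in> hexad_stab" "three_cycle \<tau> (pt (l ! 0)) (pt (l ! 1)) (pt (l ! 2))"
      and l: "length l = 3" "\<And>k. k \<in> set l \<Longrightarrow> k < 24"
      using Pl by (auto simp: P_def)
    have \<sigma>: "perm L \<in> hexad_stab"
      using L(1) by (rule hexad_perm_stab)
    have valid: "length L = 24" "list_all (\<lambda>k. k < 24) L"
      using valid_perm_list[of L] L(1) by (auto simp: valid_perm_def)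
    have less: "l ! 0 < 24" "l ! 1 < 24" "l ! 2 < 24"
      using l by simp_all
    have "three_cycle (perm L \<circ> \<tau> \<circ> inv' (perm L)) (pt (f l ! 0)) (pt (f l ! 1)) (pt (f l ! 2))"
      using three_cycle_conjugate[OF \<sigma> \<tau>(2)] l(1) less by (simp add: L(2) perm_pt)
    moreover have "perm L \<circ> \<tau> \<circ> inv' (perm L) \<in> hexad_stab"
      using \<sigma> \<tau>(1) by (intro hexad_stab_comp hexad_stab_inv)
    moreover have "\<forall>k\<in>set (f l). k < 24"
      using l(2) valid by (auto simp: L(2) list_all_length)
    ultimately show "P (f l)"
      using l(1) by (auto simp: P_def L(2))
  qed
  then show ?thesis
    by (simp add: P_def numeral_2_eq_2)
qed

lemma three_cycles_relabel:
  assumes "p \<in> three_cycles 6"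
  shows "p \<in> relabel ` hexad_stab"
proof -
  obtain cs where cs: "p = cycle_of_list cs" "distinct cs" "length cs = 3" "set cs \<subseteq> {1..6}"
    using assms by auto
  obtain i j k where ijk: "cs = [i, j, k]"
    using cs(3) by (auto simp: length_Suc_conv numeral_3_eq_3)
  have mem: "i \<in> {1..6}" "j \<in> {1..6}" "k \<in> {1..6}" and ne: "i \<noteq> j" "i \<noteq> k" "j \<noteq> k"
    using cs ijk by auto
  have hex_mem: "hex ! (a - 1) \<in> set hex" if "a \<in> {1..6}" for a
    using that by (intro nth_mem) (auto simp: hex_def)
  have lab_ne: "hex ! (a - 1) \<noteq> hex ! (b - 1)" if "a \<in> {1..6}" "b \<in> {1..6}" "a \<noteq> b" for a b
    using label_inject[OF that(1,2)] that(3) by (auto simp: label_def)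
  have "distinct [hex ! (i - 1), hex ! (j - 1), hex ! (k - 1)]"
    using lab_ne mem ne by simp
  from hexad_stab_three_cycle[OF hex_mem[OF mem(1)] hex_mem[OF mem(2)] hex_mem[OF mem(3)] this]
  obtain \<tau> where \<tau>: "\<tau> \<in> hexad_stab" "three_cycle \<tau> (label i) (label j) (label k)"
    by (auto simp: label_def)
  have p: "p i = j" "p j = k" "p k = i" "\<And>a. a \<notin> {i, j, k} \<Longrightarrow> p a = a" 
    using ne by (auto simp: cs(1) ijk Transposition.transpose_def)
  have "relabel \<tau> = p"
  proof (rule relabel_eqI[OF \<tau>(1)])
    fix a :: nat assume a: "a \<in> {1..6}"
    show "p a \<in> {1..6} \<and> label (p a) = \<tau> (label a)"
    proof (cases "a \<in> {i, j, k}")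
      case True
      have t: "\<tau> (label i) = label j" "\<tau> (label j) = label k" "\<tau> (label k) = label i"
        using \<tau>(2) by (simp_all only: three_cycle_def)
      from True consider "a = i" | "a = j" | "a = k"
        by blast
      then show ?thesis
        by cases (simp_all only: p t mem simp_thms)
    next
      case False
      have "label a \<in> hexad"
        using bij_label a by (rule bij_betw_apply)
      moreover have "label a \<notin> {label i, label j, label k}"
        using False label_inject[OF a] mem by auto
      ultimately have "\<tau> (label a) = label a"
        using \<tau>(2) unfolding three_cycle_def by blast
      then show ?thesis
        using p(4)[OF False] a by simp
    qed
  next
    fix a :: nat assume "a \<notin> {1..6}"
    then show "p a = a"
      using mem by (intro p(4)) auto
  qed
  then show ?thesis
    using \<tau>(1) by blast
qed

lemma relabel_inv:
  assumes \<sigma>: "\<sigma> \<in> hexad_stab"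
  shows "relabel (inv' \<sigma>) = inv' (relabel \<sigma>)"
proof -
  have "inv' \<sigma> \<circ> \<sigma> = id"
    using golay_aut_bij[OF hexad_stab_aut[OF \<sigma>]] by (simp add: bij_is_inj)
  then have "relabel (inv' \<sigma>) \<circ> relabel \<sigma> = id"
    using relabel_comp[OF hexad_stab_inv[OF \<sigma>] \<sigma>] relabel_id by simp
  then show ?thesis
    using permutes_inv_o(1)[OF relabel_permutes[OF \<sigma>]] by (metis comp_assoc comp_id id_comp)
qed

text \<open>The alternating group is generated by 3-cycles.\<close>

lemma alt_group_subset_relabel: "carrier (alt_group 6) \<subseteq> relabel ` hexad_stab"
proof
  fix p assume "p \<in> carrier (alt_group 6)"
  then have "p \<in> generate (alt_group 6) (three_cycles 6)"
    by (simp only: alt_group_carrier_as_three_cycles)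
  then show "p \<in> relabel ` hexad_stab"
  proof (induction rule: generate.induct)
    case one
    then show ?case
      unfolding alt_group_one using relabel_id[symmetric] hexad_stab_id by (rule image_eqI)
  next
    case (incl h)
    then show ?case by (rule three_cycles_relabel)
  next
    case (inv h)
    obtain \<sigma> where \<sigma>: "\<sigma> \<in> hexad_stab" "h = relabel \<sigma>"
      using three_cycles_relabel[OF inv] by blast
    have "h \<in> carrier (alt_group 6)"
      using inv three_cycles_incl by blast
    then have "inv\<^bsub>alt_group 6\<^esub> h = relabel (inv' \<sigma>)"
      using alt_group_inv_equality relabel_inv[OF \<sigma>(1)] \<sigma>(2) by metis
    then show ?case
      using hexad_stab_inv[OF \<sigma>(1)] by blast
  next
    case (eng h1 h2)
    then obtain \<sigma> \<tau> where "\<sigma> \<in> hexad_stab" "h1 = relabel \<sigma>" "\<tau> \<in> hexad_stab" "h2 = relabel \<tau>"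
      by blast
    then show ?case
      using relabel_comp[of \<sigma> \<tau>] hexad_stab_comp[of \<sigma> \<tau>] by (simp only: alt_group_mult) (metis image_eqI)
  qed
qed

text \<open>An odd permutation composed with a transposition is even and hence also induced; the quotient would induce a
  transposition.\<close>

lemma relabel_even:
  assumes \<sigma>: "\<sigma> \<in> hexad_stab"
  shows "evenperm (relabel \<sigma>)"
proof (rule ccontr)
  assume odd: "\<not> evenperm (relabel \<sigma>)"
  let ?p = "relabel \<sigma>" and ?t = "Transposition.transpose 1 2 :: nat \<Rightarrow> nat"
  have p: "?p permutes {1..6}"
    using \<sigma> by (rule relabel_permutes)
  have t: "?t permutes {1..6}"
    by (rule permutes_swap_id) auto
  have "permutation ?p" "permutation ?t"
    using p t permutation_permutes by blast+
  then have "evenperm (?p \<circ> ?t)"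
    using odd by (simp add: evenperm_comp evenperm_swap)
  then have "?p \<circ> ?t \<in> carrier (alt_group 6)"
    using permutes_compose[OF t p] by (simp add: alt_group_carrier)
  then obtain \<tau> where \<tau>: "\<tau> \<in> hexad_stab" "relabel \<tau> = ?p \<circ> ?t"
    using alt_group_subset_relabel by force
  define \<rho> where "\<rho> = inv' \<sigma> \<circ> \<tau>"
  have \<rho>: "\<rho> \<in> hexad_stab"
    unfolding \<rho>_def using \<sigma> \<tau>(1) by (intro hexad_stab_comp hexad_stab_inv)
  have "relabel \<rho> = inv' ?p \<circ> (?p \<circ> ?t)"
    unfolding \<rho>_def relabel_comp[OF hexad_stab_inv[OF \<sigma>] \<tau>(1)] relabel_inv[OF \<sigma>] \<tau>(2) ..
  also have "\<dots> = ?t"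
    using permutes_inv_o(2)[OF p] by (simp only: comp_assoc[symmetric] id_comp)
  finally have lab: "\<rho> (label j) = label (?t j)" if "j \<in> {1..6}" for j
    using label_relabel(1)[OF \<rho> that] by simp
  have "\<rho> (pt 3) = pt 4" "\<rho> (pt 5) = pt 5" "\<rho> (pt 12) = pt 12" "\<rho> (pt 13) = pt 13" "\<rho> (pt 18) = pt 18"
    using lab[of 1] lab[of 3] lab[of 4] lab[of 5] lab[of 6] label_values by (simp_all add: Transposition.transpose_def)
  then show False
    by (rule hexad_stab_no_transposition[OF \<rho>])
qed

definition hexad_group :: "(P1 \<Rightarrow> P1) monoid" where
  "hexad_group = \<lparr>carrier = hexad_stab, mult = (\<circ>), one = id\<rparr>"

lemma hexad_group_is_group: "group hexad_group"
proof (rule groupI)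
  fix \<sigma> assume \<sigma>: "\<sigma> \<in> carrier hexad_group"
  then have "inv' \<sigma> \<in> hexad_stab" "inv' \<sigma> \<circ> \<sigma> = id"
    using hexad_stab_inv golay_aut_bij[OF hexad_stab_aut] by (auto simp: hexad_group_def bij_is_inj)
  then show "\<exists>\<tau>\<in>carrier hexad_group. \<tau> \<otimes>\<^bsub>hexad_group\<^esub> \<sigma> = \<one>\<^bsub>hexad_group\<^esub>"
    by (auto simp: hexad_group_def)
qed (auto simp: hexad_group_def hexad_stab_comp hexad_stab_id comp_assoc)

theorem hexad_group_iso: "hexad_group \<cong> alt_group 6"
proof -
  have mem: "relabel \<sigma> \<in> carrier (alt_group 6)" if "\<sigma> \<in> hexad_stab" for \<sigma>
    unfolding alt_group_carrier using relabel_permutes[OF that] relabel_even[OF that] by (rule conjI)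
  have "relabel \<in> hom hexad_group (alt_group 6)"
    by (rule homI) (simp_all add: hexad_group_def alt_group_mult mem relabel_comp)
  moreover have "inj_on relabel hexad_stab"
  proof (rule inj_onI)
    fix \<sigma> \<tau> assume \<sigma>\<tau>: "\<sigma> \<in> hexad_stab" "\<tau> \<in> hexad_stab" "relabel \<sigma> = relabel \<tau>"
    have "relabel (inv' \<tau> \<circ> \<sigma>) = id"
      unfolding relabel_comp[OF hexad_stab_inv[OF \<sigma>\<tau>(2)] \<sigma>\<tau>(1)] relabel_inv[OF \<sigma>\<tau>(2)] \<sigma>\<tau>(3)
      using relabel_permutes[OF \<sigma>\<tau>(2)] by (rule permutes_inv_o(2))
    then have "inv' \<tau> \<circ> \<sigma> = id"
      by (rule relabel_inj[OF hexad_stab_comp[OF hexad_stab_inv[OF \<sigma>\<tau>(2)] \<sigma>\<tau>(1)]])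
    then have "\<tau> (inv' \<tau> (\<sigma> x)) = \<tau> x" for x
      by (metis comp_apply id_apply)
    then have "\<sigma> x = \<tau> x" for x
      using golay_aut_bij[OF hexad_stab_aut[OF \<sigma>\<tau>(2)]] by (simp add: bij_is_surj surj_f_inv_f)
    then show "\<sigma> = \<tau>"
      by (rule ext)
  qed
  moreover have "relabel ` hexad_stab = carrier (alt_group 6)"
    using mem alt_group_subset_relabel by blast
  ultimately show ?thesis
    by (auto simp: is_iso_def iso_def bij_betw_def hexad_group_def)
qed

section \<open>The stabilizer of the normal form\<close>

lemma perm_map_comp:
  assumes "bij \<sigma>" "bij \<tau>"
  shows "perm_map (\<sigma> \<circ> \<tau>) x = perm_map \<sigma> (perm_map \<tau> x)"
  by (rule perm_map_eqI[OF bij_comp[OF assms(2,1)]]) (simp add: perm_map_nth assms)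

lemma perm_map_stars:
  assumes \<sigma>: "\<sigma> \<in> hexad_stab" and s: "s \<in> set stars"
  shows "perm_map \<sigma> s = s"
proof -
  have aut: "\<sigma> \<in> golay_aut"
    using \<sigma> by (rule hexad_stab_aut)
  have lin: "linear (perm_map \<sigma>)"
    using perm_map_co0[OF aut] by (rule co0_linear)
  have pair: "perm_map \<sigma> (pair_vec j k) = pair_vec j k" if "\<sigma> (pt j) = pt j" "\<sigma> (pt k) = pt k" for j k
    using that by (simp add: pair_vec_def linear_add[OF lin] linear_scale[OF lin] perm_map_nu[OF aut])
  have inv: "\<sigma> i = pt k \<longleftrightarrow> i = pt k" if "\<sigma> (pt k) = pt k" for i k
    using golay_aut_inj[OF aut, of i "pt k"] that by simp
  have hex: "\<sigma> i \<in> hexad \<longleftrightarrow> i \<in> hexad" for i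
    using inj_image_mem_iff[OF bij_is_inj[OF golay_aut_bij[OF aut]], of i hexad] by (simp only: hexad_stab_image[OF \<sigma>])
  have c: "perm_map \<sigma> c_star = c_star"
    unfolding c_star_def using hexad_stab_fix[OF \<sigma>]
    by (intro perm_map_eqI golay_aut_bij[OF aut]) (simp add: ind_def inv)
  have r: "perm_map \<sigma> r_star = r_star"
    unfolding r_star_def std_octad_eq using hexad_stab_fix[OF \<sigma>]
    by (intro perm_map_eqI golay_aut_bij[OF aut]) (simp add: ind_def inv hex)
  show ?thesis
    using s c r pair hexad_stab_fix[OF \<sigma>] linear_0[OF lin] by (auto simp: stars_def)
qed

text \<open>The three vectors of shape \<open>(4\<^sup>2, 0\<^sup>2\<^sup>2)\<close> in the normal form span three coordinate axes.\<close>

lemma frame_from_stars: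
  "8 *\<^sub>R nu (pt 23) = pair_vec 23 0 + pair_vec 23 1 - pair_vec 0 1"
  "8 *\<^sub>R nu (pt 0) = pair_vec 23 0 + pair_vec 0 1 - pair_vec 23 1"
  "8 *\<^sub>R nu (pt 1) = pair_vec 23 1 + pair_vec 0 1 - pair_vec 23 0"
  by (simp_all add: pair_vec_def vec_eq_iff nu_nth)

lemma codeword_iff_leech: "2 *\<^sub>R nu_set A \<in> leech_lattice \<longleftrightarrow> A \<in> golay_code"
proof
  assume "2 *\<^sub>R nu_set A \<in> leech_lattice"
  then have A: "leech_coords (\<lambda>i. 2 * ind A i)"
    unfolding octad_vec ivec_in_leech_iff .
  have "{i. 2 * ind A i mod 4 = 2} \<in> golay_code"
    by (rule even_coords(2)[OF A, of None]) simp
  moreover have "{i. 2 * ind A i mod 4 = 2} = A"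
    by (auto simp: ind_def)
  ultimately show "A \<in> golay_code"
    by simp
qed (rule leech_codeword)

text \<open>The axis \<open>8\<nu>\<^sub>\<infinity>\<close> is fixed, so all axes are permuted up to signs by \<open>frame_neighbour\<close>. The signs are positive because
  \<open>c_star\<close> is fixed, whose coordinates on the axes that can move are all \<open>-1\<close>. The octad is seen from
  \<open>r_star\<close>.\<close>

lemma star_stabilizer_monomial:
  assumes g: "g \<in> co0" and stars: "\<And>s. s \<in> set stars \<Longrightarrow> g s = s"
  shows "\<exists>\<sigma>\<in>hexad_stab. g = perm_map \<sigma>"
proof -
  note lin = co0_linear[OF g]
  have pairs: "g (pair_vec 23 0) = pair_vec 23 0" "g (pair_vec 23 1) = pair_vec 23 1" "g (pair_vec 0 1) = pair_vec 0 1"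
    and gc: "g c_star = c_star" and gr: "g r_star = r_star"
    by (rule stars, simp add: stars_def)+
  have "g (8 *\<^sub>R nu (pt k)) = 8 *\<^sub>R nu (pt k)" if "k \<in> {23, 0, 1}" for k
    using that pairs
    by (auto simp only: insert_iff empty_iff frame_from_stars linear_add[OF lin] linear_diff[OF lin] simp_thms)
  then have fixnu: "g (nu (pt k)) = nu (pt k)" if "k \<in> {23, 0, 1}" for k
    using that by (simp add: linear_scale[OF lin])
  have c_nth: "c_star $ pt k = 3" if "k \<in> {23, 0, 1}" for k
    using that by (auto simp: c_star_def ind_def)
  have c_other: "c_star $ i = -1" if "i \<notin> pt ` {23, 0, 1}" for i
    using that by (simp add: c_star_def ind_def)
  have ex: "\<exists>j. g (nu i) = nu j" for i
  proof (cases "i \<in> pt ` {23, 0, 1}")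
    case True
    then show ?thesis
      using fixnu by blast
  next
    case False
    have ne: "i \<noteq> pt 23"
      using False by blast
    \<comment> \<open>The images of \<open>8\<nu>\<^sub>i\<close> and of half its sum with the fixed vector \<open>8\<nu>\<^sub>\<infinity>\<close>.\<close>
    let ?w = "g (8 *\<^sub>R nu i)"
    let ?y = "g (4 *\<^sub>R nu i + 4 *\<^sub>R nu (pt 23))"
    have "4 *\<^sub>R nu i + 4 *\<^sub>R nu (pt 23) = (4 *\<^sub>R nu i - 4 *\<^sub>R nu (pt 23)) + 8 *\<^sub>R nu (pt 23)"
      by (simp add: vec_eq_iff)
    then have "4 *\<^sub>R nu i + 4 *\<^sub>R nu (pt 23) \<in> leech_lattice"
      using leech_add[OF leech_4_diff[of i "pt 23"] leech_8[of "pt 23"]] by (simp only:)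
    then have y: "?y \<in> leech_lattice"
      by (rule co0_leech[OF g])
    have w: "2 *\<^sub>R ?y = ?w + 8 *\<^sub>R nu (pt 23)"
      using fixnu[of 23] by (simp add: linear_add[OF lin] linear_scale[OF lin] scaleR_right_distrib)
    have norm: "?w \<bullet> ?w = 64"
      unfolding co0_inner[OF g] by (simp add: nu_inner)
    have "?w \<bullet> g (nu (pt 23)) = 0"
      unfolding co0_inner[OF g] using ne by (simp add: nu_inner)
    then have orth: "?w \<bullet> nu (pt 23) = 0"
      using fixnu[of 23] by simp
    obtain j s where j: "s = 1 \<or> s = -1" "?w = (8 * s) *\<^sub>R nu j"
      using frame_neighbour[OF y w norm orth] by blast
    have "c_star \<bullet> ?w = c_star \<bullet> (8 *\<^sub>R nu i)"
      using co0_inner[OF g, of c_star "8 *\<^sub>R nu i"] by (simp only: gc)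
    then have "s * c_star $ j = -1"
      unfolding j(2) using c_other[OF False] by (simp add: inner_nu)
    moreover have "c_star $ j = 3 \<or> c_star $ j = -1"
      using c_nth c_other[of j] by (cases "j \<in> pt ` {23, 0, 1}") blast+
    ultimately have "s = 1"
      using j(1) by auto
    then have "8 *\<^sub>R g (nu i) = 8 *\<^sub>R nu j"
      using j(2) by (simp add: linear_scale[OF lin])
    then show ?thesis
      by auto
  qed
  then obtain \<sigma> where \<sigma>: "\<And>i. g (nu i) = nu (\<sigma> i)"
    by metis
  have nu_inj: "nu i = nu j \<longleftrightarrow> i = j" for i j
    by (metis nu_nth zero_neq_one)
  have "inj \<sigma>"
  proof (rule injI)
    fix i j assume "\<sigma> i = \<sigma> j"
    then have "g (nu i) \<bullet> g (nu j) = 1"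
      by (simp add: \<sigma> nu_inner)
    then show "i = j"
      unfolding co0_inner[OF g] nu_inner by (simp split: if_splits)
  qed
  then have b: "bij \<sigma>"
    by (simp add: bij_def finite_UNIV_inj_surj)
  have g_eq: "g = perm_map \<sigma>"
  proof
    fix x
    have "g x $ \<sigma> i = x $ i" for i
      using co0_inner[OF g, of x "nu i"] by (simp add: \<sigma> inner_nu)
    then show "g x = perm_map \<sigma> x"
      using perm_map_eqI[OF b, of "g x" x] by simp
  qed
  have set_image: "perm_map \<sigma> (2 *\<^sub>R nu_set A) = 2 *\<^sub>R nu_set (\<sigma> ` A)" for A
    using b by (intro perm_map_eqI) (auto simp: nu_set_nth ind_def bij_is_inj inj_image_mem_iff)
  have "inv' \<sigma> \<in> golay_aut"
  proof (rule golay_autI)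
    show "bij (inv' \<sigma>)"
      using b by (rule bij_imp_bij_inv)
    fix A assume "A \<in> golay_code"
    then have "g (2 *\<^sub>R nu_set A) \<in> leech_lattice"
      by (intro co0_leech[OF g] leech_codeword)
    then have "\<sigma> ` A \<in> golay_code"
      unfolding g_eq set_image codeword_iff_leech .
    moreover have "inv' \<sigma> -` A = \<sigma> ` A"
      using bij_vimage_eq_inv_image[OF bij_imp_bij_inv[OF b], of A] by (simp only: inv_inv_eq[OF b])
    ultimately show "inv' \<sigma> -` A \<in> golay_code"
      by simp
  qed
  from golay_aut_inv[OF this] have aut: "\<sigma> \<in> golay_aut"
    by (simp only: inv_inv_eq[OF b])
  have fixed: "\<sigma> (pt k) = pt k" if "k \<in> {23, 0, 1}" for k
    using fixnu[OF that] by (simp only: \<sigma> nu_inj)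
  have "r_star $ \<sigma> i = r_star $ i" for i
    using perm_map_nth[OF b, of r_star i] gr by (simp only: g_eq)
  moreover have r_one: "i \<in> hexad \<longleftrightarrow> r_star $ i = 1 \<and> i \<noteq> pt 23 \<and> i \<noteq> pt 0" for i
    by (auto simp: r_star_def std_octad_eq ind_def hexad_def hex_def pt_eq_iff)
  moreover have "\<sigma> i = pt k \<longleftrightarrow> i = pt k" if "k \<in> {23, 0, 1}" for i k
    using golay_aut_inj[OF aut, of i "pt k"] fixed[OF that] by simp
  ultimately have mem: "\<sigma> i \<in> hexad \<longleftrightarrow> i \<in> hexad" for i
    by simp
  have "\<sigma> ` hexad \<subseteq> hexad"
    using mem by blast
  then have "\<sigma> ` hexad = hexad"
    using b by (intro endo_inj_surj[OF finite]) (auto intro: inj_on_subset bij_is_inj)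
  then have "\<sigma> \<in> hexad_stab"
    using aut fixed by (simp add: hexad_stab_def)
  then show ?thesis
    using g_eq by blast
qed

lemma Aut_D_stab_carrier: "\<phi> \<in> carrier (Aut_D_stab R) \<longleftrightarrow> \<phi> \<in> Aut_D_carrier \<and> (\<forall>r\<in>R. \<phi> r = r)"
  and Aut_D_stab_mult: "\<phi> \<otimes>\<^bsub>Aut_D_stab R\<^esub> \<psi> = \<phi> \<circ> \<psi>"
  by (simp_all add: Aut_D_stab_def Aut_D_def)

definition star_roots :: "amb set" where
  "star_roots = leech_root ` set stars"

text \<open>The root of the lattice point 0 and the Weyl vector span the hyperbolic plane, whose orthogonal complement is the
  span of \<open>\<Lambda>\<close>. An isometry that fixes both acts on the complement only.\<close>

lemma star_stabilizer_lift:
  assumes \<phi>: "\<phi> \<in> Aut_D_carrier" and fixes_roots: "\<And>s. s \<in> set stars \<Longrightarrow> \<phi> (leech_root s) = leech_root s"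
  shows "\<exists>\<sigma>\<in>hexad_stab. \<phi> = linear_lift (perm_map \<sigma>)"
proof -
  note lin = Aut_D_linear[OF \<phi>]
  have z: "\<phi> (0, 1, -1) = (0, 1, -1)"
    using fixes_roots[of 0] by (simp add: stars_def leech_root_def)
  have w: "\<phi> (0, 0, 1) = (0, 0, 1)"
    using Aut_D_weyl[OF \<phi>] by (simp add: weyl_def)
  have hyp: "\<phi> (0, l, m) = (0, l, m)" for l m
  proof -
    have "(0, l, m) = l *\<^sub>R (0 :: real ^ P1, 1, -1) + (l + m) *\<^sub>R (0, 0, 1)"
      by simp
    then show ?thesis
      by (simp only: linear_add[OF lin] linear_scale[OF lin] z w)
  qed
  \<comment> \<open>The orthogonal complement of the hyperbolic plane is invariant.\<close>
  define g where "g x = fst (\<phi> (x, 0, 0))" for x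
  have \<phi>_x: "\<phi> (x, 0, 0) = (g x, 0, 0)" for x
  proof -
    obtain y l m where y: "\<phi> (x, 0, 0) = (y, l, m)"
      by (cases "\<phi> (x, 0, 0)")
    have "Pi_form (y, l, m) (0, 0, 1) = Pi_form (x, 0, 0) (0, 0, 1)" "Pi_form (y, l, m) (0, 1, 0) = Pi_form (x, 0, 0) (0, 1, 0)"
      using Aut_D_form[OF \<phi>, of "(x, 0, 0)"] hyp y by metis+
    then have "l = 0" "m = 0"
      by (simp_all add: Pi_form.simps leech_form_def)
    then show ?thesis
      by (simp add: g_def y)
  qed
  have lift: "\<phi> (x, l, m) = (g x, l, m)" for x l m
  proof -
    have "\<phi> ((x, 0, 0) + (0, l, m)) = (g x, 0, 0) + (0, l, m)"
      unfolding linear_add[OF lin] \<phi>_x hyp ..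
    then show ?thesis
      by simp
  qed
  have "g \<in> co0"
    unfolding co0_def
  proof (intro CollectI conjI allI)
    show "linear g"
    proof (rule linearI)
      show "g (x + y) = g x + g y" for x y
        using linear_add[OF lin, of "(x, 0, 0)" "(y, 0, 0)"] by (simp add: \<phi>_x)
      show "g (c *\<^sub>R x) = c *\<^sub>R g x" for c x
        using linear_scale[OF lin, of c "(x, 0, 0)"] by (simp add: \<phi>_x)
    qed
    show "g x \<bullet> g y = x \<bullet> y" for x y
      using Aut_D_form[OF \<phi>, of "(x, 0, 0)" "(y, 0, 0)"] by (simp add: \<phi>_x Pi_form.simps leech_form_def)
    have mem: "(x, 0, 0) \<in> Pi_lattice \<longleftrightarrow> x \<in> leech_lattice" for x
      by (simp add: Pi_lattice_def)
    have iff: "g x \<in> leech_lattice \<longleftrightarrow> x \<in> leech_lattice" for x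
      using inj_image_mem_iff[OF bij_is_inj[OF Aut_D_bij[OF \<phi>]], of "(x, 0, 0)" Pi_lattice]
      by (simp only: Aut_D_lattice[OF \<phi>] \<phi>_x mem)
    have "x \<in> g ` leech_lattice" if x: "x \<in> leech_lattice" for x
    proof -
      have "(x, 0, 0) \<in> \<phi> ` Pi_lattice"
        unfolding Aut_D_lattice[OF \<phi>] mem by (rule x)
      then obtain y l m where "(x, 0, 0) = \<phi> (y, l, m)"
        by auto
      then have "x = g y"
        by (simp add: lift)
      then show ?thesis
        using iff[of y] x by blast
    qed
    then show "g ` leech_lattice = leech_lattice"
      using iff by blast
  qed
  moreover have "g s = s" if "s \<in> set stars" for s
    using fixes_roots[OF that] by (simp add: leech_root_def lift)
  ultimately obtain \<sigma> where "\<sigma> \<in> hexad_stab" "g = perm_map \<sigma>"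
    using star_stabilizer_monomial by blast
  moreover have "\<phi> = linear_lift g"
    by (rule ext) (metis lift linear_lift_Pair prod_cases3)
  ultimately show ?thesis
    by blast
qed

theorem star_stabilizer_iso: "Aut_D_stab star_roots \<cong> alt_group 6"
proof -
  let ?L = "\<lambda>\<sigma>. linear_lift (perm_map \<sigma>)"
  have stab: "?L \<sigma> \<in> carrier (Aut_D_stab star_roots)" if \<sigma>: "\<sigma> \<in> hexad_stab" for \<sigma>
  proof -
    have g: "perm_map \<sigma> \<in> co0"
      using hexad_stab_aut[OF \<sigma>] by (rule perm_map_co0)
    then show ?thesis
      unfolding Aut_D_stab_carrier star_roots_def
      by (auto simp: linear_lift_Aut_D linear_lift_root perm_map_stars[OF \<sigma>])
  qed
  have "?L \<in> hom hexad_group (Aut_D_stab star_roots)"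
  proof (rule homI)
    show "?L \<sigma> \<in> carrier (Aut_D_stab star_roots)" if "\<sigma> \<in> carrier hexad_group" for \<sigma>
      using that stab by (simp add: hexad_group_def)
    fix \<sigma> \<tau> assume "\<sigma> \<in> carrier hexad_group" "\<tau> \<in> carrier hexad_group"
    then have "bij \<sigma>" "bij \<tau>"
      by (auto simp: hexad_group_def intro!: golay_aut_bij hexad_stab_aut)
    then show "?L (\<sigma> \<otimes>\<^bsub>hexad_group\<^esub> \<tau>) = ?L \<sigma> \<otimes>\<^bsub>Aut_D_stab star_roots\<^esub> ?L \<tau>"
      unfolding Aut_D_stab_mult by (intro ext) (simp add: hexad_group_def linear_lift_def perm_map_comp)
  qed
  moreover have "inj_on ?L hexad_stab"
  proof (rule inj_onI)
    fix \<sigma> \<tau> assume \<sigma>: "\<sigma> \<in> hexad_stab" and \<tau>: "\<tau> \<in> hexad_stab" and eq: "?L \<sigma> = ?L \<tau>"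
    have "nu (\<sigma> i) = nu (\<tau> i)" for i
      using fun_cong[OF eq, of "(nu i, 0, 0)"] perm_map_nu[OF hexad_stab_aut[OF \<sigma>], of i] perm_map_nu[OF hexad_stab_aut[OF \<tau>], of i]
      by simp
    then show "\<sigma> = \<tau>"
      by (intro ext) (metis nu_nth zero_neq_one)
  qed
  moreover have "?L ` hexad_stab = carrier (Aut_D_stab star_roots)"
  proof
    show "?L ` hexad_stab \<subseteq> carrier (Aut_D_stab star_roots)"
      using stab by blast
    show "carrier (Aut_D_stab star_roots) \<subseteq> ?L ` hexad_stab"
    proof
      fix \<phi> assume "\<phi> \<in> carrier (Aut_D_stab star_roots)"
      then show "\<phi> \<in> ?L ` hexad_stab"
        using star_stabilizer_lift[of \<phi>] by (auto simp: Aut_D_stab_carrier star_roots_def)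
    qed
  qed
  ultimately have "?L \<in> iso hexad_group (Aut_D_stab star_roots)"
    by (simp add: iso_def bij_betw_def hexad_group_def)
  then have "hexad_group \<cong> Aut_D_stab star_roots"
    by (rule is_isoI)
  then have "Aut_D_stab star_roots \<cong> hexad_group"
    by (rule group.iso_sym[OF hexad_group_is_group])
  then show ?thesis
    using hexad_group_iso by (rule iso_trans)
qed

section \<open>Transfer to the given roots\<close>

lemma diagram_to_stars:
  assumes "forms_A2A2A1A1 R"
  shows "\<exists>\<phi>\<in>Aut_D_carrier. \<phi> ` R = star_roots"
proof -
  obtain f :: "nat \<Rightarrow> amb" where R: "R \<subseteq> leech_roots" and f: "bij_betw f {0..<6} R"
    and form: "\<And>i j. i < 6 \<Longrightarrow> j < 6 \<Longrightarrow> i \<noteq> j \<Longrightarrow> Pi_form (f i) (f j) = (if {i, j} \<in> {{0, 1}, {2, 3}} then 1 else 0)"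
    using assms unfolding forms_A2A2A1A1_def forms_diagram_def by (auto simp del: One_nat_def)
  have "\<exists>x\<in>leech_lattice. f i = leech_root x" if "i < 6" for i
  proof -
    have "f i \<in> leech_root ` leech_lattice"
      using R bij_betw_apply[OF f, of i] that unfolding leech_roots_eq by auto
    then show ?thesis
      by blast
  qed
  then obtain X where X: "\<And>i. i < 6 \<Longrightarrow> X i \<in> leech_lattice" "\<And>i. i < 6 \<Longrightarrow> f i = leech_root (X i)"
    by metis
  \<comment> \<open>The lattice point of node 1 is moved to 0.\<close>
  define Y where "Y i = X i - X 1" for i
  have "config Y"
    unfolding config_def
  proof (intro conjI allI impI)
    show "Y i \<in> leech_lattice" if "i < 6" for i
      using X(1)[OF that] X(1)[of 1] by (simp add: Y_def leech_diff)
    show "(Y i - Y j) \<bullet> (Y i - Y j) = (if {i, j} \<in> {{0, 1}, {2, 3}} then 48 else 32)"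
      if ij: "i < 6" "j < 6" "i \<noteq> j" for i j
    proof -
      have "Y i - Y j = X i - X j"
        by (simp add: Y_def)
      moreover have "(X i - X j) \<bullet> (X i - X j) / 16 - 2 = (if {i, j} \<in> {{0, 1}, {2, 3}} then 1 else 0)"
        using form[OF ij] unfolding X(2)[OF ij(1)] X(2)[OF ij(2)] Pi_form_roots .
      ultimately show ?thesis
        by (simp split: if_splits)
    qed
  qed
  moreover have "Y 1 = 0"
    by (simp add: Y_def)
  ultimately obtain g where g: "g \<in> co0" "\<And>i. i < 6 \<Longrightarrow> g (Y i) = stars ! i"
    using config_normal_form by blast
  define \<phi> where "\<phi> = linear_lift g \<circ> translation (- X 1)"
  have mem: "\<phi> \<in> Aut_D_carrier"
    unfolding \<phi>_def using g(1) X(1)[of 1] by (intro Aut_D_comp linear_lift_Aut_D translation_Aut_D leech_minus) simp_all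
  have img: "\<phi> (f i) = leech_root (stars ! i)" if "i < 6" for i
    using g(2)[OF that] by (simp add: \<phi>_def X(2)[OF that] translation_root linear_lift_root[OF g(1)] Y_def)
  have "\<phi> ` R = \<phi> ` f ` {0..<6}"
    using f by (simp add: bij_betw_imp_surj_on)
  also have "\<dots> = (\<lambda>i. leech_root (stars ! i)) ` {0..<6}"
    unfolding image_image by (rule image_cong) (simp_all add: img)
  also have "\<dots> = leech_root ` (!) stars ` {0..<length stars}"
    by (simp add: image_image stars_def eval_nat_numeral)
  also have "(!) stars ` {0..<length stars} = set stars"
    by (auto simp: set_conv_nth)
  finally have "\<phi> ` R = star_roots"
    by (simp add: star_roots_def)
  with mem show ?thesis
    by blast
qed

lemma Aut_D_stab_conj:
  assumes \<phi>: "\<phi> \<in> Aut_D_carrier"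
  shows "Aut_D_stab R \<cong> Aut_D_stab (\<phi> ` R)"
proof -
  have b: "bij \<phi>"
    using \<phi> by (rule Aut_D_bij)
  let ?c = "\<lambda>\<psi>. \<phi> \<circ> \<psi> \<circ> inv' \<phi>"
  have inv[simp]: "inv' \<phi> (\<phi> x) = x" "\<phi> (inv' \<phi> x) = x" for x
    using b by (simp_all add: bij_is_inj bij_is_surj surj_f_inv_f)
  have closed: "?c \<psi> \<in> carrier (Aut_D_stab (\<phi> ` R))" if "\<psi> \<in> carrier (Aut_D_stab R)" for \<psi>
    using that \<phi> by (auto simp: Aut_D_stab_carrier intro!: Aut_D_comp Aut_D_inv)
  have "?c \<in> hom (Aut_D_stab R) (Aut_D_stab (\<phi> ` R))"
    by (rule homI) (use closed in \<open>auto simp: Aut_D_stab_mult fun_eq_iff\<close>)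
  moreover have "inj_on ?c (carrier (Aut_D_stab R))"
  proof (rule inj_onI)
    fix \<psi> \<theta> assume "?c \<psi> = ?c \<theta>"
    then have "inv' \<phi> (?c \<psi> (\<phi> x)) = inv' \<phi> (?c \<theta> (\<phi> x))" for x
      by simp
    then show "\<psi> = \<theta>"
      by (intro ext) simp
  qed
  moreover have "\<psi> \<in> ?c ` carrier (Aut_D_stab R)" if \<psi>: "\<psi> \<in> carrier (Aut_D_stab (\<phi> ` R))" for \<psi>
  proof (rule image_eqI)
    show "\<psi> = ?c (inv' \<phi> \<circ> \<psi> \<circ> \<phi>)"
      by (simp add: fun_eq_iff)
    show "inv' \<phi> \<circ> \<psi> \<circ> \<phi> \<in> carrier (Aut_D_stab R)"
      using \<psi> \<phi> by (auto simp: Aut_D_stab_carrier intro!: Aut_D_comp Aut_D_inv)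
  qed
  ultimately have "?c \<in> iso (Aut_D_stab R) (Aut_D_stab (\<phi> ` R))"
    using closed by (auto simp: iso_def bij_betw_def)
  then show ?thesis
    by (rule is_isoI)
qed

subsection \<open>The given roots form the diagram\<close>

text \<open>The coordinates of the lattice points of the six given roots, in the order \<open>c, z, x\<^sub>0, r\<^sub>0, x\<^sub>1, x\<^sub>2\<close>, in which joined
  roots have the indices 0, 1 and 2, 3.\<close>

definition R_lists :: "int list list" where
  "R_lists = [map (\<lambda>k. if k = 23 then 5 else 1) [0..<24], map (\<lambda>k. 0) [0..<24],
     map (\<lambda>k. if k = 23 \<or> k = 0 then 4 else 0) [0..<24],
     map (\<lambda>b. if b then 2 else 0) (points [23, 1, 2, 3, 4, 6, 15, 18]),
     map (\<lambda>b. if b then 2 else 0) (points [23, 0, 1, 2, 3, 5, 14, 17]),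
     map (\<lambda>b. if b then 2 else 0) (points [23, 0, 1, 2, 4, 13, 16, 22])]"

definition R_dist :: "nat \<Rightarrow> nat \<Rightarrow> int" where
  "R_dist i j = (\<Sum>k\<leftarrow>[0..<24]. (R_lists ! i ! k - R_lists ! j ! k) * (R_lists ! i ! k - R_lists ! j ! k))"

lemma R_lists_leech: "list_all leech_list R_lists"
  by code_simp

lemma R_dist_values:
  "map (\<lambda>i. map (R_dist i) [0..<6]) [0..<6] =
   [[0, 48, 32, 32, 32, 32], [48, 0, 32, 32, 32, 32], [32, 32, 0, 48, 32, 32],
    [32, 32, 48, 0, 32, 32], [32, 32, 32, 32, 0, 32], [32, 32, 32, 32, 32, 0]]"
  by code_simp

lemma lvec_dist: "(lvec L - lvec M) \<bullet> (lvec L - lvec M) = of_int (\<Sum>k\<leftarrow>[0..<24]. (L ! k - M ! k) * (L ! k - M ! k))"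
proof -
  have "lvec L - lvec M = ivec (\<lambda>x. L ! idx x - M ! idx x)"
    by (simp add: lvec_def ivec_diff)
  moreover have "(\<Sum>x\<in>UNIV. (L ! idx x - M ! idx x) * (L ! idx x - M ! idx x)) =
      (\<Sum>k\<leftarrow>[0..<24]. (L ! k - M ! k) * (L ! k - M ! k))"
    unfolding sum_P1 by (rule arg_cong[where f = sum_list], rule map_cong) (auto simp: idx_pt)
  ultimately show ?thesis
    by (simp only: ivec_inner)
qed

lemma octad_list_vec:
  assumes "list_all (\<lambda>k. k < 24) ks"
  shows "2 *\<^sub>R nu_set (pt ` set ks) = lvec (map (\<lambda>b. if b then 2 else 0) (points ks))"
proof (rule lvec_eqI)
  fix k :: nat assume k: "k < 24"
  have "pt k \<in> pt ` set ks \<longleftrightarrow> k \<in> set ks"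
    using assms k by (auto simp: list_all_iff pt_eq_iff)
  then show "(2 *\<^sub>R nu_set (pt ` set ks)) $ pt k = real_of_int (map (\<lambda>b. if b then 2 else 0) (points ks) ! k)"
    using k by (simp add: nu_set_nth ind_def nth_points)
qed

lemma upt_0_6: "[0..<6] = [0, 1, 2, 3, 4, 5::nat]"
  by code_simp

lemma roots_R_eq:
  "[root_c, root_z, root_x0, root_r0, root_x1, root_x2] = map (\<lambda>L. leech_root (lvec L)) R_lists"
proof -
  have None: "pt k = None \<longleftrightarrow> k = 23" if "k < 24" for k
    using that by (auto simp: pt_def)
  have Some0: "pt k = Some 0 \<longleftrightarrow> k = 0" if "k < 24" for k
    using pt_eq_iff[OF that, of 0] by (simp add: pt_def)
  have c: "4 *\<^sub>R nu None + nu_set UNIV = lvec (R_lists ! 0)"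
    by (rule lvec_eqI) (simp add: R_lists_def nu_nth nu_set_nth ind_def None del: upt_rec_numeral)
  have z: "0 = lvec (R_lists ! 1)"
    by (rule lvec_eqI) (simp add: R_lists_def del: upt_rec_numeral)
  have x0: "4 *\<^sub>R nu None + 4 *\<^sub>R nu (Some 0) = lvec (R_lists ! 2)"
    by (rule lvec_eqI) (simp add: R_lists_def nu_nth None Some0 del: upt_rec_numeral)
  have "K0 = pt ` set [23, 1, 2, 3, 4, 6, 15, 18]" "K1 = pt ` set [23, 0, 1, 2, 3, 5, 14, 17]" "K2 = pt ` set [23, 0, 1, 2, 4, 13, 16, 22]"
    by (simp_all add: K0_def K1_def K2_def pt_def insert_commute)
  then have r: "2 *\<^sub>R nu_set K0 = lvec (R_lists ! 3)" "2 *\<^sub>R nu_set K1 = lvec (R_lists ! 4)" "2 *\<^sub>R nu_set K2 = lvec (R_lists ! 5)"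
    by (simp_all add: R_lists_def octad_list_vec[simplified list_all_iff, symmetric])
  have sq: "lvec (R_lists ! i) \<bullet> lvec (R_lists ! i) = of_int (R_dist i 1)" for i
    using lvec_dist[of "R_lists ! i" "R_lists ! 1"] unfolding z[symmetric] R_dist_def by simp
  have vals: "R_dist 0 1 = 48" "R_dist 1 1 = 0" "R_dist 2 1 = 32" "R_dist 3 1 = 32" "R_dist 4 1 = 32" "R_dist 5 1 = 32"
    by code_simp+
  have "R_lists = map ((!) R_lists) [0..<6]"
    by (rule nth_equalityI) (simp_all add: R_lists_def del: upt_rec_numeral)
  then have "map (\<lambda>L. leech_root (lvec L)) R_lists = map (\<lambda>i. leech_root (lvec (R_lists ! i))) [0, 1, 2, 3, 4, 5]"
    by (metis (no_types, lifting) list.map_comp comp_apply map_cong upt_0_6)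
  then show ?thesis
    by (simp add: leech_root_def sq vals c[symmetric] x0[symmetric] r[symmetric] z[symmetric] root_c_def root_z_def root_x0_def root_r0_def root_x1_def root_x2_def
        del: One_nat_def)
qed

lemma roots_R_diagram: "forms_A2A2A1A1 roots_R"
proof -
  define X where "X i = lvec (R_lists ! i)" for i
  define f where "f i = leech_root (X i)" for i
  have len: "length R_lists = 6"
    by (simp add: R_lists_def)
  have mem: "X i \<in> leech_lattice" if "i < 6" for i
    using R_lists_leech that len by (auto simp: X_def list_all_length intro: leech_list)
  have dist: "(X i - X j) \<bullet> (X i - X j) = of_int (R_dist i j)" for i j
    by (simp only: X_def lvec_dist R_dist_def)
  have vals: "R_dist i j = (if i = j then 0 else if {i, j} \<in> {{0, 1}, {2, 3}} then 48 else 32)" if "i < 6" "j < 6" for i j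
  proof -
    have "R_dist i j = map (\<lambda>i. map (R_dist i) [0..<6]) [0..<6] ! i ! j"
      using that by (simp del: upt_rec_numeral)
    moreover have "i \<in> {0, 1, 2, 3, 4, 5}" "j \<in> {0, 1, 2, 3, 4, 5}"
      using that by auto
    ultimately show ?thesis
      unfolding R_dist_values by (elim insertE emptyE) (simp_all add: doubleton_eq_iff)
  qed
  have form: "Pi_form (f i) (f j) = (if {i, j} \<in> {{0, 1}, {2, 3}} then 1 else 0)" if "i < 6" "j < 6" "i \<noteq> j" for i j
    unfolding f_def Pi_form_roots dist vals[OF that(1,2)] using that(3) by simp
  have inj: "inj_on f {0..<6}"
  proof (rule inj_onI)
    fix i j :: nat assume ij: "i \<in> {0..<6}" "j \<in> {0..<6}" "f i = f j"
    show "i = j"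
    proof (rule ccontr)
      assume "i \<noteq> j"
      then have "Pi_form (f i) (f j) \<ge> 0"
        using form[of i j] ij by (simp split: if_splits)
      moreover have "Pi_form (f j) (f j) = -2"
        using root_self[OF root_in[OF mem]] ij(2) by (simp add: f_def)
      ultimately show False
        using ij(3) by simp
    qed
  qed
  have "roots_R = set [root_c, root_z, root_x0, root_r0, root_x1, root_x2]"
    by (simp add: roots_R_def)
  also have "\<dots> = (\<lambda>L. leech_root (lvec L)) ` set R_lists"
    by (simp only: roots_R_eq set_map)
  also have "set R_lists = (!) R_lists ` {0..<6}"
    using len by (auto simp: set_conv_nth)
  also have "(\<lambda>L. leech_root (lvec L)) ` (!) R_lists ` {0..<6} = f ` {0..<6}"
    by (simp add: image_image f_def X_def)
  finally have img: "f ` {0..<6} = roots_R" ..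
  have "roots_R \<subseteq> leech_roots"
    unfolding img[symmetric] using mem root_in by (auto simp: f_def)
  moreover have "bij_betw f {0..<6} roots_R"
    using inj img by (simp add: bij_betw_def)
  ultimately show ?thesis
    unfolding forms_A2A2A1A1_def forms_diagram_def using form by (intro conjI exI[of _ f] ballI impI) simp_all
qed

section \<open>Uniqueness of the diagram and its stabilizer\<close>

text \<open>The given roots form the diagram themselves, so they are equivalent to the normal form like any other diagram.
  Their pointwise stabilizer is conjugate to that of the normal form.\<close>

theorem theorem2p3:
  shows "(forms_A2A2A1A1 roots_R \<and>
           (\<forall>R'. forms_A2A2A1A1 R' \<longrightarrow> (\<exists>\<phi>\<in>carrier Aut_D. \<phi> ` R' = roots_R)))
         \<and> Aut_D_stab roots_R \<cong> alt_group 6"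
proof (intro conjI allI impI)
  show "forms_A2A2A1A1 roots_R"
    by (rule roots_R_diagram)
  obtain \<psi> where \<psi>: "\<psi> \<in> Aut_D_carrier" "\<psi> ` roots_R = star_roots"
    using diagram_to_stars[OF roots_R_diagram] by blast
  have from_stars: "inv' \<psi> ` star_roots = roots_R"
    using image_inv_f_f[OF bij_is_inj[OF Aut_D_bij[OF \<psi>(1)]], of roots_R] by (simp only: \<psi>(2))
  show "\<exists>\<phi>\<in>carrier Aut_D. \<phi> ` R' = roots_R" if "forms_A2A2A1A1 R'" for R'
  proof -
    obtain \<theta> where \<theta>: "\<theta> \<in> Aut_D_carrier" "\<theta> ` R' = star_roots"
      using diagram_to_stars[OF \<open>forms_A2A2A1A1 R'\<close>] by blast
    have "(inv' \<psi> \<circ> \<theta>) ` R' = roots_R"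
      by (simp only: image_comp[symmetric] \<theta>(2) from_stars)
    moreover have "inv' \<psi> \<circ> \<theta> \<in> carrier Aut_D"
      using \<psi>(1) \<theta>(1) by (simp add: Aut_D_def Aut_D_comp Aut_D_inv)
    ultimately show ?thesis
      by blast
  qed
  show "Aut_D_stab roots_R \<cong> alt_group 6"
    using iso_trans[OF Aut_D_stab_conj[OF \<psi>(1), of roots_R, unfolded \<psi>(2)] star_stabilizer_iso] .
qed

end
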